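(* Let $K$ be a field of characteristic $p>0$, $x\in K\setminus K^p$, and let $R$ be a discrete valuation ring over $K$ with residue field $L$ such that $R\otimes_K K(x^{1/p^\infty})$ is an integral domain, where $K(x^{1/p^\infty})=\bigcup_{n\geq1}K(x^{1/p^n})$. Let $R(1_x)$ be the normalization of $R\otimes_K K(x^{1/p})$ in its field of fractions, and suppose that $R(1_x)$ is finite over $R$. Let $L(1_x)$ be the residue field of the discrete valuation ring $R(1_x)$. Let $R(2_x)$ be the normalization of $R(1_x)\otimes_{K(x^{1/p})}K(x^{1/p^2})$ in its field of fractions, a discrete valuation ring with residue field $L(2_x)$. Suppose that $x^{1/p}\in L$, that $x^{1/p^2}\in L(1_x)$, and that $L$ is finite over $K$. Let $e_1$ be the ramification index of $R(1_x)$ over $R$, and $e_2$ the ramification index of $R(2_x)$ over $R(1_x)$ (each of them is $1$ or $p$). Put $$g_{10}=\dim_{K(x^{1/p})}\big(R(1_x)/(R\otimes_K K(x^{1/p}))\big),\qquad g_{21}=\dim_{K(x^{1/p^2})}\big(R(2_x)/(R(1_x)\otimes_{K(x^{1/p})} K(x^{1/p^2}))\big).$$ Then: 1. If $e_1=e_2=p$, then $pg_{21}=g_{10}$. 2. If $e_1=p$ and $e_2=1$, then $pg_{21}\leq g_{10}$. 3. If $e_1=e_2=1$, then $pg_{21}\leq g_{10}$. Moreover, the equality holds if $L(2_x)$ is a simple field extension over $L$. 4. If $e_1=1$ and $e_2=p$, then $pg_{21}+\frac{p(p-1)}{2}\leq g_{10}$.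
   Context: "$x^{1/p}\in L$" means that the image of $x$ in $L$ has a $p$-th root in $L$, and "$x^{1/p^2}\in L(1_x)$" that the image of $x$ in $L(1_x)$ has a $p^2$-th root in $L(1_x)$. Under the hypotheses, $R(2_x)$ is automatically finite over $R(1_x)$. *)

theory Defs
  imports
    "HOL-Algebra.Algebra"
    "HOL-Algebra.Algebraic_Closure_Type"
    "HOL-Computational_Algebra.Computational_Algebra"
    "HOL-Library.Poly_Mapping"
    "HOL-Library.Extended_Nat"
    "HOL-Library.FuncSet"
begin

text \<open>
  Rings are records of HOL-Algebra. A subset \<open>A\<close> of a type of class \<open>comm_ring_1\<close> is turned into
  such a record by restricting the carrier of \<open>ring_of_type_algebra\<close>. An algebra over a ring \<open>K\<close> is a
  ring together with its structure homomorphism.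
\<close>

abbreviation ring_on :: "'a::comm_ring_1 set \<Rightarrow> 'a ring"
  where "ring_on A \<equiv> ring_of_type_algebra\<lparr>carrier := A\<rparr>"


section \<open>Tensor products\<close>

text \<open>
  The tensor product of a \<open>K\<close>-algebra \<open>A\<close> (structure map \<open>f\<close>) and a \<open>K\<close>-algebra \<open>B\<close> (structure map
  \<open>g\<close>) is the free abelian group on \<open>carrier A \<times> carrier B\<close> modulo the following subgroup.
\<close>

inductive_set tensor_relations ::
  "'k ring \<Rightarrow> ('k \<Rightarrow> 'a) \<Rightarrow> 'a ring \<Rightarrow> ('k \<Rightarrow> 'b) \<Rightarrow> 'b ring \<Rightarrow> (('a \<times> 'b) \<Rightarrow>\<^sub>0 int) set"
  for K f A g B
where
  zero: "0 \<in> tensor_relations K f A g B"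
| diff: "u \<in> tensor_relations K f A g B \<Longrightarrow> v \<in> tensor_relations K f A g B \<Longrightarrow>
    u - v \<in> tensor_relations K f A g B"
| add_left: "a \<in> carrier A \<Longrightarrow> a' \<in> carrier A \<Longrightarrow> b \<in> carrier B \<Longrightarrow>
    Poly_Mapping.single (a \<oplus>\<^bsub>A\<^esub> a', b) 1 - Poly_Mapping.single (a, b) 1
      - Poly_Mapping.single (a', b) 1 \<in> tensor_relations K f A g B"
| add_right: "a \<in> carrier A \<Longrightarrow> b \<in> carrier B \<Longrightarrow> b' \<in> carrier B \<Longrightarrow>
    Poly_Mapping.single (a, b \<oplus>\<^bsub>B\<^esub> b') 1 - Poly_Mapping.single (a, b) 1
      - Poly_Mapping.single (a, b') 1 \<in> tensor_relations K f A g B"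
| scalar: "c \<in> carrier K \<Longrightarrow> a \<in> carrier A \<Longrightarrow> b \<in> carrier B \<Longrightarrow>
    Poly_Mapping.single (f c \<otimes>\<^bsub>A\<^esub> a, b) 1
      - Poly_Mapping.single (a, g c \<otimes>\<^bsub>B\<^esub> b) 1 \<in> tensor_relations K f A g B"

definition tensor_eval ::
  "'t ring \<Rightarrow> ('a \<Rightarrow> 't) \<Rightarrow> ('b \<Rightarrow> 't) \<Rightarrow> (('a \<times> 'b) \<Rightarrow>\<^sub>0 int) \<Rightarrow> 't"
  where "tensor_eval T i j u =
    (\<Oplus>\<^bsub>T\<^esub>q\<in>Poly_Mapping.keys u.
       add_pow T (Poly_Mapping.lookup u q) (i (fst q) \<otimes>\<^bsub>T\<^esub> j (snd q)))"

text \<open>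
  The commutative ring \<open>T\<close>, with \<open>i a\<close> and \<open>j b\<close> in the roles of \<open>a \<otimes> 1\<close> and \<open>1 \<otimes> b\<close>, is a tensor product
  of \<open>A\<close> and \<open>B\<close> over \<open>K\<close>: the canonical homomorphism from the free abelian group on
  \<open>carrier A \<times> carrier B\<close> to \<open>T\<close> is onto and its kernel is the subgroup of tensor relations. As \<open>i\<close> and
  \<open>j\<close> are ring homomorphisms, \<open>T\<close> then has the multiplication of the tensor product of algebras.
\<close>

definition is_tensor_product ::
  "'k ring \<Rightarrow> ('k \<Rightarrow> 'a) \<Rightarrow> 'a ring \<Rightarrow> ('k \<Rightarrow> 'b) \<Rightarrow> 'b ring
    \<Rightarrow> 't ring \<Rightarrow> ('a \<Rightarrow> 't) \<Rightarrow> ('b \<Rightarrow> 't) \<Rightarrow> bool"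
  where "is_tensor_product K f A g B T i j \<longleftrightarrow>
    cring T \<and> i \<in> ring_hom A T \<and> j \<in> ring_hom B T \<and>
    (\<forall>c\<in>carrier K. i (f c) = j (g c)) \<and>
    (let F = {u. Poly_Mapping.keys u \<subseteq> carrier A \<times> carrier B} in
      tensor_eval T i j ` F = carrier T \<and>
      {u \<in> F. tensor_eval T i j u = \<zero>\<^bsub>T\<^esub>} = tensor_relations K f A g B)"


section \<open>Normalization in the field of fractions\<close>

definition normalization :: "'t::idom fract set"
  where "normalization = {z. \<exists>q::'t poly. lead_coeff q = 1 \<and> poly (map_poly to_fract q) z = 0}"


section \<open>Discrete valuation rings\<close>

definition discrete_valuation_ring :: "'a ring \<Rightarrow> bool"
  where "discrete_valuation_ring R \<longleftrightarrow>
    principal_domain R \<and> \<not> field R \<and> (\<exists>!m. maximalideal m R)"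

text \<open>The following notions are meant for local rings; \<open>residue R\<close> is the projection onto the residue field.\<close>

definition max_ideal :: "'a ring \<Rightarrow> 'a set"
  where "max_ideal R = (THE m. maximalideal m R)"

definition residue_field :: "'a ring \<Rightarrow> 'a set ring"
  where "residue_field R = R Quot (max_ideal R)"

definition residue :: "'a ring \<Rightarrow> 'a \<Rightarrow> 'a set"
  where "residue R a = max_ideal R +>\<^bsub>R\<^esub> a"

definition uniformizer :: "'a ring \<Rightarrow> 'a \<Rightarrow> bool"
  where "uniformizer R t \<longleftrightarrow> t \<in> carrier R \<and> max_ideal R = PIdl\<^bsub>R\<^esub> t"

text \<open>The ramification index of \<open>f: A \<rightarrow> B\<close> is the valuation in \<open>B\<close> of a uniformizer of \<open>A\<close>.\<close>

definition ramification_index :: "('a \<Rightarrow> 'b) \<Rightarrow> 'a ring \<Rightarrow> 'b ring \<Rightarrow> nat"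
  where "ramification_index f A B = (THE e::nat. \<exists>t s. \<exists>u\<in>Units B.
    uniformizer A t \<and> uniformizer B s \<and> f t = u \<otimes>\<^bsub>B\<^esub> s [^]\<^bsub>B\<^esub> e)"


section \<open>Finiteness, dimension, simple extensions\<close>

text \<open>\<open>B\<close> is finitely generated as a module over \<open>A\<close> via \<open>f\<close>.\<close>

definition finite_over :: "('a \<Rightarrow> 'b) \<Rightarrow> 'a ring \<Rightarrow> 'b ring \<Rightarrow> bool"
  where "finite_over f A B \<longleftrightarrow> (\<exists>S. finite S \<and> S \<subseteq> carrier B \<and>
    (\<forall>b\<in>carrier B. \<exists>c\<in>S \<rightarrow> carrier A. b = (\<Oplus>\<^bsub>B\<^esub>s\<in>S. f (c s) \<otimes>\<^bsub>B\<^esub> s)))"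

text \<open>
  Let \<open>B\<close> be a vector space over the field \<open>K\<close> via \<open>f\<close>, and \<open>W\<close> a subspace. \<open>basis_mod f K B W S\<close>: the
  cosets of the elements of the finite set \<open>S\<close> are pairwise distinct and form a basis of \<open>B / W\<close>. The
  dimension is infinite if there is no finite basis (the infimum of the empty set is \<open>\<infinity>\<close>); otherwise
  all bases have the same cardinality.
\<close>

definition basis_mod :: "('k \<Rightarrow> 'b) \<Rightarrow> 'k ring \<Rightarrow> 'b ring \<Rightarrow> 'b set \<Rightarrow> 'b set \<Rightarrow> bool"
  where "basis_mod f K B W S \<longleftrightarrow> finite S \<and> S \<subseteq> carrier B \<and>
    (\<forall>b\<in>carrier B. \<exists>!c. c \<in> S \<rightarrow>\<^sub>E carrier K \<and>
       W +>\<^bsub>B\<^esub> b = W +>\<^bsub>B\<^esub> (\<Oplus>\<^bsub>B\<^esub>s\<in>S. f (c s) \<otimes>\<^bsub>B\<^esub> s))"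

definition quotient_dim :: "('k \<Rightarrow> 'b) \<Rightarrow> 'k ring \<Rightarrow> 'b ring \<Rightarrow> 'b set \<Rightarrow> enat"
  where "quotient_dim f K B W = Inf {enat (card S) | S. basis_mod f K B W S}"

definition simple_field_extension :: "'a ring \<Rightarrow> 'a set \<Rightarrow> bool"
  where "simple_field_extension E F \<longleftrightarrow>
    (\<exists>\<alpha>\<in>carrier E. generate_field E (insert \<alpha> F) = carrier E)"

end

theory Submission
  imports Defs "HOL-Number_Theory.Cong"
begin

text \<open>
  Let \<open>A\<close> be the image of \<open>R\<close> in the fraction field \<open>F(y)\<close>, where \<open>y\<^sup>p = x\<close>, let \<open>t\<close> be a uniformizer
  of \<open>A\<close> with valuation \<open>v\<close>, and let \<open>B\<close> be the normalization, which consists of the \<open>z\<close> with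
  \<open>z\<^sup>p \<in> A\<close>. By finiteness, \<open>v(x - a\<^sup>p)\<close> has a maximum \<open>m\<close> over \<open>a \<in> A\<close>. If it is attained at \<open>a\<close>, then
  the \<open>(y - a)\<^sup>i / t\<^sup>n\<close> with \<open>i < p\<close> and \<open>n = \<lfloor>i m / p\<rfloor>\<close> form a basis of \<open>B\<close> over \<open>A\<close>. So the step is
  ramified iff \<open>p\<close> does not divide \<open>m\<close>, and \<open>p g = d (\<Sum>i<p. \<lfloor>i m / p\<rfloor>)\<close> with \<open>d = [L : K]\<close>.

  Let \<open>m'\<close> be the corresponding number of the second step. As the \<open>p\<close>-th powers of elements of \<open>B\<close> lie
  in \<open>A\<close>, raising \<open>y - b\<^sup>p\<close> to the \<open>p\<close>-th power gives \<open>m' \<le> m\<close> if the first step is ramified and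
  \<open>p m' \<le> m\<close> otherwise. If both steps are ramified and \<open>m' < m\<close>, then \<open>m' = v((a - b\<^sup>p)\<^sup>p)\<close> would be a
  multiple of \<open>p\<close>. If none is ramified and \<open>p m' < m\<close>, then the \<open>p\<close>-th powers of \<open>L(2\<^sub>x)\<close> lie in \<open>L\<close>,
  although \<open>L(2\<^sub>x)\<close> has degree \<open>p\<^sup>2\<close> over \<open>L\<close>, so it is not simple over \<open>L\<close>. If the first step is
  unramified and \<open>m > 0\<close>, then \<open>A + t B\<close> is stable under multiplication by \<open>y\<close>, hence \<open>p\<close> divides \<open>d\<close>.
  The rest is a comparison of the sums of floors.
\<close>

section \<open>Relative dimension\<close>

text \<open>Write \<open>F(m)\<close> for the sum of the floors of \<open>i m / p\<close> over
  \<open>i < p\<close>. The remainders of \<open>i m\<close> modulo \<open>p\<close> give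
  \<open>2 F(m) = m (p - 1)\<close> if \<open>p\<close> divides \<open>m\<close> and
  \<open>2 F(m) = (m - 1) (p - 1)\<close> otherwise. The residue degree \<open>d1\<close> of
  \<open>B\<close> over \<open>K(y)\<close> satisfies \<open>p d1 = e d\<close>, where
  \<open>e = 1\<close> for a ramified step and \<open>e = p\<close> for an unramified one, and
  \<open>p g21 = d1 F(m')\<close>. So \<open>p g21 \<le> g10\<close> follows from
  \<open>e F(m') \<le> F(m)\<close>, with \<open>e m' \<le> m\<close> at hand. In the fourth case
  the factor \<open>m' - 1\<close> in place of \<open>m'\<close> leaves a gap of
  \<open>d (p - 1) / 2\<close>, and \<open>p \<le> d\<close> turns it into
  \<open>p (p - 1) / 2\<close>.

  The tensor products are given as abstract rings, and the two normalizations live in different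
  fraction fields. For this reason a step is a statement about subsets of one field, an injective
  homomorphism \<open>h\<close> carries the first normalization into the second field, and
  dimensions are chains of subspaces, which such maps transport.\<close>

definition subring_set :: "'f::comm_ring_1 set \<Rightarrow> bool"
  where "subring_set D \<longleftrightarrow> 1 \<in> D \<and> (\<forall>a\<in>D. \<forall>b\<in>D. a - b \<in> D \<and> a * b \<in> D)"

definition subfield_set :: "'f::field set \<Rightarrow> bool"
  where "subfield_set k \<longleftrightarrow> subring_set k \<and> (\<forall>a\<in>k. inverse a \<in> k)"

lemma subring_setD:
  assumes "subring_set D"
  shows subring_set_1: "1 \<in> D" and subring_set_0: "0 \<in> D"
    and subring_set_diff: "\<And>a b. a \<in> D \<Longrightarrow> b \<in> D \<Longrightarrow> a - b \<in> D"
    and subring_set_mult: "\<And>a b. a \<in> D \<Longrightarrow> b \<in> D \<Longrightarrow> a * b \<in> D"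
    and subring_set_uminus: "\<And>a. a \<in> D \<Longrightarrow> - a \<in> D"
    and subring_set_add: "\<And>a b. a \<in> D \<Longrightarrow> b \<in> D \<Longrightarrow> a + b \<in> D"
    and subring_set_power: "\<And>a n. a \<in> D \<Longrightarrow> a ^ n \<in> D"
    and subring_set_of_nat: "\<And>n. of_nat n \<in> D"
proof -
  show 1: "1 \<in> D" and d: "\<And>a b. a \<in> D \<Longrightarrow> b \<in> D \<Longrightarrow> a - b \<in> D"
    and m: "\<And>a b. a \<in> D \<Longrightarrow> b \<in> D \<Longrightarrow> a * b \<in> D"
    using assms unfolding subring_set_def by auto
  show 0: "0 \<in> D" using d[OF 1 1] by simp
  show u: "\<And>a. a \<in> D \<Longrightarrow> - a \<in> D" using d[OF 0] by simp
  show a: "\<And>a b. a \<in> D \<Longrightarrow> b \<in> D \<Longrightarrow> a + b \<in> D" using d u by (metis diff_minus_eq_add)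
  show "a ^ n \<in> D" if "a \<in> D" for a n by (induction n) (auto simp: 1 m that)
  show "of_nat n \<in> D" for n by (induction n) (auto simp: 0 1 a)
qed

lemma subring_set_sum:
  assumes "subring_set D" "\<And>i. i \<in> S \<Longrightarrow> f i \<in> D"
  shows "sum f S \<in> D"
  using assms(2)
  by (induction S rule: infinite_finite_induct)
     (auto simp: subring_set_0[OF assms(1)] intro!: subring_set_add[OF assms(1)])

lemma subring_set_prod:
  assumes "subring_set D" "\<And>i. i \<in> S \<Longrightarrow> f i \<in> D"
  shows "prod f S \<in> D"
  using assms(2)
  by (induction S rule: infinite_finite_induct)
     (auto simp: subring_set_1[OF assms(1)] intro!: subring_set_mult[OF assms(1)])

definition subspace_over :: "'f::comm_ring_1 set \<Rightarrow> 'f set \<Rightarrow> bool"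
  where "subspace_over k W \<longleftrightarrow> 0 \<in> W \<and> (\<forall>a\<in>W. \<forall>b\<in>W. a + b \<in> W) \<and> (\<forall>c\<in>k. \<forall>a\<in>W. c * a \<in> W)"

lemma subspace_overD:
  assumes "subspace_over k W"
  shows subspace_over_0: "0 \<in> W"
    and subspace_over_add: "\<And>a b. a \<in> W \<Longrightarrow> b \<in> W \<Longrightarrow> a + b \<in> W"
    and subspace_over_scale: "\<And>c a. c \<in> k \<Longrightarrow> a \<in> W \<Longrightarrow> c * a \<in> W"
  using assms unfolding subspace_over_def by auto

lemma subspace_over_diff:
  assumes "subspace_over k W" "subring_set k" "a \<in> W" "b \<in> W"
  shows "a - b \<in> W"
proof -
  have "(-1) * b \<in> W"
    using assms by (intro subspace_over_scale[OF assms(1)] subring_set_uminus subring_set_1)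
  from subspace_over_add[OF assms(1) assms(3) this] show ?thesis by simp
qed

lemma subspace_over_sum:
  assumes "subspace_over k W" "\<And>i. i \<in> S \<Longrightarrow> f i \<in> W"
  shows "sum f S \<in> W"
  using assms(2)
  by (induction S rule: infinite_finite_induct)
     (auto simp: subspace_over_0[OF assms(1)] intro!: subspace_over_add[OF assms(1)])

text \<open>The space \<open>W + k v\<close>: one line is added to a vector space, no ring is
  generated.\<close>

definition adjoin :: "'f::comm_ring_1 set \<Rightarrow> 'f set \<Rightarrow> 'f \<Rightarrow> 'f set"
  where "adjoin k W v = {w + c * v | w c. w \<in> W \<and> c \<in> k}"

lemma subset_adjoin: "subring_set k \<Longrightarrow> W \<subseteq> adjoin k W v"
  unfolding adjoin_def using subring_set_0 by force

lemma mem_adjoin: "subring_set k \<Longrightarrow> 0 \<in> W \<Longrightarrow> v \<in> adjoin k W v"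
  unfolding adjoin_def using subring_set_1 by force



lemma subspace_adjoin:
  assumes "subring_set k" "subspace_over k W"
  shows "subspace_over k (adjoin k W v)"
  unfolding subspace_over_def
proof (intro conjI ballI)
  show "0 \<in> adjoin k W v" using subset_adjoin[OF assms(1)] subspace_over_0[OF assms(2)] by blast
next
  fix a b assume "a \<in> adjoin k W v" "b \<in> adjoin k W v"
  then obtain w c w' c' where *: "a = w + c * v" "b = w' + c' * v" "w \<in> W" "w' \<in> W" "c \<in> k" "c' \<in> k"
    unfolding adjoin_def by blast
  have "a + b = (w + w') + (c + c') * v" using * by (simp add: algebra_simps)
  then show "a + b \<in> adjoin k W v"
    unfolding adjoin_def using * subspace_over_add[OF assms(2)] subring_set_add[OF assms(1)] by blast
next
  fix c a assume "c \<in> k" "a \<in> adjoin k W v"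
  then obtain w c' where *: "a = w + c' * v" "w \<in> W" "c' \<in> k"
    unfolding adjoin_def by blast
  have "c * a = c * w + (c * c') * v" using * by (simp add: algebra_simps)
  then show "c * a \<in> adjoin k W v"
    unfolding adjoin_def
    using * \<open>c \<in> k\<close> subspace_over_scale[OF assms(2)] subring_set_mult[OF assms(1)] by blast
qed

lemma adjoin_least:
  assumes "subspace_over k W" "U \<subseteq> W" "v \<in> W"
  shows "adjoin k U v \<subseteq> W"
  unfolding adjoin_def using assms subspace_overD[OF assms(1)] by blast

lemma adjoin_absorb:
  assumes "subring_set k" "subspace_over k W" "v \<in> W"
  shows "adjoin k W v = W"
  using adjoin_least[OF assms(2) order_refl assms(3)] subset_adjoin[OF assms(1)] by blast

lemma adjoin_commute:
  assumes "subring_set k"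
  shows "adjoin k (adjoin k W u) v = adjoin k (adjoin k W v) u"
proof -
  have "adjoin k (adjoin k W u) v \<subseteq> adjoin k (adjoin k W v) u" for u v
  proof
    fix z assume "z \<in> adjoin k (adjoin k W u) v"
    then obtain w c c' where "z = (w + c * u) + c' * v" "w \<in> W" "c \<in> k" "c' \<in> k"
      unfolding adjoin_def by blast
    then have "z = (w + c' * v) + c * u" by (simp add: algebra_simps)
    with \<open>w \<in> W\<close> \<open>c \<in> k\<close> \<open>c' \<in> k\<close> show "z \<in> adjoin k (adjoin k W v) u"
      unfolding adjoin_def by blast
  qed
  then show ?thesis by blast
qed

text \<open>Steinitz exchange. The coefficient of \<open>v\<close> in \<open>u\<close> cannot vanish
  since \<open>u\<close> is outside \<open>W\<close>, and it can be inverted because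
  \<open>k\<close> is a field.\<close>

lemma adjoin_exchange:
  fixes k :: "'f::field set"
  assumes "subfield_set k" "subspace_over k W" "u \<in> adjoin k W v" "u \<notin> W"
  shows "adjoin k W u = adjoin k W v"
proof -
  have k: "subring_set k" using assms(1) unfolding subfield_set_def by simp
  obtain w c where *: "u = w + c * v" "w \<in> W" "c \<in> k" using assms(3) unfolding adjoin_def by blast
  with assms(4) have "c \<noteq> 0" by auto
  have "- (inverse c * w) \<in> W"
    using * assms(1) subspace_over_scale[OF assms(2), of "inverse c" w]
      subspace_over_diff[OF assms(2) k subspace_over_0[OF assms(2)], of "inverse c * w"]
    unfolding subfield_set_def by auto
  moreover have "v = - (inverse c * w) + inverse c * u" using * \<open>c \<noteq> 0\<close> by (simp add: field_simps)
  ultimately have "v \<in> adjoin k W u"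
    using * assms(1) unfolding adjoin_def subfield_set_def by blast
  then have "adjoin k W v \<subseteq> adjoin k W u"
    by (intro adjoin_least subspace_adjoin k assms(2) subset_adjoin)
  moreover have "adjoin k W u \<subseteq> adjoin k W v"
    by (intro adjoin_least subspace_adjoin k assms(2) subset_adjoin assms(3))
  ultimately show ?thesis by blast
qed

text \<open>\<open>qdim k V W n\<close> says that the dimension of \<open>V / W\<close> over \<open>k\<close> is \<open>n\<close>.\<close>

inductive qdim :: "'f::comm_ring_1 set \<Rightarrow> 'f set \<Rightarrow> 'f set \<Rightarrow> nat \<Rightarrow> bool" for k where
  refl: "qdim k W W 0"
| adjoin: "qdim k V W n \<Longrightarrow> v \<notin> V \<Longrightarrow> qdim k (adjoin k V v) W (Suc n)"

lemma qdim_subset: "qdim k V W n \<Longrightarrow> subring_set k \<Longrightarrow> W \<subseteq> V"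
  by (induction rule: qdim.induct) (use subset_adjoin in blast)+

lemma qdim_subspace: "qdim k V W n \<Longrightarrow> subring_set k \<Longrightarrow> subspace_over k W \<Longrightarrow> subspace_over k V"
  by (induction rule: qdim.induct) (auto intro: subspace_adjoin)

lemma qdim_trans: "qdim k V U n \<Longrightarrow> qdim k U W m \<Longrightarrow> qdim k V W (n + m)"
  by (induction rule: qdim.induct) (auto intro: qdim.intros)

lemma qdim_0D: "qdim k V W 0 \<Longrightarrow> V = W"
  by (auto elim: qdim.cases)

text \<open>A chain from \<open>W\<close> to \<open>V\<close> can be rearranged to start with any
  prescribed vector \<open>v\<close>. The vector of the chain whose adjunction first captures
  \<open>v\<close> is the one that \<open>v\<close> replaces.\<close>

lemma qdim_drop:
  fixes k :: "'f::field set"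
  assumes "qdim k V W (Suc n)" "subfield_set k" "subspace_over k W" "v \<in> V" "v \<notin> W"
  shows "qdim k V (adjoin k W v) n"
proof -
  have k: "subring_set k" using assms(2) unfolding subfield_set_def by simp
  \<comment> \<open>As long as \<open>v\<close> lies outside \<open>V\<close>, adding it to every
    member of the chain keeps all inclusions strict.\<close>
  have shift: "qdim k (adjoin k V v) (adjoin k W v) n"
    if "qdim k V W n" "v \<notin> V" "subspace_over k W" for V W n
    using that
  proof (induction rule: qdim.induct)
    case (refl W) show ?case by (rule qdim.refl)
  next
    case (adjoin V W n u)
    have V: "subspace_over k V" using qdim_subspace[OF adjoin(1) k adjoin.prems(2)] .
    have "v \<notin> V" using adjoin.prems(1) subset_adjoin[OF k] by blast
    have "u \<notin> adjoin k V v"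
    proof
      assume "u \<in> adjoin k V v"
      then have "adjoin k V u = adjoin k V v" by (rule adjoin_exchange[OF assms(2) V _ adjoin(2)])
      with adjoin.prems(1) mem_adjoin[OF k subspace_over_0[OF V]] show False by blast
    qed
    from qdim.adjoin[OF adjoin.IH[OF \<open>v \<notin> V\<close> adjoin.prems(2)] this] show ?case
      by (simp add: adjoin_commute[OF k])
  qed
  show ?thesis using assms(1,3,4,5)
  proof (induction V W "Suc n" arbitrary: n rule: qdim.induct)
    case (adjoin V W m u)
    have V: "subspace_over k V" using qdim_subspace[OF adjoin(1) k adjoin.prems(1)] .
    show ?case
    proof (cases "v \<in> V")
      case True
      with adjoin.prems(3) adjoin(1) obtain m' where "m = Suc m'"
        by (metis qdim_0D not0_implies_Suc)
      from adjoin.hyps(2)[OF this adjoin.prems(1) True adjoin.prems(3)] \<open>m = Suc m'\<close> adjoin.hyps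
      show ?thesis by (auto intro: qdim.adjoin)
    next
      case False
      with adjoin.prems(2) have "adjoin k V v = adjoin k V u"
        by (intro adjoin_exchange[OF assms(2) V])
      with shift[OF adjoin(1) False adjoin.prems(1)] show ?thesis using adjoin.hyps by simp
    qed
  qed
qed

text \<open>Invariance of dimension: dividing out one common vector shortens both chains by
  one.\<close>

lemma qdim_unique:
  fixes k :: "'f::field set"
  assumes "subfield_set k" "subspace_over k W" "qdim k V W n" "qdim k V W m"
  shows "n = m"
  using assms(2-)
proof (induction n arbitrary: m W)
  case 0
  have k: "subring_set k" using assms(1) unfolding subfield_set_def by simp
  from 0 have "V = W" using qdim_0D by blast
  show ?case
  proof (cases m)
    case (Suc m')
    from 0(3)[unfolded Suc] show ?thesis
    proof cases
      case (adjoin V' v)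
      with \<open>V = W\<close> qdim_subset[OF _ k] mem_adjoin[OF k subspace_over_0[OF qdim_subspace[OF _ k 0(1)]]]
      show ?thesis by blast
    qed
  qed simp
next
  case (Suc n)
  have k: "subring_set k" using assms(1) unfolding subfield_set_def by simp
  from Suc.prems(2) obtain V' v where V': "V = adjoin k V' v" "v \<notin> V'" "qdim k V' W n"
    by (auto elim: qdim.cases)
  then have v: "v \<in> V" "v \<notin> W"
    using qdim_subset[OF V'(3) k] mem_adjoin[OF k subspace_over_0[OF qdim_subspace[OF V'(3) k Suc.prems(1)]]]
    by auto
  then obtain m' where m': "m = Suc m'" using Suc.prems(3) by (metis qdim_0D not0_implies_Suc)
  have "n = m'"
    using Suc.IH[OF subspace_adjoin[OF k Suc.prems(1)]
        qdim_drop[OF Suc.prems(2) assms(1) Suc.prems(1) v]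
        qdim_drop[OF Suc.prems(3)[unfolded m'] assms(1) Suc.prems(1) v]] .
  with m' show ?case by simp
qed

section \<open>Semilinear maps and change of scalars\<close>

definition sum_set :: "'f::comm_ring_1 set \<Rightarrow> 'f set \<Rightarrow> 'f set"
  where "sum_set U V = {u + v | u v. u \<in> U \<and> v \<in> V}"

lemma subspace_sum_set:
  assumes "subspace_over k U" "subspace_over k V"
  shows "subspace_over k (sum_set U V)"
  unfolding subspace_over_def
proof (intro conjI ballI)
  show "0 \<in> sum_set U V"
    using assms[THEN subspace_over_0] unfolding sum_set_def by force
next
  fix a b assume "a \<in> sum_set U V" "b \<in> sum_set U V"
  then obtain u v u' v' where *: "a = u + v" "b = u' + v'" "u \<in> U" "u' \<in> U" "v \<in> V" "v' \<in> V"
    unfolding sum_set_def by blast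
  have "a + b = (u + u') + (v + v')" using * by (simp add: algebra_simps)
  with * show "a + b \<in> sum_set U V"
    unfolding sum_set_def using assms[THEN subspace_over_add] by blast
next
  fix c a assume "c \<in> k" "a \<in> sum_set U V"
  then show "c * a \<in> sum_set U V"
    unfolding sum_set_def using assms[THEN subspace_over_scale] by (auto simp: distrib_left; metis)
qed



text \<open>On the target side \<open>N\<close> is divided out by adding it to both spaces, so no
  quotient has to be formed, and \<open>ker\<close> says that \<open>h\<close> is injective from
  \<open>V / W\<close> to the target modulo \<open>N\<close>. The scalars may change along \<sigma>,
  which allows a passage from one fraction field to another.\<close>

lemma qdim_transport:
  fixes h :: "'f::comm_ring_1 \<Rightarrow> 'g::comm_ring_1"
  assumes "qdim k V W n" "subring_set k" "subspace_over k W" "subspace_over (\<sigma> ` k) N"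
    and add: "\<And>a b. a \<in> V \<Longrightarrow> b \<in> V \<Longrightarrow> h (a + b) = h a + h b"
    and scale: "\<And>c a. c \<in> k \<Longrightarrow> a \<in> V \<Longrightarrow> h (c * a) = \<sigma> c * h a"
    and ker: "\<And>v. v \<in> V \<Longrightarrow> h v \<in> N \<Longrightarrow> v \<in> W"
  shows "qdim (\<sigma> ` k) (sum_set N (h ` V)) (sum_set N (h ` W)) n"
  using assms(1,3,5-)
proof (induction rule: qdim.induct)
  case (refl W) show ?case by (rule qdim.refl)
next
  case (adjoin V W n v)
  note k = assms(2)
  have V: "subspace_over k V" using qdim_subspace[OF adjoin(1) k adjoin.prems(1)] .
  note sub = subset_adjoin[OF k, of V v]
  have vV: "v \<in> adjoin k V v" using mem_adjoin[OF k subspace_over_0[OF V]] .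
  have av: "subspace_over k (adjoin k V v)" by (rule subspace_adjoin[OF k V])
  have "qdim (\<sigma> ` k) (sum_set N (h ` V)) (sum_set N (h ` W)) n"
    using sub by (intro adjoin.IH adjoin.prems) auto
  moreover have "h v \<notin> sum_set N (h ` V)"
  proof
    assume "h v \<in> sum_set N (h ` V)"
    then obtain a b where ab: "h v = a + h b" "a \<in> N" "b \<in> V" unfolding sum_set_def by blast
    have d: "v - b \<in> adjoin k V v"
      using ab sub vV by (intro subspace_over_diff[OF av k]) auto
    have "h v = h (v - b) + h b" using adjoin.prems(2)[OF d, of b] ab sub by auto
    with ab have "h (v - b) \<in> N" by simp
    then have "v - b \<in> W" using adjoin.prems(4) d by blast
    then have "v - b \<in> V" using qdim_subset[OF adjoin(1) k] by blast
    from subspace_over_add[OF V this ab(3)] adjoin(2) show False by simp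
  qed
  ultimately have "qdim (\<sigma> ` k) (adjoin (\<sigma> ` k) (sum_set N (h ` V)) (h v)) (sum_set N (h ` W)) (Suc n)"
    by (rule qdim.adjoin)
  moreover have "adjoin (\<sigma> ` k) (sum_set N (h ` V)) (h v) = sum_set N (h ` adjoin k V v)"
  proof (intro equalityI subsetI)
    fix z assume "z \<in> adjoin (\<sigma> ` k) (sum_set N (h ` V)) (h v)"
    then obtain a b c where *: "z = (a + h b) + \<sigma> c * h v" "a \<in> N" "b \<in> V" "c \<in> k"
      unfolding adjoin_def sum_set_def by blast
    have "h (b + c * v) = h b + \<sigma> c * h v"
      using * adjoin.prems(2)[of b "c * v"] adjoin.prems(3)[of c v] sub vV
        subspace_over_scale[OF av] by auto
    then have "z = a + h (b + c * v)" using * by (simp add: algebra_simps)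
    with * show "z \<in> sum_set N (h ` adjoin k V v)" unfolding sum_set_def adjoin_def by blast
  next
    fix z assume "z \<in> sum_set N (h ` adjoin k V v)"
    then obtain a b c where *: "z = a + h (b + c * v)" "a \<in> N" "b \<in> V" "c \<in> k"
      unfolding sum_set_def adjoin_def by blast
    have "h (b + c * v) = h b + \<sigma> c * h v"
      using * adjoin.prems(2)[of b "c * v"] adjoin.prems(3)[of c v] sub vV
        subspace_over_scale[OF av] by auto
    then have "z = (a + h b) + \<sigma> c * h v" using * by (simp add: algebra_simps)
    with * show "z \<in> adjoin (\<sigma> ` k) (sum_set N (h ` V)) (h v)"
      unfolding adjoin_def sum_set_def by blast
  qed
  ultimately show ?case by simp
qed

lemma qdim_image:
  fixes h :: "'f::comm_ring_1 \<Rightarrow> 'g::comm_ring_1"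
  assumes "qdim k V W n" "subring_set k" "subspace_over k W"
    and add: "\<And>a b. a \<in> V \<Longrightarrow> b \<in> V \<Longrightarrow> h (a + b) = h a + h b"
    and scale: "\<And>c a. c \<in> k \<Longrightarrow> a \<in> V \<Longrightarrow> h (c * a) = \<sigma> c * h a"
    and ker: "\<And>v. v \<in> V \<Longrightarrow> h v = 0 \<Longrightarrow> v \<in> W"
  shows "qdim (\<sigma> ` k) (h ` V) (h ` W) n"
proof -
  have "qdim (\<sigma> ` k) (sum_set {0} (h ` V)) (sum_set {0} (h ` W)) n"
    by (rule qdim_transport[OF assms(1-3)]) (use assms in \<open>auto simp: subspace_over_def\<close>)
  then show ?thesis by (simp add: sum_set_def Setcompr_eq_image image_image)
qed

text \<open>Turns finite generation into a dimension. The minimality of \<open>V\<close> later keeps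
  it inside the ring whose residue field is spanned.\<close>

lemma qdim_exists_span:
  assumes "subring_set k" "subspace_over k W" "finite S"
  shows "\<exists>n V. qdim k V W n \<and> S \<subseteq> V \<and> (\<forall>U. subspace_over k U \<longrightarrow> W \<subseteq> U \<longrightarrow> S \<subseteq> U \<longrightarrow> V \<subseteq> U)"
  using assms(3)
proof (induction S)
  case empty
  then show ?case using qdim.refl by blast
next
  case (insert s S)
  then obtain n V where IH: "qdim k V W n" "S \<subseteq> V"
    "\<And>U. subspace_over k U \<Longrightarrow> W \<subseteq> U \<Longrightarrow> S \<subseteq> U \<Longrightarrow> V \<subseteq> U" by metis
  show ?case
  proof (cases "s \<in> V")
    case True
    then show ?thesis using IH by (intro exI[of _ n] exI[of _ V]) auto
  next
    case False
    have V: "subspace_over k V" using qdim_subspace[OF IH(1) assms(1,2)] .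
    have "insert s S \<subseteq> adjoin k V s"
      using mem_adjoin[OF assms(1) subspace_over_0[OF V]] subset_adjoin[OF assms(1)] IH(2) by blast
    then show ?thesis using qdim.adjoin[OF IH(1) False] IH adjoin_least by (metis insert_subset)
  qed
qed

text \<open>When \<open>U\<close> is added to every member of the chain, each inclusion either stays
  strict or collapses, hence only an inequality.\<close>

lemma qdim_intermediate:
  fixes k :: "'f::field set"
  assumes "qdim k V W n" "subfield_set k" "subspace_over k W" "subspace_over k U"
  shows "\<exists>m\<le>n. qdim k (sum_set U V) (sum_set U W) m"
  using assms(1,3)
proof (induction rule: qdim.induct)
  case (refl W)
  then show ?case using qdim.refl by blast
next
  case (adjoin V W n v)
  have k: "subring_set k" using assms(2) unfolding subfield_set_def by simp
  have eq: "sum_set U (adjoin k V v) = adjoin k (sum_set U V) v"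
    unfolding sum_set_def adjoin_def by (auto simp: add.assoc; metis add.assoc)
  from adjoin obtain m where m: "m \<le> n" "qdim k (sum_set U V) (sum_set U W) m" by blast
  have V: "subspace_over k V" using qdim_subspace[OF adjoin(1) k adjoin.prems] .
  show ?case
  proof (cases "v \<in> sum_set U V")
    case True
    then have "sum_set U (adjoin k V v) = sum_set U V"
      unfolding eq by (intro adjoin_absorb[OF k] subspace_sum_set assms(4) V)
    then show ?thesis using m le_SucI by metis
  next
    case False
    then show ?thesis unfolding eq using qdim.adjoin[OF m(2) False] m(1) by blast
  qed
qed

lemma sum_set_absorb:
  assumes "subspace_over k V" "0 \<in> U" "U \<subseteq> V"
  shows "sum_set U V = V"
proof (intro equalityI subsetI)
  fix v assume "v \<in> V"
  moreover have "v = 0 + v" by simp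
  ultimately show "v \<in> sum_set U V" unfolding sum_set_def using assms(2) by blast
qed (use assms subspace_over_add[OF assms(1)] in \<open>auto simp: sum_set_def\<close>)

lemma sum_set_absorb2:
  assumes "subspace_over k V" "0 \<in> U" "U \<subseteq> V"
  shows "sum_set V U = V"
proof (intro equalityI subsetI)
  fix v assume "v \<in> V"
  moreover have "v = v + 0" by simp
  ultimately show "v \<in> sum_set V U" unfolding sum_set_def using assms(2) by blast
qed (use assms subspace_over_add[OF assms(1)] in \<open>auto simp: sum_set_def\<close>)

text \<open>One vector of \<open>U\<close> outside \<open>W\<close> is divided out before the rest
  of \<open>U\<close>; this first division makes the inequality strict.\<close>

lemma qdim_larger:
  fixes k :: "'f::field set"
  assumes "qdim k V W n" "subfield_set k" "subspace_over k W" "subspace_over k U" "W \<subset> U" "U \<subseteq> V"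
  shows "\<exists>m<n. qdim k V U m"
proof -
  have k: "subring_set k" using assms(2) unfolding subfield_set_def by simp
  obtain v where v: "v \<in> U" "v \<notin> W" using assms(5) by blast
  obtain n' where n': "n = Suc n'" using v assms(1,6) by (metis qdim_0D not0_implies_Suc subsetD)
  have drop: "qdim k V (adjoin k W v) n'"
    using qdim_drop[OF assms(1)[unfolded n'] assms(2,3) _ v(2)] v(1) assms(6) by blast
  obtain m where m: "m \<le> n'" "qdim k (sum_set U V) (sum_set U (adjoin k W v)) m"
    using qdim_intermediate[OF drop assms(2) subspace_adjoin[OF k assms(3)] assms(4)] by blast
  have "sum_set U V = V"
    by (intro sum_set_absorb[of k] qdim_subspace[OF assms(1) k assms(3)] assms subspace_over_0[OF assms(4)])
  moreover have "sum_set U (adjoin k W v) = U"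
    using assms(3,5) v k
    by (intro sum_set_absorb2[of k] assms adjoin_least subspace_over_0[OF subspace_adjoin[OF k assms(3)]])
       auto
  ultimately show ?thesis using m n' by (metis le_imp_less_Suc)
qed

text \<open>A whole line over \<open>k1\<close> is adjoined at a time. It strictly enlarges
  \<open>W\<close>, so the dimension over \<open>k\<close> of what remains drops and the process
  stops.\<close>

lemma qdim_coarser_field:
  fixes k :: "'f::field set"
  assumes "qdim k V W n" "subfield_set k" "subfield_set k1" "k \<subseteq> k1"
    "subspace_over k1 W" "subspace_over k1 V"
  shows "\<exists>m. qdim k1 V W m"
  using assms(1,5)
proof (induction n arbitrary: W rule: less_induct)
  case (less n)
  have k1: "subring_set k1" and k: "subring_set k" using assms(2,3) unfolding subfield_set_def by simp_all
  have sub: "subspace_over k U" if "subspace_over k1 U" for U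
    using that assms(4) unfolding subspace_over_def by blast
  show ?case
  proof (cases "V = W")
    case True
    then show ?thesis using qdim.refl by blast
  next
    case False
    then obtain v where v: "v \<in> V" "v \<notin> W" using qdim_subset[OF less.prems(1) k] by blast
    let ?U = "adjoin k1 W v"
    have U: "subspace_over k1 ?U" by (intro subspace_adjoin k1 less.prems)
    have WU: "W \<subset> ?U"
      using subset_adjoin[OF k1] mem_adjoin[OF k1 subspace_over_0[OF less.prems(2)]] v by blast
    have "?U \<subseteq> V" using adjoin_least[OF assms(6) qdim_subset[OF less.prems(1) k] v(1)] .
    then obtain m where "m < n" "qdim k V ?U m"
      using qdim_larger[OF less.prems(1) assms(2) sub sub[OF U] WU] less.prems(2) by blast
    then obtain m' where "qdim k1 V ?U m'" using less.IH U by blast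
    moreover have "qdim k1 ?U W (Suc 0)"
      by (intro qdim.adjoin qdim.refl v)
    ultimately show ?thesis using qdim_trans by blast
  qed
qed

text \<open>The tower law for \<open>k1 = k(y)\<close> of degree \<open>p\<close>: a line over
  \<open>k1\<close> is filled by the vectors \<open>v\<close>, \<open>y v\<close>, ...,
  \<open>y ^ (p - 1) v\<close>, adjoined one after another over \<open>k\<close>.\<close>

lemma qdim_restrict_scalars:
  fixes k :: "'f::field set"
  assumes "qdim k1 V W n" "subfield_set k" "subfield_set k1" "k \<subseteq> k1" "subspace_over k1 W"
    and y: "y \<in> k1" and span: "\<And>z. z \<in> k1 \<Longrightarrow> \<exists>c. (\<forall>i<p. c i \<in> k) \<and> z = (\<Sum>i<p. c i * y ^ i)"
    and indep: "\<And>c. (\<And>i. i < p \<Longrightarrow> c i \<in> k) \<Longrightarrow> (\<Sum>i<p. c i * y ^ i) = 0 \<Longrightarrow> (\<forall>i<p. c i = 0)"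
  shows "qdim k V W (p * n)"
  using assms(1,5)
proof (induction rule: qdim.induct)
  case (refl W)
  then show ?case by (simp add: qdim.refl)
next
  case (adjoin V W n v)
  have k1: "subring_set k1" and k: "subring_set k" using assms(2,3) unfolding subfield_set_def by simp_all
  have V: "subspace_over k1 V" using qdim_subspace[OF adjoin(1) k1 adjoin.prems] .
  define U where "U j = {w + (\<Sum>i<j. c i * y ^ i) * v | w c. w \<in> V \<and> (\<forall>i<j. c i \<in> k)}" for j
  have "qdim k (U j) V j" if "j \<le> p" for j
    using that
  proof (induction j)
    case 0
    have "U 0 = V" unfolding U_def by simp
    then show ?case by (simp add: qdim.refl)
  next
    case (Suc j)
    have "y ^ j * v \<notin> U j"
    proof
      assume "y ^ j * v \<in> U j"
      then obtain w c where wc: "y ^ j * v = w + (\<Sum>i<j. c i * y ^ i) * v" "w \<in> V" "\<forall>i<j. c i \<in> k"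
        unfolding U_def by blast
      \<comment> \<open>If \<open>y ^ j * v\<close> already lay in \<open>U j\<close>, then
        \<open>z * v\<close> would lie in \<open>V\<close> for this polynomial \<open>z\<close> in
        \<open>y\<close>. Its coefficient 1 at \<open>y ^ j\<close> makes \<open>z\<close> nonzero,
        and dividing by \<open>z\<close> in \<open>k1\<close> would put \<open>v\<close> in
        \<open>V\<close>.\<close>
      define c' where "c' i = (if i < j then - c i else if i = j then 1 else 0)" for i
      define z where "z = (\<Sum>i<p. c' i * y ^ i)"
      have c'k: "c' i \<in> k" for i
        using wc(3) subring_set_0[OF k] subring_set_1[OF k] subring_set_uminus[OF k]
        unfolding c'_def by auto
      have "z = (\<Sum>i<Suc j. c' i * y ^ i)"
        unfolding z_def using Suc.prems by (intro sum.mono_neutral_right) (auto simp: c'_def)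
      also have "\<dots> = y ^ j - (\<Sum>i<j. c i * y ^ i)"
        by (simp add: c'_def sum_negf)
      finally have "z * v = y ^ j * v - (\<Sum>i<j. c i * y ^ i) * v" by (simp only: left_diff_distrib)
      also have "\<dots> = w" unfolding wc(1) by (rule add_diff_cancel_right')
      finally have zv: "z * v = w" .
      have "z \<noteq> 0"
      proof
        assume "z = 0"
        then have "\<forall>i<p. c' i = 0" unfolding z_def by (intro indep c'k)
        then have "c' j = 0" using Suc.prems by simp
        then show False by (simp add: c'_def)
      qed
      have "z \<in> k1"
        unfolding z_def using c'k assms(4) y
        by (intro subring_set_sum[OF k1] subring_set_mult[OF k1] subring_set_power[OF k1]) auto
      then have "inverse z * w \<in> V"
        using assms(3) wc(2) subspace_over_scale[OF V] unfolding subfield_set_def by blast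
      moreover have "inverse z * w = v" using \<open>z \<noteq> 0\<close> by (simp add: zv[symmetric])
      ultimately have "v \<in> V" by simp
      with adjoin(2) show False by simp
    qed
    moreover have "U (Suc j) = adjoin k (U j) (y ^ j * v)"
    proof (intro equalityI subsetI)
      fix z assume "z \<in> U (Suc j)"
      then obtain w c where "z = w + (\<Sum>i<Suc j. c i * y ^ i) * v" "w \<in> V" "\<forall>i<Suc j. c i \<in> k"
        unfolding U_def by blast
      then have "z = (w + (\<Sum>i<j. c i * y ^ i) * v) + c j * (y ^ j * v)" "w \<in> V" "\<forall>i<j. c i \<in> k" "c j \<in> k"
        by (auto simp: algebra_simps)
      then show "z \<in> adjoin k (U j) (y ^ j * v)" unfolding U_def adjoin_def by blast
    next
      fix z assume "z \<in> adjoin k (U j) (y ^ j * v)"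
      then obtain w c d where *: "z = (w + (\<Sum>i<j. c i * y ^ i) * v) + d * (y ^ j * v)"
          "w \<in> V" "\<forall>i<j. c i \<in> k" "d \<in> k"
        unfolding U_def adjoin_def by blast
      define c' where "c' = c(j := d)"
      have "(\<Sum>i<j. c' i * y ^ i) = (\<Sum>i<j. c i * y ^ i)"
        by (intro sum.cong) (auto simp: c'_def)
      then have "z = w + (\<Sum>i<Suc j. c' i * y ^ i) * v"
        using * by (simp add: c'_def algebra_simps)
      moreover have "\<forall>i<Suc j. c' i \<in> k" using * by (auto simp: c'_def less_Suc_eq)
      ultimately show "z \<in> U (Suc j)" using *(2) unfolding U_def by blast
    qed
    ultimately show ?case using Suc qdim.adjoin[of k "U j" V j] by simp
  qed
  then have "qdim k (U p) V p" by simp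
  moreover have "U p = adjoin k1 V v"
  proof (intro equalityI subsetI)
    fix z assume "z \<in> U p"
    then obtain w c where *: "z = w + (\<Sum>i<p. c i * y ^ i) * v" "w \<in> V" "\<forall>i<p. c i \<in> k"
      unfolding U_def by blast
    have "(\<Sum>i<p. c i * y ^ i) \<in> k1"
      using * assms(4) y
      by (intro subring_set_sum[OF k1] subring_set_mult[OF k1] subring_set_power[OF k1]) auto
    with * show "z \<in> adjoin k1 V v" unfolding adjoin_def by blast
  next
    fix z assume "z \<in> adjoin k1 V v"
    then obtain w c where *: "z = w + c * v" "w \<in> V" "c \<in> k1" unfolding adjoin_def by blast
    obtain d where "\<forall>i<p. d i \<in> k" "c = (\<Sum>i<p. d i * y ^ i)" using span[OF *(3)] by blast
    with * show "z \<in> U p" unfolding U_def by blast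
  qed
  ultimately have "qdim k (adjoin k1 V v) V p" by simp
  from qdim_trans[OF this adjoin.IH[OF adjoin.prems]] show ?case by simp
qed

section \<open>Purely inseparable elements modulo a prime ideal\<close>

definition coeffs_in :: "'f::comm_ring_1 set \<Rightarrow> 'f poly \<Rightarrow> bool"
  where "coeffs_in D f \<longleftrightarrow> (\<forall>i. coeff f i \<in> D)"

lemma coeffs_in_add: "subring_set D \<Longrightarrow> coeffs_in D f \<Longrightarrow> coeffs_in D g \<Longrightarrow> coeffs_in D (f + g)"
  unfolding coeffs_in_def by (auto intro: subring_set_add)

lemma coeffs_in_diff: "subring_set D \<Longrightarrow> coeffs_in D f \<Longrightarrow> coeffs_in D g \<Longrightarrow> coeffs_in D (f - g)"
  unfolding coeffs_in_def by (auto intro: subring_set_diff)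

lemma coeffs_in_mult: "subring_set D \<Longrightarrow> coeffs_in D f \<Longrightarrow> coeffs_in D g \<Longrightarrow> coeffs_in D (f * g)"
  unfolding coeffs_in_def coeff_mult by (auto intro!: subring_set_sum subring_set_mult)

lemma coeffs_in_power: "subring_set D \<Longrightarrow> coeffs_in D f \<Longrightarrow> coeffs_in D (f ^ n)"
proof (induction n)
  case 0
  then show ?case by (auto simp: coeffs_in_def coeff_1 subring_set_0 subring_set_1)
qed (auto intro: coeffs_in_mult)

lemma coeffs_in_const: "subring_set D \<Longrightarrow> a \<in> D \<Longrightarrow> coeffs_in D [:a:]"
  by (auto simp: coeffs_in_def coeff_pCons subring_set_0 split: nat.splits)

lemma coeffs_in_linear: "subring_set D \<Longrightarrow> a \<in> D \<Longrightarrow> coeffs_in D [:a, 1:]"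
  by (auto simp: coeffs_in_def coeff_pCons subring_set_0 subring_set_1 split: nat.splits)

lemma coeffs_in_monom: "subring_set D \<Longrightarrow> a \<in> D \<Longrightarrow> coeffs_in D (monom a n)"
  by (auto simp: coeffs_in_def subring_set_0)

lemma poly_eq_sum_lessThan:
  fixes f :: "'f::comm_ring_1 poly"
  assumes "degree f < n"
  shows "poly f z = (\<Sum>i<n. coeff f i * z ^ i)"
proof -
  have "(\<Sum>i<n. coeff f i * z ^ i) = (\<Sum>i\<le>degree f. coeff f i * z ^ i)"
    using assms by (intro sum.mono_neutral_right) (auto simp: coeff_eq_0)
  then show ?thesis by (simp add: poly_altdef)
qed

lemma poly_in:
  assumes "subring_set D" "coeffs_in D f" "z \<in> D"
  shows "poly f z \<in> D"
  unfolding Polynomial.poly_altdef using assms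
  by (intro subring_set_sum subring_set_mult subring_set_power) (auto simp: coeffs_in_def)

lemma coeff_lessThan_sum_monom:
  "coeff (\<Sum>i<n. monom (c i) i) j = (if j < n then c j else (0::'f::comm_monoid_add))"
  by (auto simp: coeff_sum)

lemma degree_lessThan_sum_monom: "n > 0 \<Longrightarrow> degree (\<Sum>i<n. monom (c i) i) < n"
proof -
  assume n: "n > 0"
  have "degree (\<Sum>i<n. monom (c i) i) \<le> n - 1"
    by (rule degree_le) (auto simp: coeff_lessThan_sum_monom)
  with n show ?thesis by simp
qed

lemma poly_lessThan_sum_monom:
  "poly (\<Sum>i<n. monom (c i) i) (z::'f::comm_ring_1) = (\<Sum>i<n. c i * z ^ i)"
  by (simp add: poly_sum Polynomial.poly_monom)

text \<open>As the divisor is monic, leading terms are cancelled without division, so quotient and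
  remainder keep their coefficients in \<open>D\<close>.\<close>

lemma division_by_monic:
  fixes g :: "'f::comm_ring_1 poly"
  assumes D: "subring_set D" and g: "coeffs_in D g" "lead_coeff g = 1" "degree g > 0" and f: "coeffs_in D f"
  shows "\<exists>q r. coeffs_in D q \<and> coeffs_in D r \<and> f = q * g + r \<and> degree r < degree g"
  using f
proof (induction "degree f" arbitrary: f rule: less_induct)
  case less
  show ?case
  proof (cases "degree f < degree g")
    case True
    then show ?thesis using less.prems
      by (intro exI[of _ 0] exI[of _ f]) (auto simp: coeffs_in_def subring_set_0[OF D])
  next
    case False
    define h where "h = monom (lead_coeff f) (degree f - degree g)"
    have h: "coeffs_in D h"
      unfolding h_def using less.prems by (intro coeffs_in_monom D) (auto simp: coeffs_in_def)
    define f' where "f' = f - h * g"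
    have f': "coeffs_in D f'" unfolding f'_def by (intro coeffs_in_diff coeffs_in_mult D h g less.prems)
    have "degree f' < degree f"
    proof -
      have "degree (h * g) \<le> degree f"
        using False degree_mult_le[of h g] degree_monom_le[of "lead_coeff f" "degree f - degree g"]
        unfolding h_def by linarith
      moreover have "coeff (h * g) (degree f) = lead_coeff f"
        unfolding h_def using False g(2) by (simp add: coeff_monom_mult)
      ultimately have "coeff f' i = 0" if "i \<ge> degree f" for i
        using that unfolding f'_def by (cases "i = degree f") (auto simp: coeff_eq_0)
      then have "degree f' \<le> degree f - 1" by (intro degree_le) auto
      then show ?thesis using False g(3) by linarith
    qed
    from less.hyps[OF this f'] obtain q r where "coeffs_in D q" "coeffs_in D r" "f' = q * g + r" "degree r < degree g"
      by blast
    moreover from this have "f = (q + h) * g + r" unfolding f'_def by (simp add: algebra_simps)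
    ultimately show ?thesis using coeffs_in_add[OF D _ h] by blast
  qed
qed

definition prime_ideal_in :: "'f::comm_ring_1 set \<Rightarrow> 'f set \<Rightarrow> bool"
  where "prime_ideal_in D P \<longleftrightarrow> P \<subseteq> D \<and> 1 \<notin> P \<and> subspace_over D P \<and>
    (\<forall>a\<in>D. \<forall>b\<in>D. a * b \<in> P \<longrightarrow> a \<in> P \<or> b \<in> P)"

lemma coeffs_in_pcompose_ideal:
  assumes D: "subring_set D" and P: "subspace_over D P" and f: "coeffs_in P f" and g: "coeffs_in D g"
  shows "coeffs_in P (pcompose f g)"
  using f
proof (induction f)
  case 0
  then show ?case by simp
next
  case (pCons a f)
  have "coeff (pCons a f) 0 \<in> P" "\<And>i. coeff (pCons a f) (Suc i) \<in> P"
    using pCons.prems unfolding coeffs_in_def by blast+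
  then have a: "a \<in> P" and f: "coeffs_in P f" unfolding coeffs_in_def by auto
  have "coeff (g * pcompose f g) i \<in> P" for i
    unfolding coeff_mult using pCons.IH[OF f] g
    by (intro subspace_over_sum[OF P] subspace_over_scale[OF P]) (auto simp: coeffs_in_def)
  then show ?case
    unfolding pcompose_pCons coeffs_in_def coeff_add
    using a subspace_over_0[OF P] by (auto intro!: subspace_over_add[OF P] simp: coeff_pCons split: nat.splits)
qed

lemma coeffs_in_pcompose:
  "subring_set D \<Longrightarrow> coeffs_in D f \<Longrightarrow> coeffs_in D g \<Longrightarrow> coeffs_in D (pcompose f g)"
  by (rule coeffs_in_pcompose_ideal)
     (auto simp: subspace_over_def intro: subring_set_0 subring_set_add subring_set_mult)

text \<open>The argument of Gauss's lemma from the low end: in the convolution for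
  \<open>i + j\<close> every term other than \<open>coeff f i * coeff g j\<close> has a factor in
  \<open>P\<close>.\<close>

lemma coeff_product_outside_prime:
  assumes D: "subring_set D" and P: "prime_ideal_in D P"
    and f: "coeffs_in D f" "coeff f i \<notin> P" "\<And>l. l < i \<Longrightarrow> coeff f l \<in> P"
    and g: "coeffs_in D g" "coeff g j \<notin> P" "\<And>l. l < j \<Longrightarrow> coeff g l \<in> P"
  shows "coeff (f * g) (i + j) \<notin> P"
proof
  assume *: "coeff (f * g) (i + j) \<in> P"
  have P': "subspace_over D P" using P unfolding prime_ideal_in_def by simp
  have "coeff (f * g) (i + j) = coeff f i * coeff g j + (\<Sum>l\<in>{..i+j}-{i}. coeff f l * coeff g (i + j - l))"
    unfolding coeff_mult by (subst sum.remove[of _ i]) auto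
  moreover have "(\<Sum>l\<in>{..i+j}-{i}. coeff f l * coeff g (i + j - l)) \<in> P"
  proof (intro subspace_over_sum[OF P'])
    fix l assume l: "l \<in> {..i+j}-{i}"
    show "coeff f l * coeff g (i + j - l) \<in> P"
    proof (cases "l < i")
      case True
      then show ?thesis using f(3) g(1) subspace_over_scale[OF P', of "coeff g (i + j - l)" "coeff f l"]
        unfolding coeffs_in_def by (simp add: mult.commute)
    next
      case False
      with l have "i + j - l < j" by auto
      then show ?thesis using g(3) f(1) subspace_over_scale[OF P'] unfolding coeffs_in_def by blast
    qed
  qed
  ultimately have "coeff f i * coeff g j \<in> P"
    using subspace_over_diff[OF P' D *] by force
  then show False using P f(1,2) g(1,2) unfolding prime_ideal_in_def coeffs_in_def by blast
qed

lemma prime_CHAR_binomial_eq_0: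
  assumes "Factorial_Ring.prime p" "CHAR('f::comm_ring_1) = p" "0 < i" "i < p"
  shows "of_nat (p choose i) = (0::'f)"
  using assms by (simp add: of_nat_eq_0_iff_char_dvd dvd_choose_prime)

lemma of_nat_inverse_CHAR:
  assumes "Factorial_Ring.prime p" "CHAR('f::comm_ring_1) = p" "0 < j" "j < p"
  shows "\<exists>j'. of_nat j' * of_nat j = (1::'f)"
proof -
  have "coprime j p"
    using assms prime_imp_coprime[of p j] by (metis coprime_commute nat_dvd_not_less)
  then obtain j' where "[j * j' = 1] (mod p)" using cong_solve_coprime_nat[of j p] by auto
  then have "of_nat (j * j') = (of_nat 1 :: 'f)" using assms(2) of_nat_eq_iff_cong_CHAR by blast
  then show ?thesis by (metis mult.commute of_nat_1 of_nat_mult)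
qed

text \<open>Modulo \<open>P\<close>, a monic relation \<open>g\<close> of minimal degree \<open>j\<close> divides \<open>X\<^sup>p - \<alpha>\<^sup>p = (X - \<alpha>)\<^sup>p\<close>, so it
  equals \<open>(X - \<alpha>)\<^sup>j\<close>, and for \<open>j < p\<close> its subleading coefficient exhibits the class of \<open>\<alpha>\<close> in \<open>D0\<close>.\<close>

lemma inseparable_powers_independent:
  fixes D :: "'f::idom set"
  assumes p: "Factorial_Ring.prime p" "CHAR('f) = p"
    and D: "subring_set D" "subring_set D0" "D0 \<subseteq> D" and P: "prime_ideal_in D P"
    and inv: "\<And>c. c \<in> D0 \<Longrightarrow> c \<notin> P \<Longrightarrow> \<exists>c'\<in>D0. c * c' - 1 \<in> P"
    and \<alpha>: "\<alpha> \<in> D" "a \<in> D0" "\<alpha> ^ p - a \<in> P" "\<And>c. c \<in> D0 \<Longrightarrow> \<alpha> - c \<notin> P"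
    and c: "\<And>i. i < p \<Longrightarrow> c i \<in> D0" "(\<Sum>i<p. c i * \<alpha> ^ i) \<in> P"
    and i: "i < p"
  shows "c i \<in> P"
proof -
  have P': "subspace_over D P" using P unfolding prime_ideal_in_def by simp
  \<comment> \<open>A relation is measured by its exact degree modulo \<open>P\<close>: the leading
    coefficient has to lie outside \<open>P\<close>, so \<open>relation\<close> first strips the top
    coefficients that lie in \<open>P\<close>.\<close>
  define Q where "Q n \<longleftrightarrow> (\<exists>c. (\<forall>i\<le>n. c i \<in> D0) \<and> (\<Sum>i\<le>n. c i * \<alpha> ^ i) \<in> P \<and> c n \<notin> P)" for n
  have relation: "\<exists>l<n. Q l"
    if c: "\<And>i. i < n \<Longrightarrow> c i \<in> D0" "(\<Sum>i<n. c i * \<alpha> ^ i) \<in> P" "i < n" "c i \<notin> P" for c i n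
  proof -
    define l where "l = Max {i. i < n \<and> c i \<notin> P}"
    have l: "l < n" "c l \<notin> P" using Max_in[of "{i. i < n \<and> c i \<notin> P}"] c(3,4) unfolding l_def by fastforce+
    have big: "c i \<in> P" if "l < i" "i < n" for i
      using that Max_ge[of "{i. i < n \<and> c i \<notin> P}" i] unfolding l_def by fastforce
    have "(\<Sum>i<n. c i * \<alpha> ^ i) = (\<Sum>i\<le>l. c i * \<alpha> ^ i) + (\<Sum>i\<in>{l<..<n}. c i * \<alpha> ^ i)"
      using l(1) by (subst sum.union_disjoint[symmetric]) (auto intro!: sum.cong)
    moreover have "(\<Sum>i\<in>{l<..<n}. c i * \<alpha> ^ i) \<in> P"
      using big subspace_over_scale[OF P' subring_set_power[OF D(1) \<alpha>(1)]]
      by (intro subspace_over_sum[OF P']) (auto simp: mult.commute)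
    ultimately have "(\<Sum>i\<le>l. c i * \<alpha> ^ i) \<in> P"
      using subspace_over_diff[OF P' D(1) c(2)] by (metis add_diff_cancel_right')
    then show ?thesis using l c(1) unfolding Q_def by (intro exI[of _ l] conjI exI[of _ c]) auto
  qed
  show ?thesis
  proof (rule ccontr)
    assume "c i \<notin> P"
    with relation[OF c i] obtain l where "l < p" "Q l" by blast
    define j where "j = (LEAST j. Q j)"
    have "Q j" unfolding j_def using \<open>Q l\<close> by (rule LeastI)
    have jp: "j < p" using Least_le[of Q, OF \<open>Q l\<close>] \<open>l < p\<close> unfolding j_def by linarith
    have min: "\<not> Q n" if "n < j" for n using that not_less_Least unfolding j_def by blast
    from \<open>Q j\<close>
    obtain b where b: "\<And>i. i \<le> j \<Longrightarrow> b i \<in> D0" "(\<Sum>i\<le>j. b i * \<alpha> ^ i) \<in> P" "b j \<notin> P"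
      unfolding Q_def by blast
    have j0: "j > 0" using b(2,3) by (cases j) auto
    obtain b' where b': "b' \<in> D0" "b j * b' - 1 \<in> P" using inv b(1,3) by blast
    \<comment> \<open>The leading coefficient is set to 1 outright, as \<open>b' * b j\<close> is 1
      only modulo \<open>P\<close>; \<open>gP\<close> absorbs the error in its last term.\<close>
    define g where "g = (\<Sum>i<Suc j. monom ((if i = j then 1 else b' * b i)) i)"
    have cg: "coeff g i = (if i < j then b' * b i else if i = j then 1 else 0)" for i
      unfolding g_def coeff_lessThan_sum_monom by auto
    have dg: "degree g = j"
      using degree_lessThan_sum_monom[of "Suc j" "\<lambda>i. if i = j then 1 else b' * b i"]
        le_degree[of g j] cg[of j] unfolding g_def[symmetric] by simp
    have gD: "coeffs_in D0 g" unfolding coeffs_in_def cg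
      using b(1) b'(1) subring_set_mult[OF D(2)] subring_set_0[OF D(2)] subring_set_1[OF D(2)] by auto
    have lg: "lead_coeff g = 1" using cg dg by simp
    have gP: "poly g \<alpha> \<in> P"
    proof -
      have "poly g \<alpha> = (\<Sum>i<j. b' * b i * \<alpha> ^ i) + \<alpha> ^ j"
        unfolding g_def poly_lessThan_sum_monom by simp
      also have "\<dots> = b' * (\<Sum>i\<le>j. b i * \<alpha> ^ i) - \<alpha> ^ j * (b j * b' - 1)"
        by (simp add: sum_distrib_left algebra_simps lessThan_Suc_atMost[symmetric])
      also have "\<dots> \<in> P"
        using b b' D(3) subring_set_power[OF D(1) \<alpha>(1)]
        by (auto intro!: subspace_over_diff[OF P' D(1) subspace_over_scale[OF P'] subspace_over_scale[OF P']])
      finally show ?thesis .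
    qed
    define f where "f = monom 1 p - [:a:]"
    have fD: "coeffs_in D0 f" unfolding f_def
      by (intro coeffs_in_diff coeffs_in_monom coeffs_in_const D subring_set_1 \<alpha>)
    obtain q r where qr: "coeffs_in D0 q" "coeffs_in D0 r" "f = q * g + r" "degree r < j"
      using division_by_monic[OF D(2) gD lg _ fD] j0 dg by auto
    have mono: "coeffs_in D h" if "coeffs_in D0 h" for h
      using that D(3) unfolding coeffs_in_def by blast
    have "poly r \<alpha> = (\<alpha> ^ p - a) - poly q \<alpha> * poly g \<alpha>"
    proof -
      have "poly f \<alpha> = poly q \<alpha> * poly g \<alpha> + poly r \<alpha>" using qr(3) by simp
      then show ?thesis unfolding f_def by (simp add: Polynomial.poly_monom algebra_simps)
    qed
    also have "\<dots> \<in> P"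
      by (intro subspace_over_diff[OF P' D(1)] \<alpha> subspace_over_scale[OF P'] gP poly_in D mono qr)
    finally have "poly r \<alpha> \<in> P" .
    then have rsum: "(\<Sum>i<j. coeff r i * \<alpha> ^ i) \<in> P" by (simp add: poly_eq_sum_lessThan[OF qr(4)])
    \<comment> \<open>A remainder with a coefficient outside \<open>P\<close> would be a relation of
      degree less than \<open>j\<close>.\<close>
    have rP: "coeffs_in P r"
      unfolding coeffs_in_def
    proof
      fix i
      show "coeff r i \<in> P"
      proof (cases "i < j")
        case True
        then show ?thesis using relation[of j "coeff r" i] rsum qr(2) min unfolding coeffs_in_def by blast
      next
        case False
        with qr(4) show ?thesis by (simp add: coeff_eq_0 subspace_over_0[OF P'])
      qed
    qed
    have "degree f = p" unfolding f_def
      using prime_gt_0_nat[OF p(1)] degree_add_eq_left[of "- [:a:]" "monom 1 p"]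
      by (simp add: Polynomial.degree_monom_eq diff_conv_add_uminus[of "monom 1 p"])
    have lf: "lead_coeff f = 1" unfolding \<open>degree f = p\<close>
      unfolding f_def using prime_gt_0_nat[OF p(1)] by (simp add: coeff_pCons split: nat.splits)
    have dq: "degree q = p - j" and lq: "lead_coeff q = 1"
    proof -
      have eq: "q * g = f - r" using qr(3) by simp
      have d: "degree (f - r) = p"
        using qr(4) jp \<open>degree f = p\<close> degree_add_eq_left[of "- r" f] by simp
      have l: "lead_coeff (f - r) = 1" using d lf \<open>degree f = p\<close> qr(4) jp by (simp add: coeff_eq_0)
      have q0: "q \<noteq> 0" using eq l by auto
      have g0: "g \<noteq> 0" using lg by auto
      show "degree q = p - j" using degree_mult_eq[OF q0 g0] eq d dg by simp
      show "lead_coeff q = 1" using lead_coeff_mult[of q g] lg l eq by simp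
    qed
    \<comment> \<open>Substituting \<open>X + \<alpha>\<close> moves the only root modulo
      \<open>P\<close> to 0: the binomial coefficients vanish and the constant term becomes
      \<open>\<alpha> ^ p - a\<close>, so \<open>f\<close> turns into \<open>X ^ p\<close> modulo
      \<open>P\<close>.\<close>
    define s where "s = [:\<alpha>, 1:]"
    have sD: "coeffs_in D s" unfolding s_def by (intro coeffs_in_linear D \<alpha>)
    have shiftP: "coeff (pcompose q s * pcompose g s) i \<in> P" if "i < p" for i
    proof -
      have "pcompose (monom 1 n) s = s ^ n" for n
        by (induction n) (simp_all add: Polynomial.monom_0 Polynomial.monom_Suc pcompose_pCons pcompose_1)
      then have "pcompose f s = s ^ p - [:a:]" unfolding f_def by (simp add: pcompose_diff)
      moreover have "pcompose f s = pcompose q s * pcompose g s + pcompose r s"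
        using qr(3) by (simp add: pcompose_add pcompose_mult)
      ultimately have "coeff (pcompose q s * pcompose g s) i = coeff (s ^ p) i - coeff [:a:] i - coeff (pcompose r s) i"
        by (metis add_diff_cancel_right' coeff_diff)
      moreover have "coeff (pcompose r s) i \<in> P"
        using coeffs_in_pcompose_ideal[OF D(1) P' rP sD] unfolding coeffs_in_def by blast
      moreover have "coeff (s ^ p) i - coeff [:a:] i \<in> P"
      proof (cases "i = 0")
        case True
        then show ?thesis unfolding s_def by (simp add: coeff_linear_poly_power \<alpha>)
      next
        case False
        then show ?thesis using prime_CHAR_binomial_eq_0[OF p, of i] that unfolding s_def
          by (simp add: coeff_linear_poly_power coeff_pCons subspace_over_0[OF P'] split: nat.splits)
      qed
      ultimately show ?thesis using subspace_over_diff[OF P' D(1)] by simp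
    qed
    have ds: "degree s = 1" and ls: "lead_coeff s = 1" unfolding s_def by simp_all
    have P1: "1 \<notin> P" using P unfolding prime_ideal_in_def by simp
    have gs: "coeff (pcompose g s) j = 1"
      using lead_coeff_comp[of s g] ds ls lg dg by (simp add: degree_pcompose)
    have qs: "coeff (pcompose q s) (p - j) = 1"
      using lead_coeff_comp[of s q] ds ls lq dq by (simp add: degree_pcompose)
    \<comment> \<open>The orders of vanishing at 0 modulo \<open>P\<close> of the two factors. They
      add up to at least \<open>p\<close>, while \<open>j\<close> and \<open>p - j\<close> bound
      them, so both bounds are attained.\<close>
    define m where "m = (LEAST i. coeff (pcompose g s) i \<notin> P)"
    define n where "n = (LEAST i. coeff (pcompose q s) i \<notin> P)"
    have m1: "coeff (pcompose g s) (j) \<notin> P" using gs P1 by simp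
    have m: "m \<le> j" "coeff (pcompose g s) m \<notin> P"
      unfolding m_def by (rule Least_le[of "\<lambda>i. coeff (pcompose g s) i \<notin> P", OF m1], rule LeastI[of "\<lambda>i. coeff (pcompose g s) i \<notin> P", OF m1])
    have m_less: "coeff (pcompose g s) l \<in> P" if "l < m" for l
      using not_less_Least[of l "\<lambda>i. coeff (pcompose g s) i \<notin> P"] that unfolding m_def by blast
    have n1: "coeff (pcompose q s) (p - j) \<notin> P" using qs P1 by simp
    have n: "n \<le> p - j" "coeff (pcompose q s) n \<notin> P"
      unfolding n_def by (rule Least_le[of "\<lambda>i. coeff (pcompose q s) i \<notin> P", OF n1], rule LeastI[of "\<lambda>i. coeff (pcompose q s) i \<notin> P", OF n1])
    have n_less: "coeff (pcompose q s) l \<in> P" if "l < n" for l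
      using not_less_Least[of l "\<lambda>i. coeff (pcompose q s) i \<notin> P"] that unfolding n_def by blast
    have "coeff (pcompose q s * pcompose g s) (n + m) \<notin> P"
      by (rule coeff_product_outside_prime[OF D(1) P coeffs_in_pcompose[OF D(1) mono[OF qr(1)] sD] n(2) n_less
            coeffs_in_pcompose[OF D(1) mono[OF gD] sD] m(2) m_less])
    then have "n + m \<ge> p" using shiftP not_le by blast
    with n(1) m(1) jp have "m = j" by linarith
    then have sub: "coeff (pcompose g s) (j - 1) \<in> P" using m_less[of "j - 1"] j0 by simp
    \<comment> \<open>The coefficient of \<open>X ^ (j - 1)\<close> after the substitution is
      \<open>coeff g (j - 1) + of_nat j * \<alpha>\<close>. It lies in \<open>P\<close> because it
      is below the order of vanishing, and \<open>j\<close> is invertible as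
      \<open>0 < j < p\<close>.\<close>
    have "pcompose g s = (\<Sum>i<j. smult (coeff g i) (s ^ i)) + s ^ j"
      using dg cg[of j] by (simp add: pcompose_altdef Polynomial.poly_altdef
          coeff_map_poly degree_map_poly lessThan_Suc_atMost[symmetric])
    then have "coeff (pcompose g s) (j - 1) = (\<Sum>i<j. coeff g i * coeff (s ^ i) (j - 1)) + coeff (s ^ j) (j - 1)"
      by (simp add: coeff_sum)
    also have "(\<Sum>i<j. coeff g i * coeff (s ^ i) (j - 1)) = (\<Sum>i\<in>{j-1}. coeff g i * coeff (s ^ i) (j - 1))"
      using j0 unfolding s_def
      by (intro sum.mono_neutral_right) (auto simp: degree_linear_power coeff_eq_0)
    also have "\<dots> = coeff g (j - 1)" by (simp add: s_def coeff_linear_poly_power)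
    also have "coeff (s ^ j) (j - 1) = of_nat j * \<alpha>"
      using j0 by (cases j) (simp_all add: s_def coeff_linear_poly_power del: power_Suc)
    finally have in_P: "coeff g (j - 1) + of_nat j * \<alpha> \<in> P" using sub by simp
    obtain j' where j': "of_nat j' * of_nat j = (1::'f)" using of_nat_inverse_CHAR[OF p j0 jp] by blast
    have "\<alpha> - (- (of_nat j' * coeff g (j - 1))) = of_nat j' * (coeff g (j - 1) + of_nat j * \<alpha>)"
      by (simp add: distrib_left mult.assoc[symmetric] j')
    also have "\<dots> \<in> P" using in_P by (intro subspace_over_scale[OF P'] subring_set_of_nat D)
    finally have "\<alpha> - (- (of_nat j' * coeff g (j - 1))) \<in> P" .
    moreover have "- (of_nat j' * coeff g (j - 1)) \<in> D0"
      using gD unfolding coeffs_in_def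
      by (intro subring_set_uminus subring_set_mult subring_set_of_nat D) auto
    ultimately show False using \<alpha>(4) by blast
  qed
qed

section \<open>Discrete valuation rings inside a field\<close>

lemma CHAR_prime_power_diff:
  assumes "Factorial_Ring.prime p" "CHAR('a::comm_ring_1) = p"
  shows "(a - b :: 'a) ^ p = a ^ p - b ^ p"
proof -
  have "(a - b + b) ^ p = (a - b) ^ p + b ^ p"
    using freshmans_dream[where x = "a - b" and y = b] assms by simp
  then show ?thesis by (simp add: algebra_simps)
qed

lemma CHAR_prime_power_sum:
  assumes "Factorial_Ring.prime p" "CHAR('a::comm_ring_1) = p"
  shows "(\<Sum>i\<in>S. f i :: 'a) ^ p = (\<Sum>i\<in>S. f i ^ p)"
  using freshmans_dream_sum[where f = f and A = S] assms by metis

text \<open>As soon as \<open>y ^ n\<close> lies in \<open>A\<close>, this is the ring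
  \<open>A[y]\<close>. With \<open>n = p\<close> it describes both the field \<open>K(y)\<close> and
  the image of the tensor product.\<close>

definition powers_span :: "'f::comm_ring_1 set \<Rightarrow> 'f \<Rightarrow> nat \<Rightarrow> 'f set"
  where "powers_span A y n = {\<Sum>i<n. c i * y ^ i | c. \<forall>i<n. c i \<in> A}"

lemma powers_span_eq_poly:
  assumes A: "subring_set A" and y: "y ^ n \<in> A" and n: "n > 0"
  shows "powers_span A y n = {poly f y | f. coeffs_in A f}"
proof (intro equalityI subsetI)
  fix z assume "z \<in> powers_span A y n"
  then obtain c where c: "z = (\<Sum>i<n. c i * y ^ i)" "\<forall>i<n. c i \<in> A" unfolding powers_span_def by blast
  then have "z = poly (\<Sum>i<n. monom (c i) i) y" by (simp add: poly_lessThan_sum_monom)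
  moreover have "coeffs_in A (\<Sum>i<n. monom (c i) i)"
    using c(2) subring_set_0[OF A] unfolding coeffs_in_def coeff_lessThan_sum_monom by auto
  ultimately show "z \<in> {poly f y | f. coeffs_in A f}" by blast
next
  fix z assume "z \<in> {poly f y | f. coeffs_in A f}"
  then obtain f where f: "z = poly f y" "coeffs_in A f" by blast
  define g where "g = monom 1 n - [:y ^ n:]"
  have dg: "degree g = n" unfolding g_def using n degree_add_eq_left[of "- [:y ^ n:]" "monom 1 n"]
    by (simp add: Polynomial.degree_monom_eq diff_conv_add_uminus[of "monom 1 n"])
  have lg: "lead_coeff g = 1" unfolding dg unfolding g_def
    using n by (simp add: coeff_pCons split: nat.splits)
  have "coeffs_in A g" unfolding g_def
    by (intro coeffs_in_diff coeffs_in_monom coeffs_in_const A y subring_set_1)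
  then obtain q r where qr: "coeffs_in A r" "f = q * g + r" "degree r < n"
    using division_by_monic[OF A _ lg _ f(2)] dg n by auto
  have "poly g y = 0" unfolding g_def by (simp add: Polynomial.poly_monom)
  then have "z = poly r y" using f(1) qr(2) by simp
  also have "\<dots> = (\<Sum>i<n. coeff r i * y ^ i)" by (rule poly_eq_sum_lessThan[OF qr(3)])
  finally show "z \<in> powers_span A y n" using qr(1) unfolding powers_span_def coeffs_in_def by blast
qed

lemma subring_set_powers_span:
  assumes A: "subring_set A" and y: "y ^ n \<in> A" and n: "n > 0"
  shows "subring_set (powers_span A y n)" "A \<subseteq> powers_span A y n" "y \<in> powers_span A y n"
proof -
  note eq = powers_span_eq_poly[OF A y n]
  show "A \<subseteq> powers_span A y n"
  proof
    fix a assume "a \<in> A"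
    then show "a \<in> powers_span A y n"
      unfolding eq using coeffs_in_const[OF A] by (intro CollectI exI[of _ "[:a:]"]) auto
  qed
  then have 1: "1 \<in> powers_span A y n" using subring_set_1[OF A] by blast
  show "y \<in> powers_span A y n"
    unfolding eq using coeffs_in_linear[OF A subring_set_0[OF A]]
    by (intro CollectI exI[of _ "[:0, 1:]"]) auto
  show "subring_set (powers_span A y n)"
    unfolding subring_set_def
  proof (intro conjI ballI 1)
    fix a b assume "a \<in> powers_span A y n" "b \<in> powers_span A y n"
    then obtain f g where fg: "a = poly f y" "b = poly g y" "coeffs_in A f" "coeffs_in A g"
      unfolding eq by blast
    have "a - b = poly (f - g) y" "a * b = poly (f * g) y" using fg by simp_all
    then show "a - b \<in> powers_span A y n" "a * b \<in> powers_span A y n"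
      unfolding eq using coeffs_in_diff[OF A fg(3,4)] coeffs_in_mult[OF A fg(3,4)] by blast+
  qed
qed

lemma powers_span_power_in:
  assumes A: "subring_set A" and y: "y ^ p \<in> A" and p: "Factorial_Ring.prime p" "CHAR('f::comm_ring_1) = p"
    and z: "(z::'f) \<in> powers_span A y p"
  shows "z ^ p \<in> A"
proof -
  obtain c where c: "z = (\<Sum>i<p. c i * y ^ i)" "\<forall>i<p. c i \<in> A" using z unfolding powers_span_def by blast
  have "z ^ p = (\<Sum>i<p. c i ^ p * (y ^ p) ^ i)"
    unfolding c(1) CHAR_prime_power_sum[OF p] by (simp add: power_mult_distrib power_mult[symmetric] mult.commute)
  also have "\<dots> \<in> A" using c(2) subring_set_power[OF A] subring_set_power[OF A y]
    by (auto intro!: subring_set_sum[OF A] subring_set_mult[OF A])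
  finally show ?thesis .
qed

text \<open>By Frobenius \<open>z ^ p\<close> lies in \<open>k\<close>, where it can be inverted,
  and \<open>z ^ (p - 1)\<close> times this inverse is the inverse of \<open>z\<close>.\<close>

lemma subfield_set_powers_span:
  assumes k: "subfield_set k" and y: "y ^ p \<in> k" and p: "Factorial_Ring.prime p" "CHAR('f::field) = p"
  shows "subfield_set (powers_span k (y::'f) p)"
proof -
  have kr: "subring_set k" using k unfolding subfield_set_def by simp
  have p0: "p > 0" using p(1) prime_gt_0_nat by blast
  note S = subring_set_powers_span[OF kr y p0]
  show ?thesis unfolding subfield_set_def
  proof (intro conjI ballI S(1))
    fix z assume z: "z \<in> powers_span k y p"
    show "inverse z \<in> powers_span k y p"
    proof (cases "z = 0")
      case True
      then show ?thesis using z by simp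
    next
      case False
      have "z ^ p \<in> k" by (rule powers_span_power_in[OF kr y p z])
      then have "inverse (z ^ p) \<in> powers_span k y p" using k S(2) unfolding subfield_set_def by blast
      then have "z ^ (p - 1) * inverse (z ^ p) \<in> powers_span k y p"
        using z by (intro subring_set_mult[OF S(1)] subring_set_power[OF S(1)])
      moreover have "z ^ p = z * z ^ (p - 1)" using p0 by (cases p) auto
      ultimately show ?thesis using False by (simp add: field_simps)
    qed
  qed
qed

text \<open>Allows \<open>y - a\<close> to replace \<open>y\<close> as a generator once
  \<open>a\<close> is a best approximation.\<close>

lemma powers_span_translate:
  fixes y :: "'f::comm_ring_1"
  assumes A: "subring_set A" and y: "y ^ p \<in> A" and p: "Factorial_Ring.prime p" "CHAR('f) = p" and a: "a \<in> A"
  shows "powers_span A (y - a) p = powers_span A y p"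
proof -
  have p0: "p > 0" using p(1) prime_gt_0_nat by blast
  have ya: "(y - a) ^ p \<in> A"
    unfolding CHAR_prime_power_diff[OF p] by (intro subring_set_diff[OF A] subring_set_power[OF A] y a)
  note eqs = powers_span_eq_poly[OF A y p0] powers_span_eq_poly[OF A ya p0]
  show ?thesis unfolding eqs
  proof (intro equalityI subsetI)
    fix z assume "z \<in> {poly f (y - a) | f. coeffs_in A f}"
    then obtain f where "z = poly f (y - a)" "coeffs_in A f" by blast
    moreover from this have "z = poly (pcompose f [:- a, 1:]) y" by (simp add: poly_pcompose)
    ultimately show "z \<in> {poly f y | f. coeffs_in A f}"
      using coeffs_in_pcompose[OF A _ coeffs_in_linear[OF A subring_set_uminus[OF A a]]] by blast
  next
    fix z assume "z \<in> {poly f y | f. coeffs_in A f}"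
    then obtain f where "z = poly f y" "coeffs_in A f" by blast
    moreover from this have "z = poly (pcompose f [:a, 1:]) (y - a)" by (simp add: poly_pcompose)
    ultimately show "z \<in> {poly f (y - a) | f. coeffs_in A f}"
      using coeffs_in_pcompose[OF A _ coeffs_in_linear[OF A a]] by blast
  qed
qed

text \<open>The valuation ring is a subset of a field that may be larger than its field of
  fractions, since \<open>A\<close> will sit in the fraction field of the tensor product. In place
  of a valuation, \<open>a / t ^ n \<in> A\<close> expresses that the valuation of \<open>a\<close>
  is at least \<open>n\<close>.\<close>

locale dvr_set =
  fixes A :: "'f::field set" and t :: 'f
  assumes A: "subring_set A" and t: "t \<in> A" "t \<noteq> 0" "inverse t \<notin> A"
    and dvr: "\<And>a. a \<in> A \<Longrightarrow> a \<noteq> 0 \<Longrightarrow> \<exists>n u. u \<in> A \<and> inverse u \<in> A \<and> a = u * t ^ n"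
begin

lemmas A_closed = subring_set_1[OF A] subring_set_0[OF A] subring_set_diff[OF A] subring_set_mult[OF A]
  subring_set_uminus[OF A] subring_set_add[OF A] subring_set_power[OF A]

definition unit_in :: "'f \<Rightarrow> bool"
  where "unit_in u \<longleftrightarrow> u \<in> A \<and> inverse u \<in> A \<and> u \<noteq> 0"

lemma t_power_in: "t ^ n \<in> A"
  using A_closed(7)[OF t(1)] .

lemma unit_in_mult: "unit_in u \<Longrightarrow> unit_in v \<Longrightarrow> unit_in (u * v)"
  unfolding unit_in_def using A_closed(4)[of u v] A_closed(4)[of "inverse u" "inverse v"] by simp

lemma unit_in_inverse: "unit_in u \<Longrightarrow> unit_in (inverse u)"
  unfolding unit_in_def by auto

lemma unit_in_power: "unit_in u \<Longrightarrow> unit_in (u ^ n)"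
  unfolding unit_in_def using A_closed(7)[of u n] A_closed(7)[of "inverse u" n] by (simp add: power_inverse)

lemma unit_in_1: "unit_in 1"
  unfolding unit_in_def using A_closed(1) by auto

lemma unit_decomposition:
  assumes "a \<in> A" "a \<noteq> 0"
  obtains n u where "unit_in u" "a = u * t ^ n"
proof -
  obtain n u where "u \<in> A" "inverse u \<in> A" "a = u * t ^ n" using dvr[OF assms] by blast
  moreover from this assms(2) have "u \<noteq> 0" by auto
  ultimately show thesis using that unfolding unit_in_def by blast
qed

lemma div_t_mono:
  assumes "a / t ^ n \<in> A" "m \<le> n"
  shows "a / t ^ m \<in> A"
proof -
  have "a / t ^ m = a / t ^ n * t ^ (n - m)"
    using assms(2) t(2) by (simp add: power_diff field_simps)
  then show ?thesis using A_closed(4)[OF assms(1) t_power_in[of "n - m"]] by (simp only:)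
qed

lemma unit_not_div_t: "unit_in u \<Longrightarrow> u / t \<notin> A"
proof
  assume "unit_in u" "u / t \<in> A"
  then have "inverse u * (u / t) \<in> A" unfolding unit_in_def by (intro A_closed(4)) auto
  then show False using t \<open>unit_in u\<close> unfolding unit_in_def by (simp add: field_simps)
qed

lemma unit_iff_not_div_t:
  assumes "a \<in> A"
  shows "unit_in a \<longleftrightarrow> a / t \<notin> A"
proof
  assume n: "a / t \<notin> A"
  then have "a \<noteq> 0" using A_closed by auto
  from unit_decomposition[OF assms this] obtain n u where nu: "unit_in u" "a = u * t ^ n" .
  show "unit_in a"
  proof (cases n)
    case (Suc n')
    then have "a / t = u * t ^ n'" using nu t by simp
    then show ?thesis using n nu t_power_in A_closed(4) unfolding unit_in_def by auto
  qed (use nu in simp)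
qed (rule unit_not_div_t)

lemma unit_power_div_iff:
  assumes "unit_in u"
  shows "u * t ^ n / t ^ m \<in> A \<longleftrightarrow> m \<le> n"
proof
  assume *: "u * t ^ n / t ^ m \<in> A"
  show "m \<le> n"
  proof (rule ccontr)
    assume "\<not> m \<le> n"
    then have "u * t ^ n / t ^ Suc n \<in> A" by (intro div_t_mono[OF *]) auto
    then have "u / t \<in> A" using t by simp
    then show False using unit_not_div_t[OF assms] by simp
  qed
next
  assume "m \<le> n"
  then have "u * t ^ n / t ^ m = u * t ^ (n - m)" using t by (simp add: power_diff)
  then show "u * t ^ n / t ^ m \<in> A"
    using assms t_power_in A_closed(4) unfolding unit_in_def by simp
qed

lemma unit_power_unique:
  assumes "unit_in u" "unit_in v" "u * t ^ n = v * t ^ m"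
  shows "n = m"
  using unit_power_div_iff[OF assms(1), of n m] unit_power_div_iff[OF assms(2), of m n]
    unit_power_div_iff[OF assms(1), of n n] unit_power_div_iff[OF assms(2), of m m] assms(3) by auto

lemma prime_t:
  assumes "a \<in> A" "b \<in> A" "a * b / t \<in> A"
  shows "a / t \<in> A \<or> b / t \<in> A"
  using assms unit_in_mult unit_iff_not_div_t A_closed(4) by metis

lemma prime_t_power: "a \<in> A \<Longrightarrow> a ^ n / t \<in> A \<Longrightarrow> a / t \<in> A"
  using unit_in_power[of a n] unit_iff_not_div_t A_closed(7) by metis

lemma div_t_add: "a / t ^ n \<in> A \<Longrightarrow> b / t ^ n \<in> A \<Longrightarrow> (a + b) / t ^ n \<in> A"
  by (simp add: add_divide_distrib A_closed)

lemma div_t_diff: "a / t ^ n \<in> A \<Longrightarrow> b / t ^ n \<in> A \<Longrightarrow> (a - b) / t ^ n \<in> A"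
  by (simp add: diff_divide_distrib A_closed)

lemma div_t_mult: "a / t ^ n \<in> A \<Longrightarrow> b \<in> A \<Longrightarrow> b * a / t ^ n \<in> A"
  using A_closed(4)[of b "a / t ^ n"] by simp

lemma div_t_sum: "(\<And>i. i \<in> S \<Longrightarrow> f i / t ^ n \<in> A) \<Longrightarrow> (\<Sum>i\<in>S. f i) / t ^ n \<in> A"
  unfolding sum_divide_distrib by (rule subring_set_sum[OF A])

definition t_ideal :: "nat \<Rightarrow> 'f set"
  where "t_ideal n = {a. a / t ^ n \<in> A}"

lemma t_ideal_0: "t_ideal 0 = A"
  unfolding t_ideal_def by simp

lemma t_ideal_subset: "t_ideal n \<subseteq> A"
  unfolding t_ideal_def using div_t_mono[of _ n 0] by auto

lemma subspace_t_ideal: "subspace_over A (t_ideal n)"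
  unfolding subspace_over_def t_ideal_def using div_t_add div_t_mult A_closed(2) by auto

text \<open>Multiplication by \<open>t ^ n\<close> identifies the residue field with the quotient of
  two successive powers of the maximal ideal, so each power contributes \<open>d\<close>.\<close>

lemma qdim_t_ideal:
  assumes k: "subring_set k" "k \<subseteq> A" and d: "qdim k A (t_ideal 1) d"
  shows "qdim k A (t_ideal n) (d * n)"
proof (induction n)
  case 0
  show ?case by (simp add: t_ideal_0 qdim.refl)
next
  case (Suc n)
  have sub: "subspace_over k (t_ideal n)" for n
    using subspace_t_ideal k(2) unfolding subspace_over_def by blast
  have "qdim ((\<lambda>c. c) ` k) ((\<lambda>a. t ^ n * a) ` A) ((\<lambda>a. t ^ n * a) ` t_ideal 1) d"
    by (rule qdim_image[OF d k(1) sub]) (use t in \<open>auto simp: algebra_simps t_ideal_def\<close>)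
  moreover have "(\<lambda>a. t ^ n * a) ` t_ideal l = t_ideal (n + l)" for l
  proof (intro equalityI subsetI)
    fix z assume "z \<in> (\<lambda>a. t ^ n * a) ` t_ideal l"
    then show "z \<in> t_ideal (n + l)" using t unfolding t_ideal_def by (auto simp: power_add)
  next
    fix z assume "z \<in> t_ideal (n + l)"
    then have "z / t ^ n \<in> t_ideal l" unfolding t_ideal_def by (simp add: power_add)
    then have "t ^ n * (z / t ^ n) \<in> (\<lambda>a. t ^ n * a) ` t_ideal l" by (rule imageI)
    then show "z \<in> (\<lambda>a. t ^ n * a) ` t_ideal l" using t by simp
  qed
  from this[of 0] this[of 1] have "(\<lambda>a. t ^ n * a) ` A = t_ideal n" "(\<lambda>a. t ^ n * a) ` t_ideal 1 = t_ideal (Suc n)"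
    by (simp_all add: t_ideal_0)
  ultimately have "qdim k (t_ideal n) (t_ideal (Suc n)) d" by simp
  from qdim_trans[OF Suc this] show ?case by (simp add: algebra_simps)
qed

lemma eq_0_if_all_powers_divide:
  assumes "a \<in> A" "\<And>n. a / t ^ n \<in> A"
  shows "a = 0"
proof (rule ccontr)
  assume "a \<noteq> 0"
  from unit_decomposition[OF assms(1) this] obtain n u where nu: "unit_in u" "a = u * t ^ n" .
  show False using assms(2)[of "Suc n"] unfolding nu(2) unit_power_div_iff[OF nu(1)] by simp
qed

end

section \<open>Adjoining a \<open>p\<close>-th root to a discrete valuation ring\<close>

text \<open>By \<open>y_indep\<close> and \<open>y_span\<close> the field is obtained from the field
  of fractions of \<open>A\<close> by adjoining \<open>y\<close>, with degree \<open>p\<close>. The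
  assumption \<open>bounded\<close> stands for finiteness of the normalization: it limits how
  closely \<open>p\<close>-th powers from \<open>A\<close> approach \<open>y ^ p\<close>, and in
  this form it passes on to the second step.\<close>

locale inseparable_step = dvr_set A t for A :: "'f::field set" and t :: 'f +
  fixes k :: "'f set" and y :: 'f and p :: nat
  assumes p: "Factorial_Ring.prime p" "CHAR('f) = p"
    and k: "subfield_set k" "k \<subseteq> A" and yk: "y ^ p \<in> k"
    and y_indep: "\<And>c. (\<And>i. i < p \<Longrightarrow> c i \<in> A) \<Longrightarrow> (\<Sum>i<p. c i * y ^ i) = 0 \<Longrightarrow> \<forall>i<p. c i = 0"
    and y_span: "\<And>z. \<exists>a\<in>A. a \<noteq> 0 \<and> a * z \<in> powers_span A y p"
    and bounded: "\<exists>N. \<forall>a\<in>A. (y ^ p - a ^ p) / t ^ N \<notin> A"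
begin

definition B :: "'f set" where "B = {z. z ^ p \<in> A}"

definition k1 :: "'f set" where "k1 = powers_span k y p"

text \<open>The image of the tensor product of the base ring with \<open>k(y)\<close>; its
  normalization is \<open>B\<close>.\<close>

definition T :: "'f set" where "T = powers_span A y p"

lemma p_pos: "p > 0" and p_gt_1: "p > 1"
  using p(1) prime_gt_0_nat prime_gt_1_nat by blast+

lemma k_subring: "subring_set k"
  using k(1) unfolding subfield_set_def by simp

lemma yp_in: "y ^ p \<in> A"
  using yk k(2) by blast

lemma power_p_diff: "(z - w :: 'f) ^ p = z ^ p - w ^ p"
  by (rule CHAR_prime_power_diff[OF p])

lemma power_p_sum: "(\<Sum>i\<in>S. f i :: 'f) ^ p = (\<Sum>i\<in>S. f i ^ p)"
  by (rule CHAR_prime_power_sum[OF p])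

lemma B_subring: "subring_set B"
  unfolding subring_set_def B_def power_p_diff
  by (auto simp: power_mult_distrib power_p_diff A_closed(1) intro: A_closed(3) A_closed(4))

lemma A_subset_B: "A \<subseteq> B"
  unfolding B_def using A_closed(7) by blast

lemma k1_subfield: "subfield_set k1"
  unfolding k1_def by (rule subfield_set_powers_span[OF k(1) yk p])

lemma k1_subring: "subring_set k1"
  using k1_subfield unfolding subfield_set_def by simp

lemma k_subset_k1: "k \<subseteq> k1" and y_in_k1: "y \<in> k1"
  unfolding k1_def using subring_set_powers_span[OF k_subring yk p_pos] by auto

lemma T_subring: "subring_set T" and A_subset_T: "A \<subseteq> T"
  unfolding T_def using subring_set_powers_span[OF A yp_in p_pos] by auto

lemma k1_subset_T: "k1 \<subseteq> T"
  unfolding k1_def T_def powers_span_def using k(2) by blast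

lemma T_subset_B: "T \<subseteq> B"
  unfolding B_def T_def using powers_span_power_in[OF A yp_in p] by blast

lemma k1_span: "z \<in> k1 \<Longrightarrow> \<exists>c. (\<forall>i<p. c i \<in> k) \<and> z = (\<Sum>i<p. c i * y ^ i)"
  unfolding k1_def powers_span_def by blast

lemma k1_indep:
  assumes "\<And>i. i < p \<Longrightarrow> c i \<in> k" "(\<Sum>i<p. c i * y ^ i) = 0"
  shows "\<forall>i<p. c i = 0"
  using y_indep[of c] assms k(2) by blast

lemma subspace_subring:
  assumes "subring_set S" "l \<subseteq> S"
  shows "subspace_over l S"
  unfolding subspace_over_def
  using assms subring_set_0[OF assms(1)] subring_set_add[OF assms(1)] subring_set_mult[OF assms(1)] by blast

lemma subspace_k_of_k1: "subspace_over k1 W \<Longrightarrow> subspace_over k W"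
  using k_subset_k1 unfolding subspace_over_def by blast

text \<open>Every dimension is first counted over \<open>k\<close> and then divided by
  \<open>p\<close> here. Existence over \<open>k1\<close>, the tower law and uniqueness over
  \<open>k\<close> combine.\<close>

lemma qdim_k1:
  assumes "qdim k V W n" "subspace_over k1 V" "subspace_over k1 W"
  shows "\<exists>n'. qdim k1 V W n' \<and> p * n' = n"
proof -
  obtain n' where n': "qdim k1 V W n'"
    using qdim_coarser_field[OF assms(1) k(1) k1_subfield k_subset_k1 assms(3,2)] by blast
  have "qdim k V W (p * n')"
    by (rule qdim_restrict_scalars[OF n' k(1) k1_subfield k_subset_k1 assms(3) y_in_k1 k1_span k1_indep])
  then have "p * n' = n"
    using qdim_unique[OF k(1) subspace_k_of_k1[OF assms(3)] _ assms(1)] by blast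
  with n' show ?thesis by blast
qed

lemma y_not_in_A: "a \<in> A \<Longrightarrow> y \<noteq> a"
proof
  assume a: "a \<in> A" "y = a"
  define c where "c = (\<lambda>i::nat. if i = 0 then - a else if i = 1 then 1 else 0)"
  have "(\<Sum>i<p. c i * y ^ i) = (\<Sum>i\<in>{0, 1}. c i * y ^ i)"
    using p_gt_1 by (intro sum.mono_neutral_right) (auto simp: c_def)
  also have "\<dots> = 0" using a by (simp add: c_def)
  finally have "\<forall>i<p. c i = 0"
    using A_closed(1,2) A_closed(5)[OF a(1)] by (intro y_indep) (auto simp: c_def)
  then show False using p_gt_1 by (auto simp: c_def)
qed

text \<open>The exponents are bounded, so a largest one exists, and the cofactor \<open>u\<close> is
  a unit since another factor \<open>t\<close> would give a larger exponent. It is nonzero because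
  \<open>y\<close> is not in \<open>A\<close>.\<close>

lemma optimal_approximation:
  "\<exists>m a u. a \<in> A \<and> unit_in u \<and> y ^ p - a ^ p = u * t ^ m \<and>
    (\<forall>b\<in>A. \<forall>n. (y ^ p - b ^ p) / t ^ n \<in> A \<longrightarrow> n \<le> m)"
proof -
  define Q where "Q n \<longleftrightarrow> (\<exists>a\<in>A. (y ^ p - a ^ p) / t ^ n \<in> A)" for n
  obtain N where N: "\<forall>a\<in>A. (y ^ p - a ^ p) / t ^ N \<notin> A" using bounded by blast
  have Q0: "Q 0" unfolding Q_def using A_closed(2) A_closed(3)[OF yp_in A_closed(7)[OF A_closed(2)]] by auto
  have QN: "n \<le> N" if "Q n" for n
    using that N div_t_mono[of _ n N] unfolding Q_def by (meson nat_le_linear)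
  define m where "m = (GREATEST n. Q n)"
  have "Q m" unfolding m_def by (rule GreatestI_nat[of Q, OF Q0 QN])
  then obtain a where a: "a \<in> A" "(y ^ p - a ^ p) / t ^ m \<in> A" unfolding Q_def by blast
  have max: "n \<le> m" if "b \<in> A" "(y ^ p - b ^ p) / t ^ n \<in> A" for b n
    unfolding m_def using that by (intro Greatest_le_nat[of Q, OF _ QN]) (auto simp: Q_def)
  define u where "u = (y ^ p - a ^ p) / t ^ m"
  have "(y - a) ^ p \<noteq> 0" using y_not_in_A[OF a(1)] by simp
  then have "u \<noteq> 0" unfolding u_def power_p_diff using t by simp
  have "u / t \<notin> A"
  proof
    assume "u / t \<in> A"
    then have "(y ^ p - a ^ p) / t ^ Suc m \<in> A" unfolding u_def by (simp add: mult.commute)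
    from max[OF a(1) this] show False by simp
  qed
  then have "unit_in u" using unit_iff_not_div_t a(2) unfolding u_def by blast
  moreover have "y ^ p - a ^ p = u * t ^ m" unfolding u_def using t by simp
  ultimately show ?thesis using a(1) max by blast
qed

end

locale optimal_step = inseparable_step A t k y p
  for A :: "'f::field set" and t :: 'f and k :: "'f set" and y :: 'f and p :: nat +
  fixes m :: nat and a u :: 'f
  assumes a: "a \<in> A" and u: "unit_in u" and ya: "y ^ p - a ^ p = u * t ^ m"
    and max: "\<And>b n. b \<in> A \<Longrightarrow> (y ^ p - b ^ p) / t ^ n \<in> A \<Longrightarrow> n \<le> m"
begin

text \<open>As \<open>(y - a) ^ p = u * t ^ m\<close>, the exponent of \<open>t\<close> is the largest one that keeps the quotient in
  \<open>B\<close>. The \<open>b i\<close> with \<open>i < p\<close> form a basis of \<open>B\<close> over \<open>A\<close>.\<close>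

definition b :: "nat \<Rightarrow> 'f" where "b i = (y - a) ^ i / t ^ (i * m div p)"

lemma b_power: "b i ^ p = u ^ i * t ^ (i * m mod p)"
proof -
  have "(y - a) ^ p = u * t ^ m" using ya by (simp add: power_p_diff)
  then have "((y - a) ^ i) ^ p = (u * t ^ m) ^ i" by (metis power_mult mult.commute)
  then have "b i ^ p = (u * t ^ m) ^ i / t ^ (p * (i * m div p))"
    unfolding b_def by (simp add: power_divide power_mult[symmetric] mult.commute)
  also have "(u * t ^ m) ^ i = u ^ i * t ^ (p * (i * m div p) + i * m mod p)"
    by (simp add: power_mult_distrib power_mult[symmetric] mult.commute)
  finally show ?thesis using t unfolding power_add by simp
qed

lemma u_power: "unit_in (u ^ i)"
  by (rule unit_in_power[OF u])

lemma b_in_B: "b i \<in> B"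
  unfolding B_def using b_power[of i] u_power[of i] A_closed(4) t_power_in unfolding unit_in_def by auto

lemma sum_b_in_B: "(\<And>i. i < p \<Longrightarrow> c i \<in> A) \<Longrightarrow> (\<Sum>i<p. c i * b i) \<in> B"
  using A_subset_B b_in_B by (intro subring_set_sum[OF B_subring] subring_set_mult[OF B_subring]) auto

lemma sum_b_power: "(\<Sum>i<p. c i * b i) ^ p = (\<Sum>i<p. c i ^ p * u ^ i * t ^ (i * m mod p))"
  unfolding power_p_sum by (simp add: power_mult_distrib b_power mult.assoc)

lemma mod_p_inj: "\<not> p dvd m \<Longrightarrow> i < p \<Longrightarrow> j < p \<Longrightarrow> i * m mod p = j * m mod p \<Longrightarrow> i = j"
proof -
  assume *: "\<not> p dvd m" "i < p" "j < p" "i * m mod p = j * m mod p"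
  have "coprime m p" using *(1) p(1) prime_imp_coprime coprime_commute by blast
  then have "[i = j] (mod p)" using *(4) cong_mult_rcancel_nat unfolding cong_def by blast
  then show "i = j" using *(2,3) by (simp add: cong_def)
qed

text \<open>The \<open>p\<close>-th powers of the nonzero terms have valuations that are pairwise
  distinct modulo \<open>p\<close>, as \<open>i * m mod p\<close> determines \<open>i\<close>. So
  nothing cancels in the term of least valuation, and this valuation is below \<open>p\<close> if
  some \<open>c j\<close> is a unit.\<close>

lemma p_not_dvd_key:
  assumes "\<not> p dvd m" and c: "\<And>i. i < p \<Longrightarrow> c i \<in> A" and j: "j < p" "c j / t \<notin> A"
  shows "(\<Sum>i<p. c i * b i) ^ p / t ^ p \<notin> A"
proof
  assume *: "(\<Sum>i<p. c i * b i) ^ p / t ^ p \<in> A"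
  define S where "S = {i. i < p \<and> c i / t \<notin> A}"
  define f where "f i = i * m mod p" for i
  have fS: "finite (f ` S)" "f ` S \<noteq> {}" using j unfolding S_def by auto
  \<comment> \<open>Among the unit coefficients, the one with the least remainder gives the dominant
    term.\<close>
  obtain i where i: "i \<in> S" "f i = Min (f ` S)" using Min_in[OF fS] by auto
  have least: "f i < f l" if "l \<in> S" "l \<noteq> i" for l
  proof -
    have "f i \<le> f l" using Min_le[OF fS(1), of "f l"] that(1) unfolding i(2) by blast
    moreover have "f i \<noteq> f l" using mod_p_inj[OF assms(1)] i(1) that unfolding S_def f_def by blast
    ultimately show ?thesis by simp
  qed
  have ip: "i < p" "c i / t \<notin> A" using i(1) unfolding S_def by auto
  define g where "g l = c l ^ p * u ^ l * t ^ f l" for l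
  \<comment> \<open>Each other term has valuation above \<open>f i\<close>: a unit coefficient comes
    with a larger remainder, and the \<open>p\<close>-th power of a non-unit contributes
    \<open>t ^ p\<close>.\<close>
  have rest: "(\<Sum>l\<in>{..<p} - {i}. g l) / t ^ Suc (f i) \<in> A"
  proof (rule div_t_sum)
    fix l assume l: "l \<in> {..<p} - {i}"
    show "g l / t ^ Suc (f i) \<in> A"
    proof (cases "l \<in> S")
      case True
      then have "Suc (f i) \<le> f l" using least l by (simp add: Suc_leI)
      then have "t ^ f l / t ^ Suc (f i) \<in> A" using unit_power_div_iff[OF unit_in_1, of "f l" "Suc (f i)"] by (simp del: power_Suc)
      then show ?thesis
        unfolding g_def using c l u_power[of l] A_closed(7) unfolding unit_in_def
        by (intro div_t_mult A_closed(4)) auto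
    next
      case False
      then have "(c l / t) ^ p \<in> A" using l unfolding S_def by (intro A_closed(7)) auto
      then have "c l ^ p / t ^ p \<in> A" by (simp add: power_divide)
      moreover have "Suc (f i) \<le> p" unfolding f_def using p_pos by (simp add: Suc_leI)
      ultimately have "c l ^ p / t ^ Suc (f i) \<in> A" by (rule div_t_mono)
      then have "(u ^ l * t ^ f l) * c l ^ p / t ^ Suc (f i) \<in> A"
        using u_power[of l] t_power_in unfolding unit_in_def by (intro div_t_mult A_closed(4)) auto
      then show ?thesis unfolding g_def by (simp add: mult_ac)
    qed
  qed
  have "Suc (f i) \<le> p" unfolding f_def using p_pos by (simp add: Suc_leI)
  from div_t_mono[OF * this] have "(\<Sum>l<p. g l) / t ^ Suc (f i) \<in> A"
    unfolding sum_b_power g_def f_def .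
  moreover have "(\<Sum>l<p. g l) = g i + (\<Sum>l\<in>{..<p} - {i}. g l)"
    using ip by (intro sum.remove) auto
  ultimately have "g i / t ^ Suc (f i) \<in> A"
    using div_t_diff[OF _ rest] by (metis add_diff_cancel_right')
  then have "(c i ^ p * u ^ i) / t \<in> A" unfolding g_def using t by simp
  moreover have "unit_in (c i ^ p * u ^ i)"
    using unit_iff_not_div_t[OF c[OF ip(1)]] ip(2) by (intro unit_in_mult unit_in_power u) simp
  ultimately show False using unit_not_div_t by blast
qed

section \<open>The basis when \<open>p\<close> divides \<open>m\<close>\<close>

lemma p_dvd_b: "p dvd m \<Longrightarrow> b i = b 1 ^ i"
proof -
  assume "p dvd m"
  then have "i * m div p = (m div p) * i" by (simp add: div_mult_swap mult.commute)
  then show ?thesis unfolding b_def by (simp add: power_divide power_mult)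
qed

lemma p_dvd_b1_power: "p dvd m \<Longrightarrow> b 1 ^ p = u"
  unfolding b_power by simp

text \<open>If \<open>u\<close> were congruent to \<open>c ^ p\<close> modulo \<open>t\<close>, then
  \<open>a + t ^ (m div p) * c\<close> would approximate \<open>y\<close> better than the exponent
  \<open>m\<close> permits.\<close>

lemma p_dvd_not_power:
  assumes "p dvd m" "c \<in> A"
  shows "(u - c ^ p) / t \<notin> A"
proof
  assume *: "(u - c ^ p) / t \<in> A"
  define d where "d = a + t ^ (m div p) * c"
  have "d \<in> A" unfolding d_def using a assms(2) t_power_in A_closed(4,6) by blast
  have "(t ^ (m div p) * c) ^ p = t ^ m * c ^ p"
    using assms(1) by (simp add: power_mult_distrib power_mult[symmetric])
  moreover have "d ^ p - a ^ p = (t ^ (m div p) * c) ^ p"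
    using power_p_diff[of d a] unfolding d_def by simp
  moreover have "y ^ p - d ^ p = (y ^ p - a ^ p) - (d ^ p - a ^ p)" by simp
  ultimately have "y ^ p - d ^ p = u * t ^ m - t ^ m * c ^ p" unfolding ya by (simp only:)
  also have "\<dots> = (u - c ^ p) * t ^ m" by (simp add: left_diff_distrib)
  finally have "y ^ p - d ^ p = (u - c ^ p) * t ^ m" .
  then have "(y ^ p - d ^ p) / t ^ Suc m \<in> A" using * t by simp
  from max[OF \<open>d \<in> A\<close> this] show False by simp
qed

text \<open>In \<open>B\<close> modulo the elements of positive valuation, \<open>b 1\<close> is a
  \<open>p\<close>-th root of the class of \<open>u\<close>, which by \<open>p_dvd_not_power\<close>
  has none in the residue field of \<open>A\<close>. Hence the powers \<open>b i\<close> of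
  \<open>b 1\<close> are independent there. The single \<open>t\<close> in the conclusion, as
  opposed to \<open>t ^ p\<close>, later shows that certain elements of \<open>B\<close> are
  units.\<close>

lemma p_dvd_key:
  assumes "p dvd m" and c: "\<And>i. i < p \<Longrightarrow> c i \<in> A" and j: "j < p" "c j / t \<notin> A"
  shows "(\<Sum>i<p. c i * b i) ^ p / t \<notin> A"
proof
  assume *: "(\<Sum>i<p. c i * b i) ^ p / t \<in> A"
  define P where "P = {z \<in> B. z ^ p / t \<in> A}"
  have "prime_ideal_in B P"
    unfolding prime_ideal_in_def
  proof (intro conjI ballI impI)
    show "P \<subseteq> B" unfolding P_def by blast
    show "1 \<notin> P" unfolding P_def using t(3) by (simp add: inverse_eq_divide)
    show "subspace_over B P"
      unfolding subspace_over_def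
    proof (intro conjI ballI)
      show "0 \<in> P" unfolding P_def using A_closed(2) subring_set_0[OF B_subring] by (simp add: zero_power[OF p_pos])
      fix z w assume zw: "z \<in> P" "w \<in> P"
      have "(z + w) ^ p = z ^ p - (- w) ^ p" using power_p_diff[of z "- w"] by simp
      moreover have "(- w) ^ p = - (w ^ p)" using power_p_diff[of 0 w] p_pos by simp
      ultimately have "(z + w) ^ p / t = z ^ p / t + w ^ p / t" by (simp add: add_divide_distrib)
      then show "z + w \<in> P"
        using zw A_closed(6) subring_set_add[OF B_subring] unfolding P_def by auto
    next
      fix z w assume zw: "z \<in> B" "w \<in> P"
      then have "z ^ p * (w ^ p / t) \<in> A" unfolding P_def B_def by (intro A_closed(4)) auto
      then show "z * w \<in> P"
        using zw subring_set_mult[OF B_subring] unfolding P_def by (simp add: power_mult_distrib)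
    qed
    fix z w assume "z \<in> B" "w \<in> B" "z * w \<in> P"
    then show "z \<in> P \<or> w \<in> P"
      using prime_t[of "z ^ p" "w ^ p"] unfolding P_def B_def by (simp add: power_mult_distrib)
  qed
  moreover have "\<exists>d'\<in>A. d * d' - 1 \<in> P" if "d \<in> A" "d \<notin> P" for d
  proof -
    have "d ^ p / t \<notin> A" using that A_subset_B unfolding P_def by blast
    then have "d / t \<notin> A" using A_closed(4)[of "d ^ (p - 1)" "d / t"] A_closed(7)[OF that(1)] p_pos
      by (metis power_minus_mult times_divide_eq_right)
    then have "unit_in d" using unit_iff_not_div_t[OF that(1)] by simp
    then have "inverse d \<in> A" "d * inverse d - 1 = 0" unfolding unit_in_def by auto
    moreover have "0 \<in> P" unfolding P_def using A_closed(2) subring_set_0[OF B_subring] by (simp add: zero_power[OF p_pos])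
    ultimately show ?thesis by metis
  qed
  moreover have "b 1 ^ p - u \<in> P"
    unfolding p_dvd_b1_power[OF assms(1)] P_def
    using A_closed(2) subring_set_0[OF B_subring] by (simp add: zero_power[OF p_pos])
  moreover have "b 1 - d \<notin> P" if "d \<in> A" for d
    using p_dvd_not_power[OF assms(1) that] unfolding P_def
    by (simp add: power_p_diff p_dvd_b1_power[OF assms(1)] del: One_nat_def)
  moreover have "(\<Sum>i<p. c i * b 1 ^ i) \<in> P"
    using * sum_b_in_B[of c, OF c] unfolding P_def p_dvd_b[OF assms(1), symmetric] by blast
  moreover have "u \<in> A" using u unfolding unit_in_def by simp
  ultimately have "c j \<in> P"
    using inseparable_powers_independent[OF p B_subring A A_subset_B _ _ b_in_B, where P = P and c = c and a = u]
      c j(1) by blast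
  then have "c j ^ p / t \<in> A" unfolding P_def by simp
  then show False using prime_t_power[OF c[OF j(1)]] j(2) by blast
qed

text \<open>An element is divisible by \<open>t\<close> in \<open>B\<close> exactly if its
  \<open>p\<close>-th power is divisible by \<open>t ^ p\<close> in \<open>A\<close>. So
  divisibility by \<open>t\<close> can be read off the coordinates, whether or not \<open>p\<close>
  divides \<open>m\<close>.\<close>

lemma key:
  assumes c: "\<And>i. i < p \<Longrightarrow> c i \<in> A" and S: "(\<Sum>i<p. c i * b i) ^ p / t ^ p \<in> A" and j: "j < p"
  shows "c j / t \<in> A"
proof (rule ccontr)
  assume n: "c j / t \<notin> A"
  show False
  proof (cases "p dvd m")
    case True
    have "(\<Sum>i<p. c i * b i) ^ p / t ^ 1 \<in> A" using p_pos by (intro div_t_mono[OF S]) simp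
    then show False using p_dvd_key[of c j, OF True c j n] by simp
  qed (use p_not_dvd_key[of c j, OF _ c j n] S in blast)
qed

text \<open>Some \<open>t ^ N * z\<close> lies in \<open>T\<close>, whose basis of powers of
  \<open>y - a\<close> consists of multiples of the \<open>b i\<close>. Then \<open>key\<close>
  removes the factors \<open>t\<close> from all coordinates one at a time.\<close>

lemma b_basis:
  assumes "z \<in> B"
  shows "\<exists>c. (\<forall>i<p. c i \<in> A) \<and> z = (\<Sum>i<p. c i * b i)"
proof -
  obtain d where d: "d \<in> A" "d \<noteq> 0" "d * z \<in> T" using y_span unfolding T_def by blast
  from unit_decomposition[OF d(1,2)] obtain N v where v: "unit_in v" "d = v * t ^ N" .
  have "inverse v * (d * z) \<in> T"
    using v A_subset_T unfolding unit_in_def by (intro subring_set_mult[OF T_subring _ d(3)]) auto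
  then have "t ^ N * z \<in> T" using v unfolding unit_in_def by (simp add: mult.assoc[symmetric])
  then have "t ^ N * z \<in> powers_span A (y - a) p"
    unfolding T_def powers_span_translate[OF A yp_in p a] .
  then obtain c where c: "\<forall>i<p. c i \<in> A" "t ^ N * z = (\<Sum>i<p. c i * (y - a) ^ i)"
    unfolding powers_span_def by blast
  then have "\<forall>i<p. c i * t ^ (i * m div p) \<in> A" "t ^ N * z = (\<Sum>i<p. (c i * t ^ (i * m div p)) * b i)"
    using t_power_in A_closed(4) t unfolding b_def by auto
  then have "\<exists>c. (\<forall>i<p. c i \<in> A) \<and> t ^ N * z = (\<Sum>i<p. c i * b i)"
    by (intro exI[of _ "\<lambda>i. c i * t ^ (i * m div p)"] conjI)
  then show ?thesis
  proof (induction N)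
    case 0
    then show ?case by simp
  next
    case (Suc N)
    then obtain c where c: "\<forall>i<p. c i \<in> A" "t ^ Suc N * z = (\<Sum>i<p. c i * b i)" by blast
    have "(\<Sum>i<p. c i * b i) ^ p / t ^ p = (t ^ N * z) ^ p"
      unfolding c(2)[symmetric] using t by (simp add: power_mult_distrib)
    also have "\<dots> \<in> A" using assms t_power_in A_closed(4,7) unfolding B_def power_mult_distrib by blast
    finally have "\<forall>i<p. c i / t \<in> A" using key[of c] c(1) by blast
    moreover have "t ^ N * z = (t ^ Suc N * z) / t" using t by simp
    then have "t ^ N * z = (\<Sum>i<p. (c i / t) * b i)" unfolding c(2) sum_divide_distrib by simp
    ultimately have "\<exists>c. (\<forall>i<p. c i \<in> A) \<and> t ^ N * z = (\<Sum>i<p. c i * b i)"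
      by (intro exI[of _ "\<lambda>i. c i / t"] conjI)
    then show ?case by (rule Suc.IH)
  qed
qed

text \<open>The value 0 is divisible by every power of \<open>t\<close>, so repeated use of
  \<open>key\<close> makes each coefficient divisible by every power of \<open>t\<close>.\<close>

lemma b_indep:
  assumes c: "\<And>i. i < p \<Longrightarrow> c i \<in> A" "(\<Sum>i<p. c i * b i) = 0" and j: "j < p"
  shows "c j = 0"
proof -
  have "\<forall>i<p. c i / t ^ n \<in> A" for n
  proof (induction n)
    case 0
    then show ?case using c(1) by simp
  next
    case (Suc n)
    have "(\<Sum>i<p. (c i / t ^ n) * b i) = (\<Sum>i<p. c i * b i) / t ^ n"
      unfolding sum_divide_distrib by simp
    then have "(\<Sum>i<p. (c i / t ^ n) * b i) ^ p / t ^ p \<in> A"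
      unfolding c(2) using A_closed(2) by (simp add: zero_power[OF p_pos])
    then have "\<forall>i<p. (c i / t ^ n) / t \<in> A" using key[of "\<lambda>i. c i / t ^ n"] Suc by blast
    then show ?case by (simp add: mult.commute)
  qed
  then show ?thesis using eq_0_if_all_powers_divide c(1) j by blast
qed

text \<open>The lattice with basis \<open>t ^ e i * b i\<close>. It is \<open>B\<close> for
  exponents 0, \<open>t B\<close> for exponents 1 and \<open>T\<close> for
  \<open>e i = i * m div p\<close>, so one dimension count serves for \<open>B / t B\<close> and for
  \<open>B / T\<close>.\<close>

definition M :: "(nat \<Rightarrow> nat) \<Rightarrow> 'f set"
  where "M e = {\<Sum>i<p. c i * b i | c. \<forall>i<p. c i \<in> t_ideal (e i)}"

lemma M_0: "M (\<lambda>i. 0) = B"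
  unfolding M_def t_ideal_0 using sum_b_in_B b_basis by blast

lemma M_T: "M (\<lambda>i. i * m div p) = T"
proof -
  have "M (\<lambda>i. i * m div p) = powers_span A (y - a) p"
    unfolding M_def powers_span_def
  proof (intro equalityI subsetI)
    fix z assume "z \<in> {\<Sum>i<p. c i * b i | c. \<forall>i<p. c i \<in> t_ideal (i * m div p)}"
    then obtain c where c: "z = (\<Sum>i<p. c i * b i)" "\<forall>i<p. c i \<in> t_ideal (i * m div p)" by blast
    have "z = (\<Sum>i<p. (c i / t ^ (i * m div p)) * (y - a) ^ i)" unfolding c(1) b_def by simp
    with c(2) show "z \<in> {\<Sum>i<p. c i * (y - a) ^ i | c. \<forall>i<p. c i \<in> A}"
      unfolding t_ideal_def
      by (intro CollectI exI[of _ "\<lambda>i. c i / t ^ (i * m div p)"]) auto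
  next
    fix z assume "z \<in> {\<Sum>i<p. c i * (y - a) ^ i | c. \<forall>i<p. c i \<in> A}"
    then obtain c where c: "z = (\<Sum>i<p. c i * (y - a) ^ i)" "\<forall>i<p. c i \<in> A" by blast
    have "z = (\<Sum>i<p. (c i * t ^ (i * m div p)) * b i)" unfolding c(1) b_def using t by simp
    with c(2) show "z \<in> {\<Sum>i<p. c i * b i | c. \<forall>i<p. c i \<in> t_ideal (i * m div p)}"
      unfolding t_ideal_def using t
      by (intro CollectI exI[of _ "\<lambda>i. c i * t ^ (i * m div p)"]) auto
  qed
  then show ?thesis unfolding T_def powers_span_translate[OF A yp_in p a] .
qed

lemma M_1: "M (\<lambda>i. 1) = {z. z / t \<in> B}"
proof (intro equalityI subsetI)
  fix z assume "z \<in> M (\<lambda>i. 1)"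
  then obtain c where c: "z = (\<Sum>i<p. c i * b i)" "\<forall>i<p. c i / t \<in> A" unfolding M_def t_ideal_def by auto
  have "z / t = (\<Sum>i<p. (c i / t) * b i)" unfolding c(1) sum_divide_distrib by simp
  then show "z \<in> {z. z / t \<in> B}" using sum_b_in_B[of "\<lambda>i. c i / t"] c(2) by auto
next
  fix z assume "z \<in> {z. z / t \<in> B}"
  then obtain c where c: "\<forall>i<p. c i \<in> A" "z / t = (\<Sum>i<p. c i * b i)" using b_basis by blast
  have "z = (z / t) * t" using t by simp
  then have "z = (\<Sum>i<p. (c i * t) * b i)" unfolding c(2) sum_distrib_right by (simp add: mult_ac)
  then show "z \<in> M (\<lambda>i. 1)"
    unfolding M_def t_ideal_def using c(1) t by (intro CollectI exI[of _ "\<lambda>i. c i * t"]) auto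
qed

text \<open>\<open>N\<close> consists of the elements whose coordinate \<open>j\<close> vanishes.
  Modulo \<open>N\<close> only this coordinate is left, and the quotient becomes \<open>A\<close>
  modulo \<open>t ^ n A\<close>; \<open>b_indep\<close> provides the injectivity.\<close>

lemma qdim_M_update:
  assumes d: "qdim k A (t_ideal 1) d" and j: "j < p"
  shows "qdim k (M (e(j := 0))) (M (e(j := n))) (d * n)"
proof -
  define N where "N = {\<Sum>i<p. c i * b i | c. (\<forall>i<p. c i \<in> t_ideal (e i)) \<and> c j = 0}"
  have sub: "subspace_over k (t_ideal n)" for n
    using subspace_t_ideal k(2) unfolding subspace_over_def by blast
  have "subspace_over ((\<lambda>c. c) ` k) N"
    unfolding subspace_over_def N_def
  proof (intro conjI ballI)
    show "0 \<in> {\<Sum>i<p. c i * b i | c. (\<forall>i<p. c i \<in> t_ideal (e i)) \<and> c j = 0}"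
      using subspace_over_0[OF sub] by (intro CollectI exI[of _ "\<lambda>i. 0"]) auto
  next
    fix z w
    assume "z \<in> {\<Sum>i<p. c i * b i | c. (\<forall>i<p. c i \<in> t_ideal (e i)) \<and> c j = 0}"
      "w \<in> {\<Sum>i<p. c i * b i | c. (\<forall>i<p. c i \<in> t_ideal (e i)) \<and> c j = 0}"
    then obtain c c' where "z = (\<Sum>i<p. c i * b i)" "\<forall>i<p. c i \<in> t_ideal (e i)" "c j = 0"
      "w = (\<Sum>i<p. c' i * b i)" "\<forall>i<p. c' i \<in> t_ideal (e i)" "c' j = 0" by auto
    then show "z + w \<in> {\<Sum>i<p. c i * b i | c. (\<forall>i<p. c i \<in> t_ideal (e i)) \<and> c j = 0}"
      using subspace_over_add[OF sub]
      by (intro CollectI exI[of _ "\<lambda>i. c i + c' i"]) (auto simp: sum.distrib distrib_right)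
  next
    fix z w
    assume "z \<in> (\<lambda>c. c) ` k" "w \<in> {\<Sum>i<p. c i * b i | c. (\<forall>i<p. c i \<in> t_ideal (e i)) \<and> c j = 0}"
    then obtain c where "z \<in> k" "w = (\<Sum>i<p. c i * b i)" "\<forall>i<p. c i \<in> t_ideal (e i)" "c j = 0" by auto
    then show "z * w \<in> {\<Sum>i<p. c i * b i | c. (\<forall>i<p. c i \<in> t_ideal (e i)) \<and> c j = 0}"
      using subspace_over_scale[OF sub]
      by (intro CollectI exI[of _ "\<lambda>i. z * c i"]) (auto simp: sum_distrib_left mult.assoc)
  qed
  moreover have "v \<in> t_ideal n" if v: "v \<in> A" "v * b j \<in> N" for v
  proof -
    obtain c where c: "v * b j = (\<Sum>i<p. c i * b i)" "\<forall>i<p. c i \<in> t_ideal (e i)" "c j = 0"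
      using v(2) unfolding N_def by blast
    have "(\<Sum>i<p. (c(j := - v)) i * b i) = - v * b j + (\<Sum>i\<in>{..<p}-{j}. c i * b i)"
      using j by (subst sum.remove[of _ j]) auto
    also have "(\<Sum>i\<in>{..<p}-{j}. c i * b i) = (\<Sum>i<p. c i * b i)"
      using j c(3) by (subst (2) sum.remove[of _ j]) auto
    finally have "(\<Sum>i<p. (c(j := - v)) i * b i) = 0" using c(1) by simp
    moreover have "(c(j := - v)) i \<in> A" if "i < p" for i
      using that c(2) t_ideal_subset A_closed(5)[OF \<open>v \<in> A\<close>] by auto
    ultimately have "(c(j := - v)) j = 0" using b_indep[of "c(j := - v)"] j by blast
    then show ?thesis using subspace_over_0[OF sub] by simp
  qed
  ultimately have "qdim ((\<lambda>c. c) ` k) (sum_set N ((\<lambda>v. v * b j) ` A)) (sum_set N ((\<lambda>v. v * b j) ` t_ideal n)) (d * n)"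
    by (intro qdim_transport[OF qdim_t_ideal[OF k_subring k(2) d] k_subring sub])
       (auto simp: algebra_simps)
  moreover have "sum_set N ((\<lambda>v. v * b j) ` t_ideal l) = M (e(j := l))" for l
  proof (intro equalityI subsetI)
    fix z assume "z \<in> sum_set N ((\<lambda>v. v * b j) ` t_ideal l)"
    then obtain c v where c: "z = (\<Sum>i<p. c i * b i) + v * b j" "\<forall>i<p. c i \<in> t_ideal (e i)" "c j = 0"
      "v \<in> t_ideal l" unfolding sum_set_def N_def by auto
    have "(\<Sum>i<p. (c(j := v)) i * b i) = v * b j + (\<Sum>i\<in>{..<p}-{j}. c i * b i)"
      using j by (subst sum.remove[of _ j]) auto
    also have "(\<Sum>i\<in>{..<p}-{j}. c i * b i) = (\<Sum>i<p. c i * b i)"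
      using j c(3) by (subst (2) sum.remove[of _ j]) auto
    finally have "z = (\<Sum>i<p. (c(j := v)) i * b i)" using c(1) by simp
    then show "z \<in> M (e(j := l))"
      unfolding M_def using c by (intro CollectI exI[of _ "c(j := v)"]) auto
  next
    fix z assume "z \<in> M (e(j := l))"
    then obtain c where c: "z = (\<Sum>i<p. c i * b i)" "\<forall>i<p. c i \<in> t_ideal ((e(j := l)) i)"
      unfolding M_def by blast
    have "(\<Sum>i<p. (c(j := 0)) i * b i) = (\<Sum>i\<in>{..<p}-{j}. c i * b i)"
      using j by (subst sum.remove[of _ j]) auto
    then have z: "z = (\<Sum>i<p. (c(j := 0)) i * b i) + c j * b j"
      unfolding c(1) using j by (subst sum.remove[of _ j]) auto
    have "(\<Sum>i<p. (c(j := 0)) i * b i) \<in> N"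
      unfolding N_def using c(2) subspace_over_0[OF sub]
      by (intro CollectI exI[of _ "c(j := 0)"]) auto
    moreover have "c j \<in> t_ideal l" using c(2) j by auto
    ultimately show "z \<in> sum_set N ((\<lambda>v. v * b j) ` t_ideal l)" unfolding sum_set_def z by blast
  qed
  from this[of 0] this[of n]
  have "sum_set N ((\<lambda>v. v * b j) ` A) = M (e(j := 0))"
    "sum_set N ((\<lambda>v. v * b j) ` t_ideal n) = M (e(j := n))" unfolding t_ideal_0 by auto
  ultimately show ?thesis by simp
qed

text \<open>The exponents are lowered to 0 one coordinate at a time.\<close>

lemma qdim_M:
  assumes d: "qdim k A (t_ideal 1) d"
  shows "qdim k B (M e) (d * (\<Sum>i<p. e i))"
proof -
  have "qdim k (M (\<lambda>i. if i < j then 0 else e i)) (M e) (d * (\<Sum>i<j. e i))" if "j \<le> p" for j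
    using that
  proof (induction j)
    case 0
    show ?case by (simp add: qdim.refl)
  next
    case (Suc j)
    define f where "f = (\<lambda>i. if i < j then 0 else e i)"
    have "qdim k (M (f(j := 0))) (M (f(j := f j))) (d * f j)"
      by (rule qdim_M_update[OF d]) (use Suc.prems in simp)
    moreover have "f(j := 0) = (\<lambda>i. if i < Suc j then 0 else e i)" unfolding f_def by auto
    moreover have "f j = e j" unfolding f_def by simp
    ultimately have "qdim k (M (\<lambda>i. if i < Suc j then 0 else e i)) (M f) (d * e j)"
      by (metis fun_upd_triv)
    from qdim_trans[OF this[unfolded f_def] Suc.IH] Suc.prems show ?case by (simp add: algebra_simps)
  qed
  from this[of p] have "qdim k (M (\<lambda>i. if i < p then 0 else e i)) (M e) (d * (\<Sum>i<p. e i))" by simp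
  moreover have "M (\<lambda>i. if i < p then 0 else e i) = M (\<lambda>i. 0)" unfolding M_def by auto
  ultimately show ?thesis unfolding M_0[symmetric] by simp
qed

lemma subspace_k1_B: "subspace_over k1 B" and subspace_k1_T: "subspace_over k1 T"
  using subspace_subring[OF B_subring] subspace_subring[OF T_subring k1_subset_T] k1_subset_T T_subset_B
  by auto

lemma subspace_k1_multiples: "subspace_over k1 {z. z / s \<in> B}"
  using subspace_k1_B unfolding subspace_over_def
  by (auto simp: add_divide_distrib simp flip: times_divide_eq_right)

lemma dim_B_mod_T:
  assumes "qdim k A (t_ideal 1) d"
  shows "\<exists>g. qdim k1 B T g \<and> p * g = d * (\<Sum>i<p. i * m div p)"
  using qdim_k1[OF _ subspace_k1_B subspace_k1_T] qdim_M[OF assms, of "\<lambda>i. i * m div p"]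
  unfolding M_T by blast

text \<open>Since \<open>b' ^ p\<close> lies in \<open>A\<close>, it competes with \<open>a\<close>
  in the maximality of \<open>m\<close>. The exponent \<open>e\<close> lets one statement cover a
  uniformizer \<open>s\<close> of \<open>B\<close> in both kinds of step.\<close>

lemma approximation_bound:
  assumes "s ^ p = v * t ^ e" "unit_in v" "b' \<in> B" "(y - b' ^ p) / s ^ n \<in> B"
  shows "e * n \<le> m"
proof -
  have "((y - b' ^ p) / s ^ n) ^ p = (y ^ p - (b' ^ p) ^ p) / (v * t ^ e) ^ n"
    unfolding assms(1)[symmetric] power_divide power_p_diff by (simp add: power_mult[symmetric] mult.commute)
  then have "(y ^ p - (b' ^ p) ^ p) / (v * t ^ e) ^ n \<in> A" using assms(4) unfolding B_def by simp
  moreover have "v ^ n \<in> A" using unit_in_power[OF assms(2)] unfolding unit_in_def by simp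
  ultimately have "v ^ n * ((y ^ p - (b' ^ p) ^ p) / (v * t ^ e) ^ n) \<in> A" by (intro A_closed(4))
  also have "v ^ n * ((y ^ p - (b' ^ p) ^ p) / (v * t ^ e) ^ n) = (y ^ p - (b' ^ p) ^ p) / t ^ (e * n)"
    using assms(2) t unfolding unit_in_def by (simp add: power_mult_distrib power_mult)
  finally show ?thesis using max[of "b' ^ p"] assms(3) unfolding B_def by blast
qed

end

context dvr_set
begin

lemma prime_ideal_t: "prime_ideal_in A (t_ideal 1)"
  unfolding prime_ideal_in_def
proof (intro conjI ballI impI)
  show "1 \<notin> t_ideal 1" using t(3) unfolding t_ideal_def by (simp add: inverse_eq_divide)
  show "t_ideal 1 \<subseteq> A" "subspace_over A (t_ideal 1)" by (rule t_ideal_subset subspace_t_ideal)+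
  fix a b assume "a \<in> A" "b \<in> A" "a * b \<in> t_ideal 1"
  then show "a \<in> t_ideal 1 \<or> b \<in> t_ideal 1" using prime_t[of a b] unfolding t_ideal_def by simp
qed

end

section \<open>Uniformizer and residue field of the normalization\<close>

context optimal_step
begin

text \<open>A fraction of elements of \<open>A\<close> whose \<open>p\<close>-th power lies in
  \<open>A\<close> cannot have negative valuation.\<close>

lemma div_t_in_B:
  assumes "z \<in> A" "z / t ^ n \<in> B"
  shows "z / t ^ n \<in> A"
proof (cases "z = 0")
  case True
  then show ?thesis using A_closed(2) by simp
next
  case False
  from unit_decomposition[OF assms(1) False] obtain j w where w: "unit_in w" "z = w * t ^ j" .
  have "w ^ p * t ^ (p * j) / t ^ (p * n) \<in> A"
    using assms(2) unfolding B_def w(2) by (simp add: power_divide power_mult_distrib power_mult[symmetric] mult.commute)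
  then have "p * n \<le> p * j" unfolding unit_power_div_iff[OF unit_in_power[OF w(1)]] .
  then have "n \<le> j" using p_pos by simp
  then show ?thesis unfolding w(2) unit_power_div_iff[OF w(1)] .
qed

text \<open>An inverse \<open>i\<close> of \<open>m\<close> modulo \<open>p\<close> gives
  \<open>i * m mod p = 1\<close>, so the \<open>p\<close>-th power of \<open>b i\<close> has
  valuation 1. The residue field does not grow, but its dimension is now counted over
  \<open>k1\<close>, which divides it by \<open>p\<close>.\<close>

lemma ramified:
  assumes "\<not> p dvd m"
  obtains s v where "dvr_set B s" "unit_in v" "s ^ p = v * t"
    "\<And>d. qdim k A (t_ideal 1) d \<Longrightarrow> \<exists>d1. qdim k1 B {z. z / s \<in> B} d1 \<and> p * d1 = d"
proof -
  have "coprime m p" using assms p(1) prime_imp_coprime coprime_commute by blast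
  then obtain i where i: "[m * i = 1] (mod p)" using cong_solve_coprime_nat[of m p] by auto
  define s where "s = b i"
  define v where "v = u ^ i"
  have "i * m mod p = 1" using i p_gt_1 unfolding cong_def by (simp add: mult.commute)
  then have sp: "s ^ p = v * t" unfolding s_def v_def b_power by simp
  have v: "unit_in v" unfolding v_def by (rule u_power)
  then have v': "v \<in> A" "inverse v \<in> A" "v \<noteq> 0" unfolding unit_in_def by auto
  have sB: "s \<in> B" unfolding s_def by (rule b_in_B)
  have s0: "s \<noteq> 0"
  proof
    assume "s = 0"
    then show False using sp v'(3) t(2) by (simp add: zero_power[OF p_pos])
  qed
  have div_s: "z / s \<in> B \<longleftrightarrow> z ^ p / t \<in> A" for z
  proof -
    have eq: "(z / s) ^ p = inverse v * (z ^ p / t)" "z ^ p / t = v * (z / s) ^ p"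
      unfolding power_divide sp using v'(3) by (simp_all add: field_simps)
    show ?thesis
    proof
      assume "z / s \<in> B"
      then show "z ^ p / t \<in> A" unfolding eq(2) B_def using A_closed(4)[OF v'(1)] by blast
    next
      assume "z ^ p / t \<in> A"
      then show "z / s \<in> B" unfolding B_def mem_Collect_eq eq(1) by (rule A_closed(4)[OF v'(2)])
    qed
  qed
  have dvr: "dvr_set B s"
  proof
    show "subring_set B" by (rule B_subring)
    show "s \<in> B" "s \<noteq> 0" by fact+
    show "inverse s \<notin> B"
      using div_s[of 1] t(3) by (simp add: inverse_eq_divide)
  next
    fix z assume z: "z \<in> B" "z \<noteq> 0"
    then have "z ^ p \<in> A" "z ^ p \<noteq> 0" unfolding B_def by auto
    from unit_decomposition[OF this] obtain n w where w: "unit_in w" "z ^ p = w * t ^ n" .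
    define q where "q = z / s ^ n"
    have "q ^ p = z ^ p / (s ^ p) ^ n" unfolding q_def power_divide by (simp add: power_mult[symmetric] mult.commute)
    also have "\<dots> = w * inverse (v ^ n)"
      unfolding sp w(2) using t v'(3) by (simp add: power_mult_distrib field_simps)
    finally have qp: "q ^ p = w * inverse (v ^ n)" .
    have "unit_in (q ^ p)" unfolding qp by (intro unit_in_mult unit_in_inverse unit_in_power w(1) v)
    then have "q \<in> B" "inverse q \<in> B" unfolding B_def unit_in_def by (auto simp: power_inverse)
    moreover have "z = q * s ^ n" unfolding q_def using s0 by simp
    ultimately show "\<exists>n u. u \<in> B \<and> inverse u \<in> B \<and> z = u * s ^ n" by blast
  qed
  have dims: "\<exists>d1. qdim k1 B {z. z / s \<in> B} d1 \<and> p * d1 = d" if d: "qdim k A (t_ideal 1) d" for d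
  proof -
    let ?N = "{z. z / s \<in> B}"
    note N = subspace_k1_multiples[of s]
    have kN: "subspace_over k ?N" by (rule subspace_k_of_k1[OF N])
    have AB: "subspace_over k B" by (rule subspace_k_of_k1[OF subspace_k1_B])
    have ti: "subspace_over k (t_ideal 1)" using subspace_t_ideal k(2) unfolding subspace_over_def by blast
    have NB: "?N \<subseteq> B"
    proof
      fix z assume "z \<in> ?N"
      then have "s * (z / s) \<in> B" using sB by (intro subring_set_mult[OF B_subring]) auto
      then show "z \<in> B" using s0 by simp
    qed
    have mem: "v \<in> t_ideal 1" if "v \<in> A" "v \<in> ?N" for v
      using that div_s[of v] prime_t_power[of v p] unfolding t_ideal_def by auto
    have "qdim ((\<lambda>c. c) ` k) (sum_set ?N ((\<lambda>z. z) ` A)) (sum_set ?N ((\<lambda>z. z) ` t_ideal 1)) d"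
      by (rule qdim_transport[OF d k_subring ti]) (use kN mem in auto)
    then have 1: "qdim k (sum_set ?N A) (sum_set ?N (t_ideal 1)) d" by simp
    have "t_ideal 1 \<subseteq> ?N"
    proof
      fix z assume z: "z \<in> t_ideal 1"
      then have "z \<in> A" using t_ideal_subset by blast
      then have "z ^ (p - 1) * (z / t) \<in> A"
        using z unfolding t_ideal_def by (intro A_closed(4) A_closed(7)) auto
      moreover have "z ^ p = z ^ (p - 1) * z" by (rule power_minus_mult[OF p_pos, symmetric])
      ultimately show "z \<in> ?N" using div_s[of z] by simp
    qed
    then have 2: "sum_set ?N (t_ideal 1) = ?N"
      by (intro sum_set_absorb2[OF kN]) (auto simp: subspace_over_0[OF ti] simp del: One_nat_def)
    \<comment> \<open>Every residue class of \<open>B\<close> comes from \<open>A\<close>: for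
      \<open>0 < i < p\<close> the remainder \<open>i * m mod p\<close> is positive, which makes
      \<open>b i\<close> a multiple of \<open>s\<close>, and \<open>b 0 = 1\<close>.\<close>
    have 3: "sum_set ?N A = B"
    proof (intro equalityI subsetI)
      fix z assume "z \<in> sum_set ?N A"
      then show "z \<in> B"
        using NB A_subset_B unfolding sum_set_def by (auto intro: subring_set_add[OF B_subring])
    next
      fix z assume "z \<in> B"
      then obtain c where c: "\<forall>i<p. c i \<in> A" "z = (\<Sum>i<p. c i * b i)" using b_basis by blast
      have "(\<Sum>i\<in>{..<p}-{0}. c i * b i) \<in> ?N"
      proof (rule subspace_over_sum[OF kN])
        fix i assume i: "i \<in> {..<p} - {0}"
        have "i * m mod p \<noteq> 0" using mod_p_inj[OF assms, of i 0] i by auto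
        then have "t ^ (i * m mod p) = t * t ^ (i * m mod p - 1)" by (metis not_gr_zero power_minus_mult mult.commute)
        then have "(c i * b i) ^ p / t = c i ^ p * (u ^ i * t ^ (i * m mod p - 1))"
          using t unfolding power_mult_distrib b_power by simp
        also have "\<dots> \<in> A"
          using c(1) i u_power[of i] t_power_in A_closed(4,7) unfolding unit_in_def by auto
        finally show "c i * b i \<in> ?N" using div_s by simp
      qed
      moreover have "z = (\<Sum>i\<in>{..<p}-{0}. c i * b i) + c 0 * b 0"
        unfolding c(2) using p_pos by (subst sum.remove[of _ 0]) auto
      moreover have "c 0 * b 0 \<in> A" using c(1) p_pos unfolding b_def by simp
      ultimately show "z \<in> sum_set ?N A" unfolding sum_set_def by blast
    qed
    show ?thesis using qdim_k1[OF 1[unfolded 2 3] subspace_k1_B N] .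
  qed
  show thesis by (rule that[OF dvr v sp dims])
qed

text \<open>Once the largest power of \<open>t\<close> is removed from an element of
  \<open>B\<close>, some coordinate is a unit, and \<open>p_dvd_key\<close> makes the
  \<open>p\<close>-th power of the rest a unit. So \<open>t\<close> remains a uniformizer. The
  quotient \<open>B / t B\<close> has dimension \<open>p d\<close> over \<open>k\<close>, hence
  \<open>d\<close> over \<open>k1\<close>.\<close>

lemma unramified:
  assumes "p dvd m"
  shows "dvr_set B t" "qdim k A (t_ideal 1) d \<Longrightarrow> qdim k1 B {z. z / t \<in> B} d"
proof -
  have tB: "inverse t \<notin> B"
    using unit_power_div_iff[OF unit_in_1, of 0 p] p_pos unfolding B_def
    by (simp add: power_inverse inverse_eq_divide power_divide)
  show "dvr_set B t"
  proof
    show "subring_set B" by (rule B_subring)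
    show "t \<in> B" "t \<noteq> 0" using t(1,2) A_subset_B by auto
    show "inverse t \<notin> B" by (rule tB)
  next
    fix z assume z: "z \<in> B" "z \<noteq> 0"
    then have "z ^ p \<in> A" "z ^ p \<noteq> 0" unfolding B_def by auto
    from unit_decomposition[OF this] obtain N w where w: "unit_in w" "z ^ p = w * t ^ N" .
    define Q where "Q n \<longleftrightarrow> z / t ^ n \<in> B" for n
    have "Q 0" unfolding Q_def using z by simp
    have QN: "n \<le> N" if "Q n" for n
    proof -
      have "w * t ^ N / t ^ (p * n) \<in> A"
        using that unfolding Q_def B_def by (simp add: power_divide w(2) power_mult[symmetric] mult.commute)
      then have "p * n \<le> N" unfolding unit_power_div_iff[OF w(1)] .
      then show ?thesis using p_pos by (metis le_trans mult_le_mono1 nat_mult_1 Suc_leI One_nat_def)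
    qed
    define n where "n = (GREATEST n. Q n)"
    have "Q n" unfolding n_def by (rule GreatestI_nat[of Q, OF \<open>Q 0\<close> QN])
    have not: "\<not> Q (Suc n)"
      using Greatest_le_nat[of Q "Suc n" N] QN unfolding n_def by fastforce
    define q where "q = z / t ^ n"
    have qB: "q \<in> B" using \<open>Q n\<close> unfolding Q_def q_def .
    then obtain c where c: "\<forall>i<p. c i \<in> A" "q = (\<Sum>i<p. c i * b i)" using b_basis by blast
    have "\<exists>j<p. c j / t \<notin> A"
    proof (rule ccontr)
      assume "\<not> (\<exists>j<p. c j / t \<notin> A)"
      then have "(\<Sum>i<p. (c i / t) * b i) \<in> B" by (intro sum_b_in_B) auto
      then have "q / t \<in> B" unfolding c(2) sum_divide_distrib by simp
      then show False using not unfolding Q_def q_def by (simp add: mult.commute)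
    qed
    then have "q ^ p / t \<notin> A" using p_dvd_key[of c, OF assms] c by blast
    then have "unit_in (q ^ p)" using unit_iff_not_div_t qB unfolding B_def by blast
    then have "inverse q \<in> B" unfolding B_def unit_in_def by (simp add: power_inverse)
    moreover have "z = q * t ^ n" unfolding q_def using t by simp
    ultimately show "\<exists>n u. u \<in> B \<and> inverse u \<in> B \<and> z = u * t ^ n" using qB by blast
  qed
  assume d: "qdim k A (t_ideal 1) d"
  have "qdim k B {z. z / t \<in> B} (d * p)" using qdim_M[OF d, of "\<lambda>i. 1"] unfolding M_1 by simp
  from qdim_k1[OF this subspace_k1_B subspace_k1_multiples]
  obtain d' where "qdim k1 B {z. z / t \<in> B} d'" "p * d' = d * p" by blast
  then show "qdim k1 B {z. z / t \<in> B} d" using p_pos by simp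
qed

text \<open>Modulo \<open>t B\<close> the space \<open>A + t B\<close> is \<open>A / t A\<close>, of
  dimension \<open>d\<close> over \<open>k\<close>. A vector space over \<open>k1\<close> has a
  multiple of \<open>p\<close> as its dimension over \<open>k\<close>.\<close>

lemma p_dvd_residue_degree:
  assumes "p dvd m" "m > 0" and d: "qdim k A (t_ideal 1) d"
  shows "p dvd d"
proof -
  let ?N = "{z. z / t \<in> B}"
  note N = subspace_k1_multiples[of t]
  have kN: "subspace_over k ?N" by (rule subspace_k_of_k1[OF N])
  have ti: "subspace_over k (t_ideal 1)" using subspace_t_ideal k(2) unfolding subspace_over_def by blast
  have mem: "v \<in> t_ideal 1" if "v \<in> A" "v \<in> ?N" for v
    using that div_t_in_B[of v 1] unfolding t_ideal_def by auto
  have "qdim ((\<lambda>c. c) ` k) (sum_set ?N ((\<lambda>z. z) ` A)) (sum_set ?N ((\<lambda>z. z) ` t_ideal 1)) d"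
    by (rule qdim_transport[OF d k_subring ti]) (use kN mem in auto)
  moreover have "t_ideal 1 \<subseteq> ?N" using A_subset_B unfolding t_ideal_def by auto
  then have "sum_set ?N (t_ideal 1) = ?N"
    by (intro sum_set_absorb2[OF kN]) (auto simp: subspace_over_0[OF ti] simp del: One_nat_def)
  ultimately have V: "qdim k (sum_set ?N A) ?N d" by simp
  have NB: "z * w \<in> ?N" if "z \<in> ?N" "w \<in> B" for z w
    using subring_set_mult[OF B_subring, of "z / t" w] that by simp
  have Vring: "subring_set (sum_set ?N A)"
    unfolding subring_set_def
  proof (intro conjI ballI)
    have "0 + 1 \<in> sum_set ?N A"
      unfolding sum_set_def using A_closed(1) subspace_over_0[OF kN] by blast
    then show "1 \<in> sum_set ?N A" by simp
    fix z w assume "z \<in> sum_set ?N A" "w \<in> sum_set ?N A"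
    then obtain n a n' a' where *: "z = n + a" "w = n' + a'" "n \<in> ?N" "n' \<in> ?N" "a \<in> A" "a' \<in> A"
      unfolding sum_set_def by blast
    have "z - w = (n - n') + (a - a')" "z * w = (n * (n' + a') + n' * a) + a * a'"
      using * by (simp_all add: algebra_simps)
    moreover have "n - n' \<in> ?N" by (rule subspace_over_diff[OF kN k_subring *(3,4)])
    moreover have "n' + a' \<in> B"
    proof -
      have "t * (n' / t) + a' \<in> B"
        using * A_subset_B t(1) by (intro subring_set_add[OF B_subring] subring_set_mult[OF B_subring]) auto
      then show ?thesis using t by simp
    qed
    then have "n * (n' + a') + n' * a \<in> ?N"
      using * A_subset_B by (intro subspace_over_add[OF kN] NB) auto
    ultimately show "z - w \<in> sum_set ?N A" "z * w \<in> sum_set ?N A"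
      unfolding sum_set_def using A_closed(3,4) *(5,6) by blast+
  qed
  \<comment> \<open>\<open>m > 0\<close> and \<open>p dvd m\<close> make \<open>m div p\<close>
    positive, so \<open>y - a\<close> is a multiple of \<open>t\<close> in \<open>B\<close>.\<close>
  have "y = t ^ (m div p) * b 1 + a" unfolding b_def using t by simp
  moreover have "t ^ (m div p) * b 1 \<in> ?N"
  proof -
    have "m div p > 0" using assms(1,2) p_pos by (metis dvd_div_eq_0_iff gr0I)
    then have "t ^ (m div p) = t * t ^ (m div p - 1)" by (metis power_minus_mult mult.commute)
    then have "t ^ (m div p) * b 1 / t = t ^ (m div p - 1) * b 1" using t by simp
    also have "\<dots> \<in> B" using t_power_in A_subset_B b_in_B by (intro subring_set_mult[OF B_subring]) auto
    finally show ?thesis by simp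
  qed
  ultimately have yV: "y \<in> sum_set ?N A" unfolding sum_set_def using a by blast
  have "k1 \<subseteq> sum_set ?N A"
  proof
    fix z assume "z \<in> k1"
    then obtain c where c: "\<forall>i<p. c i \<in> k" "z = (\<Sum>i<p. c i * y ^ i)" using k1_span by blast
    have "c i \<in> sum_set ?N A" if "i < p" for i
    proof -
      have "0 + c i \<in> sum_set ?N A"
        unfolding sum_set_def using subspace_over_0[OF kN] c(1) k(2) that by blast
      then show ?thesis by simp
    qed
    then show "z \<in> sum_set ?N A" unfolding c(2)
      by (intro subring_set_sum[OF Vring] subring_set_mult[OF Vring] subring_set_power[OF Vring] yV) auto
  qed
  then have "subspace_over k1 (sum_set ?N A)" using subspace_subring[OF Vring] by blast
  from qdim_k1[OF V this N] show ?thesis by auto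
qed

text \<open>A generator \<open>\<alpha>\<close> of the residue field of \<open>B\<close> over that of \<open>A0\<close> would satisfy an equation
  \<open>\<alpha> ^ p = a0\<close> with \<open>a0\<close> in the residue field of \<open>A0\<close>, so \<open>z\<close> would be a polynomial in \<open>\<alpha>\<close> of degree
  less than \<open>p\<close> over that field. But the powers of \<open>\<alpha>\<close> are independent even over the residue field
  of \<open>A\<close>, which puts the class of \<open>z\<close> in the residue field of \<open>A0\<close>.\<close>

lemma residue_field_not_simple:
  assumes "p dvd m" and A0: "subring_set A0" "A0 \<subseteq> A" and pw: "\<And>c. c \<in> A \<Longrightarrow> c ^ p \<in> A0"
    and u0: "u0 \<in> A0" "(u - u0) / t \<in> A" and z: "z \<in> A" "\<And>r. r \<in> A0 \<Longrightarrow> (z - r) / t \<notin> A"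
    and \<alpha>: "\<alpha> \<in> B"
  shows "\<exists>w\<in>B. \<forall>f. coeffs_in A0 f \<longrightarrow> (w - poly f \<alpha>) / t \<notin> B"
proof (rule ccontr)
  assume "\<not> ?thesis"
  then have gen: "\<And>w. w \<in> B \<Longrightarrow> \<exists>f. coeffs_in A0 f \<and> (w - poly f \<alpha>) / t \<in> B" by blast
  interpret B: dvr_set B t by (rule unramified[OF assms(1)])
  define P where "P = B.t_ideal 1"
  have P_iff: "w \<in> P \<longleftrightarrow> w / t \<in> B" for w unfolding P_def B.t_ideal_def by simp
  have prime: "prime_ideal_in B P" unfolding P_def by (rule B.prime_ideal_t)
  have P: "subspace_over B P" using prime unfolding prime_ideal_in_def by simp
  have A0B: "A0 \<subseteq> B" using A0 A_subset_B by blast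
  obtain c where c: "\<forall>i<p. c i \<in> A" "\<alpha> = (\<Sum>i<p. c i * b i)" using b_basis[OF \<alpha>] by blast
  \<comment> \<open>This is \<open>\<alpha> ^ p\<close> with \<open>u\<close> replaced by
    \<open>u0\<close>. The two agree modulo \<open>t\<close>, and \<open>a0\<close> lies in
    \<open>A0\<close> because the \<open>p\<close>-th powers of elements of \<open>A\<close>
    do.\<close>
  define a0 where "a0 = (\<Sum>i<p. c i ^ p * u0 ^ i)"
  have a0: "a0 \<in> A0"
    unfolding a0_def using c(1) pw u0(1)
    by (auto intro!: subring_set_sum[OF A0(1)] subring_set_mult[OF A0(1)] intro: subring_set_power[OF A0(1)])
  have uA: "u \<in> A" using u unfolding unit_in_def by simp
  have "\<alpha> ^ p - a0 = (\<Sum>i<p. c i ^ p * (u ^ i - u0 ^ i))"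
  proof -
    have "\<alpha> ^ p = (\<Sum>i<p. c i ^ p * u ^ i)"
      unfolding c(2) sum_b_power using assms(1) by (intro sum.cong) auto
    then show ?thesis unfolding a0_def by (simp add: sum_subtractf right_diff_distrib)
  qed
  also have "\<dots> \<in> P"
  proof (rule subspace_over_sum[OF P])
    fix i assume i: "i \<in> {..<p}"
    have "u ^ i - u0 ^ i = (\<Sum>j<i. u0 ^ (i - Suc j) * u ^ j) * (u - u0)"
      by (simp add: power_diff_sumr2 mult.commute)
    moreover have "u - u0 \<in> P" using u0(2) A_subset_B unfolding P_iff by blast
    moreover have "(\<Sum>j<i. u0 ^ (i - Suc j) * u ^ j) \<in> B"
      using A0B A_subset_B u0(1) uA
      by (intro subring_set_sum[OF B_subring] subring_set_mult[OF B_subring] subring_set_power[OF B_subring]) auto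
    ultimately have "u ^ i - u0 ^ i \<in> P" using subspace_over_scale[OF P] by simp
    moreover have "c i ^ p \<in> B" using c(1) i A_subset_B A_closed(7) by blast
    ultimately show "c i ^ p * (u ^ i - u0 ^ i) \<in> P" by (intro subspace_over_scale[OF P])
  qed
  finally have \<alpha>p: "\<alpha> ^ p - a0 \<in> P" .
  \<comment> \<open>If \<alpha> were congruent to some \<open>d\<close> in \<open>A\<close>, then
    \<open>b 1\<close>, congruent to a polynomial in \<alpha>, would be congruent to
    \<open>poly f d\<close>, and \<open>u = b 1 ^ p\<close> would be a \<open>p\<close>-th power
    modulo \<open>t\<close>.\<close>
  have \<alpha>_new: "\<alpha> - d \<notin> P" if d: "d \<in> A" for d
  proof
    assume \<alpha>d: "\<alpha> - d \<in> P"
    obtain f where f: "coeffs_in A0 f" "b 1 - poly f \<alpha> \<in> P" using gen[OF b_in_B] unfolding P_iff by blast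
    have fB: "coeffs_in B f" using f(1) A0B unfolding coeffs_in_def by blast
    have "poly f \<alpha> - poly f d \<in> P"
    proof -

      have dB: "d \<in> B" using d A_subset_B by blast
      have fd: "coeffs_in B (f - [:poly f d:])"
        by (intro coeffs_in_diff[OF B_subring fB] coeffs_in_const[OF B_subring] poly_in[OF B_subring fB dB])
      have lin: "coeffs_in B [:- d, 1:]"
        by (intro coeffs_in_linear[OF B_subring] subring_set_uminus[OF B_subring] dB)
      obtain q' r' where qr: "coeffs_in B q'" "f - [:poly f d:] = q' * [:- d, 1:] + r'" "degree r' < 1"
        using division_by_monic[OF B_subring lin _ _ fd] by auto
      have "poly r' d = 0" using arg_cong[OF qr(2), of "\<lambda>g. poly g d"] by simp
      moreover obtain r0 where "r' = [:r0:]" using qr(3) by (metis degree_eq_zeroE less_one)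
      ultimately have "r' = 0" by simp
      then have "poly f \<alpha> - poly f d = poly q' \<alpha> * (\<alpha> - d)"
        using arg_cong[OF qr(2), of "\<lambda>g. poly g \<alpha>"] by (simp add: algebra_simps)
      then show ?thesis
        using subspace_over_scale[OF P poly_in[OF B_subring qr(1) \<alpha>] \<alpha>d] by simp
    qed
    from subspace_over_add[OF P f(2) this] have "b 1 - poly f d \<in> P" by simp
    moreover have fd: "poly f d \<in> A"
      using f(1) A0(2) by (intro poly_in[OF A _ d]) (auto simp: coeffs_in_def)
    ultimately have "(u - poly f d ^ p) / t ^ p \<in> A"
      unfolding P_iff B_def by (simp add: power_divide power_p_diff p_dvd_b1_power[OF assms(1)] del: One_nat_def)
    then have "(u - poly f d ^ p) / t ^ 1 \<in> A" by (rule div_t_mono) (use p_pos in simp)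
    then show False using p_dvd_not_power[OF assms(1) fd] by simp
  qed
  obtain f where f: "coeffs_in A0 f" "z - poly f \<alpha> \<in> P"
    using gen[of z] z(1) A_subset_B unfolding P_iff by blast
  \<comment> \<open>Reduction modulo \<open>X ^ p - a0\<close> brings the degree of \<open>f\<close>
    below \<open>p\<close> at the cost of an error in \<open>P\<close>.\<close>
  define g where "g = monom 1 p - [:a0:]"
  have dg: "degree g = p" unfolding g_def using p_pos degree_add_eq_left[of "- [:a0:]" "monom 1 p"]
    by (simp add: Polynomial.degree_monom_eq diff_conv_add_uminus[of "monom 1 p"])
  have lg: "lead_coeff g = 1" unfolding dg unfolding g_def
    using p_pos by (simp add: coeff_pCons split: nat.splits)
  have "coeffs_in A0 g" unfolding g_def
    by (intro coeffs_in_diff coeffs_in_monom coeffs_in_const A0 a0 subring_set_1)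
  then obtain q r where qr: "coeffs_in A0 q" "coeffs_in A0 r" "f = q * g + r" "degree r < p"
    using division_by_monic[OF A0(1) _ lg _ f(1)] dg p_pos by auto
  have mono: "coeffs_in B h" if "coeffs_in A0 h" for h
    using that A0B unfolding coeffs_in_def by blast
  have "poly q \<alpha> * (\<alpha> ^ p - a0) \<in> P"
    by (intro subspace_over_scale[OF P] poly_in[OF B_subring mono[OF qr(1)] \<alpha>] \<alpha>p)
  moreover have "poly f \<alpha> = poly q \<alpha> * (\<alpha> ^ p - a0) + poly r \<alpha>"
    unfolding qr(3) g_def by (simp add: Polynomial.poly_monom)
  ultimately have zr: "z - poly r \<alpha> \<in> P"
    using subspace_over_add[OF P f(2)] by (metis add_diff_cancel_left' add_diff_eq diff_add_cancel diff_diff_add)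
  \<comment> \<open>The congruence between \<open>z\<close> and \<open>poly r \<alpha>\<close>, read
    as a relation between powers of \<alpha> with coefficients in \<open>A\<close>. Its constant
    coefficient \<open>z - coeff r 0\<close> has to vanish modulo \<open>P\<close>, which
    contradicts the choice of \<open>z\<close>.\<close>
  define e where "e = (\<lambda>i. if i = 0 then z - coeff r 0 else - coeff r i)"
  have "(\<Sum>i<p. e i * \<alpha> ^ i) = z - (\<Sum>i<p. coeff r i * \<alpha> ^ i)"
  proof -
    have "(\<Sum>i<p. e i * \<alpha> ^ i) = e 0 + (\<Sum>i\<in>{..<p}-{0}. e i * \<alpha> ^ i)"
      using p_pos by (subst sum.remove[of _ 0]) auto
    also have "(\<Sum>i\<in>{..<p}-{0}. e i * \<alpha> ^ i) = - (\<Sum>i\<in>{..<p}-{0}. coeff r i * \<alpha> ^ i)"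
      unfolding sum_negf[symmetric] by (intro sum.cong) (auto simp: e_def)
    also have "(\<Sum>i<p. coeff r i * \<alpha> ^ i) = coeff r 0 + (\<Sum>i\<in>{..<p}-{0}. coeff r i * \<alpha> ^ i)"
      using p_pos by (subst sum.remove[of _ 0]) auto
    ultimately show ?thesis by (simp add: e_def)
  qed
  then have "(\<Sum>i<p. e i * \<alpha> ^ i) \<in> P" using zr poly_eq_sum_lessThan[OF qr(4), of \<alpha>] by simp
  moreover have "e i \<in> A" for i
  proof -
    have "coeff r i \<in> A" for i using qr(2) A0(2) unfolding coeffs_in_def by blast
    then show ?thesis unfolding e_def using z(1) A_closed(3,5) by auto
  qed
  moreover have "\<exists>d'\<in>A. d * d' - 1 \<in> P" if "d \<in> A" "d \<notin> P" for d
  proof -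
    have "d / t \<notin> A" using that(2) A_subset_B unfolding P_iff by blast
    then have "unit_in d" using unit_iff_not_div_t[OF that(1)] by simp
    then have "inverse d \<in> A" "d * inverse d - 1 = 0" unfolding unit_in_def by auto
    then show ?thesis using subspace_over_0[OF P] by metis
  qed
  ultimately have "e 0 \<in> P"
    using inseparable_powers_independent[OF p B_subring A A_subset_B prime _ \<alpha> _ \<alpha>p \<alpha>_new, where c = e]
      p_pos a0 A0(2) by blast
  then have "(z - coeff r 0) / t ^ 1 \<in> B" unfolding e_def P_iff by simp
  moreover have "z - coeff r 0 \<in> A" using \<open>\<And>i. e i \<in> A\<close>[of 0] unfolding e_def by simp
  ultimately have "(z - coeff r 0) / t ^ 1 \<in> A" using div_t_in_B by blast
  then show False using z(2)[of "coeff r 0"] qr(2) unfolding coeffs_in_def by simp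
qed

end

section \<open>Sums of floors\<close>

definition floor_sum :: "nat \<Rightarrow> nat \<Rightarrow> nat"
  where "floor_sum p m = (\<Sum>i<p. i * m div p)"

lemma floor_sum_mono: "m \<le> n \<Longrightarrow> floor_sum p m \<le> floor_sum p n"
  unfolding floor_sum_def by (intro sum_mono div_le_mono) simp

lemma double_sum_lessThan: "2 * (\<Sum>i<p. i) = p * (p - 1 :: nat)"
  using gauss_sum_nat[of "p - 1"] by (cases p) (auto simp: lessThan_Suc_atMost atMost_atLeast0)

lemma floor_sum_dvd:
  assumes "p dvd m" "p > 0"
  shows "2 * floor_sum p m = m * (p - 1)"
proof -
  obtain n where n: "m = p * n" using assms(1) by blast
  have "floor_sum p m = (\<Sum>i<p. i) * n"
    unfolding floor_sum_def n sum_distrib_right using assms(2)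
    by (intro sum.cong) (auto simp: mult.left_commute)
  then have "2 * floor_sum p m = (2 * (\<Sum>i<p. i)) * n" by simp
  then show ?thesis unfolding double_sum_lessThan n by (simp add: mult_ac)
qed

text \<open>Multiplication by \<open>m\<close> permutes the residues modulo \<open>p\<close>, so the
  remainders of the \<open>i * m\<close> sum up to the sum of all \<open>i < p\<close>. This sum is
  the defect against exact division.\<close>

lemma floor_sum_not_dvd:
  assumes "Factorial_Ring.prime p" "\<not> p dvd m"
  shows "2 * floor_sum p m + (p - 1) = m * (p - 1)"
proof -
  have p0: "p > 0" using assms(1) prime_gt_0_nat by blast
  have "coprime m p" using assms prime_imp_coprime coprime_commute by blast
  have inj: "inj_on (\<lambda>i. i * m mod p) {..<p}"
  proof (rule inj_onI)
    fix i j assume *: "i \<in> {..<p}" "j \<in> {..<p}" "i * m mod p = j * m mod p"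
    then have "[i = j] (mod p)"
      using \<open>coprime m p\<close> cong_mult_rcancel_nat unfolding cong_def by blast
    then show "i = j" using * by (simp add: cong_def)
  qed
  have "(\<lambda>i. i * m mod p) ` {..<p} = {..<p}"
    using p0 by (intro endo_inj_surj inj) auto
  then have "(\<Sum>i<p. i * m mod p) = (\<Sum>i<p. i)"
    using sum.reindex[OF inj, of "\<lambda>i. i"] by simp
  moreover have "(\<Sum>i<p. i) * m = (\<Sum>i<p. p * (i * m div p)) + (\<Sum>i<p. i * m mod p)"
    unfolding sum_distrib_right sum.distrib[symmetric] by (intro sum.cong) auto
  ultimately have "(\<Sum>i<p. i) * m = p * floor_sum p m + (\<Sum>i<p. i)"
    unfolding floor_sum_def sum_distrib_left by (simp only:)
  then have "(2 * (\<Sum>i<p. i)) * m = 2 * p * floor_sum p m + 2 * (\<Sum>i<p. i)" by simp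
  then have "p * ((p - 1) * m) = p * (2 * floor_sum p m + (p - 1))"
    unfolding double_sum_lessThan by (simp add: algebra_simps)
  then show ?thesis using p0 by (simp add: mult.commute)
qed

section \<open>Two successive roots\<close>

text \<open>Meant for embeddings that are homomorphisms only on a subset of their type, such as that
  of the first normalization into the second fraction field.\<close>

definition inj_hom_on :: "'f::comm_ring_1 set \<Rightarrow> ('f \<Rightarrow> 'g::comm_ring_1) \<Rightarrow> bool"
  where "inj_hom_on D h \<longleftrightarrow> h 1 = 1 \<and> (\<forall>a\<in>D. \<forall>b\<in>D. h (a - b) = h a - h b \<and> h (a * b) = h a * h b) \<and>
    (\<forall>a\<in>D. h a = 0 \<longrightarrow> a = 0)"

lemma inj_hom_onD:
  assumes "inj_hom_on D h" "subring_set D"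
  shows inj_hom_on_1: "h 1 = 1" and inj_hom_on_0: "h 0 = 0"
    and inj_hom_on_diff: "\<And>a b. a \<in> D \<Longrightarrow> b \<in> D \<Longrightarrow> h (a - b) = h a - h b"
    and inj_hom_on_add: "\<And>a b. a \<in> D \<Longrightarrow> b \<in> D \<Longrightarrow> h (a + b) = h a + h b"
    and inj_hom_on_mult: "\<And>a b. a \<in> D \<Longrightarrow> b \<in> D \<Longrightarrow> h (a * b) = h a * h b"
    and inj_hom_on_power: "\<And>a n. a \<in> D \<Longrightarrow> h (a ^ n) = h a ^ n"
    and inj_hom_on_eq_iff: "\<And>a b. a \<in> D \<Longrightarrow> b \<in> D \<Longrightarrow> h a = h b \<longleftrightarrow> a = b"
    and inj_hom_on_eq_0_iff: "\<And>a. a \<in> D \<Longrightarrow> h a = 0 \<longleftrightarrow> a = 0"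
proof -
  show 1: "h 1 = 1" and d: "\<And>a b. a \<in> D \<Longrightarrow> b \<in> D \<Longrightarrow> h (a - b) = h a - h b"
    and m: "\<And>a b. a \<in> D \<Longrightarrow> b \<in> D \<Longrightarrow> h (a * b) = h a * h b"
    using assms(1) unfolding inj_hom_on_def by auto
  have i: "\<And>a. a \<in> D \<Longrightarrow> h a = 0 \<Longrightarrow> a = 0" using assms(1) unfolding inj_hom_on_def by auto
  note D1 = subring_set_1[OF assms(2)] and D0 = subring_set_0[OF assms(2)]
  show 0: "h 0 = 0" using d[OF D1 D1] by simp
  show "h (a + b) = h a + h b" if "a \<in> D" "b \<in> D" for a b
    using d[OF that(1) subring_set_uminus[OF assms(2) that(2)]] d[OF D0 that(2)] 0 by simp
  show "h (a ^ n) = h a ^ n" if "a \<in> D" for a n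
    by (induction n) (simp_all add: 1 m that subring_set_power[OF assms(2)])
  show "h a = h b \<longleftrightarrow> a = b" if "a \<in> D" "b \<in> D" for a b
    using i[OF subring_set_diff[OF assms(2) that]] d[OF that] by auto
  show "h a = 0 \<longleftrightarrow> a = 0" if "a \<in> D" for a
    using i[OF that] 0 by auto
qed

lemma subring_set_image:
  assumes h: "inj_hom_on D h" and D: "subring_set D"
  shows "subring_set (h ` D)"
  unfolding subring_set_def
proof (intro conjI ballI)
  show "1 \<in> h ` D" using inj_hom_on_1[OF h D] subring_set_1[OF D] by force
  fix a b assume "a \<in> h ` D" "b \<in> h ` D"
  then obtain a' b' where "a = h a'" "b = h b'" "a' \<in> D" "b' \<in> D" by blast
  then have "a - b = h (a' - b')" "a * b = h (a' * b')"
    using inj_hom_on_diff[OF h D] inj_hom_on_mult[OF h D] by simp_all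
  then show "a - b \<in> h ` D" "a * b \<in> h ` D"
    using subring_set_diff[OF D \<open>a' \<in> D\<close> \<open>b' \<in> D\<close>] subring_set_mult[OF D \<open>a' \<in> D\<close> \<open>b' \<in> D\<close>] by auto
qed

lemma inj_hom_on_subset: "inj_hom_on D h \<Longrightarrow> C \<subseteq> D \<Longrightarrow> inj_hom_on C h"
  unfolding inj_hom_on_def by blast

lemma inj_hom_on_inverse:
  fixes h :: "'f::field \<Rightarrow> 'g::field"
  assumes h: "inj_hom_on D h" and D: "subring_set D" and a: "a \<in> D" "inverse a \<in> D"
  shows "h (inverse a) = inverse (h a)"
proof (cases "a = 0")
  case True
  then show ?thesis using inj_hom_on_0[OF h D] by simp
next
  case False
  then have "h a * h (inverse a) = 1"
    using inj_hom_on_mult[OF h D a] inj_hom_on_1[OF h D] by simp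
  then show ?thesis by (rule inverse_unique[symmetric])
qed

context dvr_set
begin

text \<open>Only on \<open>A\<close> is \<open>h\<close> a homomorphism, so \<open>a / t ^ n\<close>
  need not have a meaningful image; the quotient is formed in the target.\<close>

lemma image_div_iff:
  fixes h :: "'f \<Rightarrow> 'g::field"
  assumes h: "inj_hom_on A h" and a: "a \<in> A"
  shows "h a / h t ^ n \<in> h ` A \<longleftrightarrow> a / t ^ n \<in> A"
proof -
  have tn: "h t ^ n = h (t ^ n)" "h t \<noteq> 0"
    using inj_hom_on_power[OF h A t(1)] inj_hom_on_eq_0_iff[OF h A t(1)] t(2) by simp_all
  show ?thesis
  proof
    assume "h a / h t ^ n \<in> h ` A"
    then obtain c where c: "c \<in> A" "h a / h t ^ n = h c" by blast
    have "h (t ^ n) \<noteq> 0" unfolding tn(1)[symmetric] using tn(2) by simp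
    then have "h a = h c * h (t ^ n)" unfolding c(2)[symmetric] tn(1) by simp
    then have "h a = h (c * t ^ n)" using inj_hom_on_mult[OF h A c(1) t_power_in] by simp
    then have "a = c * t ^ n" using inj_hom_on_eq_iff[OF h A a A_closed(4)[OF c(1) t_power_in]] by simp
    then show "a / t ^ n \<in> A" using c(1) t(2) by simp
  next
    assume *: "a / t ^ n \<in> A"
    have "h a = h (a / t ^ n * t ^ n)" using t(2) by simp
    also have "\<dots> = h (a / t ^ n) * h t ^ n" unfolding tn(1) by (rule inj_hom_on_mult[OF h A * t_power_in])
    finally have "h a / h t ^ n = h (a / t ^ n)" using tn(2) by simp
    then show "h a / h t ^ n \<in> h ` A" using * by simp
  qed
qed

lemma image_dvr_set:
  fixes h :: "'f \<Rightarrow> 'g::field"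
  assumes h: "inj_hom_on A h"
  shows "dvr_set (h ` A) (h t)"
proof
  show "subring_set (h ` A)" by (rule subring_set_image[OF h A])
  show "h t \<in> h ` A" using t(1) by blast
  show "h t \<noteq> 0" using inj_hom_on_eq_0_iff[OF h A t(1)] t(2) by simp
  show "inverse (h t) \<notin> h ` A"
    using image_div_iff[OF h A_closed(1), of 1] t(3) inj_hom_on_1[OF h A] by (simp add: inverse_eq_divide)
  fix z assume "z \<in> h ` A" "z \<noteq> 0"
  then obtain a where a: "a \<in> A" "z = h a" "a \<noteq> 0" using inj_hom_on_0[OF h A] by blast
  from dvr[OF a(1,3)] obtain n u where u: "u \<in> A" "inverse u \<in> A" "a = u * t ^ n" by blast
  have "z = h u * h t ^ n"
    unfolding a(2) u(3) using inj_hom_on_mult[OF h A u(1) t_power_in] inj_hom_on_power[OF h A t(1)] by simp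
  moreover have "inverse (h u) \<in> h ` A" using inj_hom_on_inverse[OF h A u(1,2)] u(2) by (metis imageI)
  ultimately show "\<exists>n u. u \<in> h ` A \<and> inverse u \<in> h ` A \<and> z = u * h t ^ n" using u(1) by blast
qed

end

section \<open>The second step compared with the first\<close>

context optimal_step
begin

text \<open>Joins the two cases. Here \<open>e\<close> is the valuation of \<open>s ^ p\<close> in
  \<open>A\<close>, so the ramification index is \<open>p / e\<close>, and \<open>e\<close> itself
  is the factor by which the residue field grows.\<close>

lemma uniformizer_exists:
  obtains s v e where "dvr_set B s" "unit_in v" "s ^ p = v * t ^ e"
    "e = 1 \<and> \<not> p dvd m \<or> e = p \<and> p dvd m \<and> s = t"
    "\<And>d. qdim k A (t_ideal 1) d \<Longrightarrow> \<exists>d1. qdim k1 B {z. z / s \<in> B} d1 \<and> p * d1 = e * d"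
proof (cases "p dvd m")
  case True
  show thesis
    by (rule that[of t 1 p]) (use unramified[OF True] True unit_in_1 in auto)
next
  case False
  from ramified[OF this] obtain s v where *: "dvr_set B s" "unit_in v" "s ^ p = v * t"
    "\<And>d. qdim k A (t_ideal 1) d \<Longrightarrow> \<exists>d1. qdim k1 B {z. z / s \<in> B} d1 \<and> p * d1 = d" by metis
  show thesis
    by (rule that[of s v 1]) (use * False in auto)
qed

lemma y_in_B: "y \<in> B"
  using yp_in unfolding B_def by simp

context
  fixes h :: "'f \<Rightarrow> 'g::field" and s v :: 'f and e :: nat and y2 :: 'g
  assumes s: "dvr_set B s" and v: "unit_in v" and sv: "s ^ p = v * t ^ e"
    and h: "inj_hom_on B h" and y2: "y2 ^ p = h y"
begin

interpretation B: dvr_set B s by (rule s)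

text \<open>An approximation of \<open>y2 ^ p = h y\<close> pulls back along \<open>h\<close> to an
  approximation of \<open>y\<close> by some \<open>b' ^ p\<close>, to which
  \<open>approximation_bound\<close> applies.\<close>

lemma second_approximation_bound:
  assumes c: "c \<in> h ` B" and n: "(y2 ^ p - c ^ p) / h s ^ n \<in> h ` B"
  shows "e * n \<le> m"
proof -
  obtain b' where b': "b' \<in> B" "c = h b'" using c by blast
  have bp: "b' ^ p \<in> B" using b'(1) by (rule subring_set_power[OF B_subring])
  have "y2 ^ p - c ^ p = h (y - b' ^ p)"
    unfolding y2 b'(2) using inj_hom_on_diff[OF h B_subring y_in_B bp] inj_hom_on_power[OF h B_subring b'(1)]
    by simp
  then have "(y - b' ^ p) / s ^ n \<in> B"
    using n B.image_div_iff[OF h subring_set_diff[OF B_subring y_in_B bp]] by simp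
  then show ?thesis by (rule approximation_bound[OF sv v b'(1)])
qed

text \<open>The bound of the second step is inherited from the maximal exponent \<open>m\<close> of
  the first.\<close>

lemma second_step_bounded:
  assumes "e > 0"
  shows "\<exists>N. \<forall>c\<in>h ` B. (y2 ^ p - c ^ p) / h s ^ N \<notin> h ` B"
proof (intro exI ballI notI)
  fix c assume "c \<in> h ` B" "(y2 ^ p - c ^ p) / h s ^ Suc m \<in> h ` B"
  then have "e * Suc m \<le> m" by (rule second_approximation_bound)
  moreover have "Suc m \<le> e * Suc m" using assms by (cases e) auto
  ultimately show False by linarith
qed

context
  fixes m2 :: nat and a2 u2 :: 'g
  assumes S2: "optimal_step (h ` B) (h s) (h ` k1) y2 p m2 a2 u2"
begin

interpretation S2: optimal_step "h ` B" "h s" "h ` k1" y2 p m2 a2 u2 by (rule S2)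

lemma second_bound: "e * m2 \<le> m"
proof -
  have "h s \<noteq> 0" by (rule S2.t(2))
  then have "(y2 ^ p - a2 ^ p) / h s ^ m2 = u2" unfolding S2.ya by simp
  also have "u2 \<in> h ` B" using S2.u unfolding S2.unit_in_def by simp
  finally show ?thesis using second_approximation_bound[OF S2.a] by blast
qed

lemma second_approximation:
  obtains b' c where "b' \<in> B" "B.unit_in c" "a2 = h b'" "u2 = h c" "y - b' ^ p = c * s ^ m2"
proof -
  obtain b' where b': "b' \<in> B" "a2 = h b'" using S2.a by blast
  obtain c where c: "c \<in> B" "u2 = h c" using S2.u unfolding S2.unit_in_def by blast
  have bp: "b' ^ p \<in> B" using b'(1) by (rule subring_set_power[OF B_subring])
  have "h (y - b' ^ p) = y2 ^ p - a2 ^ p"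
    unfolding y2 b'(2) using inj_hom_on_diff[OF h B_subring y_in_B bp] inj_hom_on_power[OF h B_subring b'(1)]
    by simp
  also have "\<dots> = h (c * s ^ m2)"
    unfolding S2.ya c(2)
    using inj_hom_on_mult[OF h B_subring c(1) B.t_power_in] inj_hom_on_power[OF h B_subring B.t(1)] by simp
  finally have "y - b' ^ p = c * s ^ m2"
    using inj_hom_on_eq_iff[OF h B_subring subring_set_diff[OF B_subring y_in_B bp]
        subring_set_mult[OF B_subring c(1) B.t_power_in]] by simp
  moreover have "B.unit_in c"
  proof -
    have "h c / h s ^ 1 \<notin> h ` B" using S2.unit_not_div_t[OF S2.u] c(2) by simp
    then have "c / s ^ 1 \<notin> B" using B.image_div_iff[OF h c(1), of 1] by blast
    then show ?thesis using B.unit_iff_not_div_t[OF c(1)] by simp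
  qed
  ultimately show thesis using that b' c by blast
qed

lemma both_ramified:
  assumes e: "e = 1" and "\<not> p dvd m2"
  shows "m2 = m"
proof (rule ccontr)
  assume "m2 \<noteq> m"
  then have m2: "m2 < m" using second_bound e by simp
  obtain b' c where *: "b' \<in> B" "B.unit_in c" "y - b' ^ p = c * s ^ m2" by (rule second_approximation) blast
  have bp: "b' ^ p \<in> A" using *(1) unfolding B_def by simp
  have "c \<in> B" "inverse c \<in> B" "c \<noteq> 0" using *(2) unfolding B.unit_in_def by auto
  then have cp: "unit_in (c ^ p)" unfolding unit_in_def B_def by (auto simp: power_inverse)
  \<comment> \<open>The cofactor of \<open>t ^ m2\<close> in \<open>(a - b' ^ p) ^ p\<close>: a unit
    minus a multiple of \<open>t\<close>, since \<open>m2 < m\<close>.\<close>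
  define w where "w = c ^ p * v ^ m2 - u * t ^ (m - m2)"
  have "y ^ p - (b' ^ p) ^ p = (c * s ^ m2) ^ p" unfolding *(3)[symmetric] by (rule power_p_diff[symmetric])
  also have "\<dots> = c ^ p * (s ^ p) ^ m2" by (simp add: power_mult_distrib power_mult[symmetric] mult.commute)
  also have "\<dots> = c ^ p * v ^ m2 * t ^ m2" unfolding sv e by (simp add: power_mult_distrib)
  finally have "(a - b' ^ p) ^ p = c ^ p * v ^ m2 * t ^ m2 - u * t ^ m"
    unfolding power_p_diff using ya by (simp add: algebra_simps)
  also have "u * t ^ m = u * t ^ (m - m2) * t ^ m2" using m2 by (simp add: power_add[symmetric] mult.assoc)
  finally have abp: "(a - b' ^ p) ^ p = w * t ^ m2" unfolding w_def by (simp add: left_diff_distrib)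
  have cv: "unit_in (c ^ p * v ^ m2)" by (intro unit_in_mult cp unit_in_power v)
  have "u * t ^ (m - m2) / t \<in> A" using unit_power_div_iff[OF u, of "m - m2" 1] m2 by simp
  then have "w / t \<notin> A"
    using unit_not_div_t[OF cv] A_closed(6)[of "w / t" "u * t ^ (m - m2) / t"]
    unfolding w_def diff_divide_distrib by auto
  moreover have "w \<in> A"
    unfolding w_def using cv u t_power_in unfolding unit_in_def
    by (intro A_closed(3)[OF _ A_closed(4)]) auto
  ultimately have w: "unit_in w" using unit_iff_not_div_t by blast
  have "a - b' ^ p \<noteq> 0"
  proof
    assume "a - b' ^ p = 0"
    then show False using abp w t(2) unfolding unit_in_def by (simp add: zero_power[OF p_pos])
  qed
  from unit_decomposition[OF A_closed(3)[OF a bp] this] obtain j x where x: "unit_in x" "a - b' ^ p = x * t ^ j" .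
  have "w * t ^ m2 = x ^ p * t ^ (p * j)"
    unfolding abp[symmetric] x(2) by (simp add: power_mult_distrib power_mult[symmetric] mult.commute)
  then have "m2 = p * j" by (rule unit_power_unique[OF w unit_in_power[OF x(1)]])
  then show False using assms(2) by simp
qed

text \<open>The strict inequality makes \<open>(y - a) / t ^ m2\<close> divisible by
  \<open>t\<close> in \<open>B\<close>, so in \<open>c = (y - b' ^ p) / t ^ m2\<close> the element
  \<open>a\<close> may replace \<open>y\<close> without a change modulo \<open>t\<close>. Hence the
  residue class of \<open>u2\<close> comes from \<open>A\<close>, as
  \<open>residue_field_not_simple\<close> demands. The image of \<open>b 1\<close> serves as
  \<open>z\<close>, its class being outside the residue field of \<open>A\<close>.\<close>

lemma second_residue_field_not_simple:
  assumes st: "s = t" "e = p" "p dvd m" "p dvd m2" "p * m2 < m" and \<alpha>: "\<alpha> ^ p \<in> h ` B"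
  shows "\<exists>w. w ^ p \<in> h ` B \<and> (\<forall>f. coeffs_in (h ` A) f \<longrightarrow> ((w - poly f \<alpha>) / h t) ^ p \<notin> h ` B)"
proof -
  obtain b' c where *: "b' \<in> B" "B.unit_in c" "u2 = h c" "y - b' ^ p = c * s ^ m2"
    by (rule second_approximation) blast
  have bp: "b' ^ p \<in> A" using *(1) unfolding B_def by simp
  have cB: "c \<in> B" using *(2) unfolding B.unit_in_def by simp
  \<comment> \<open>The 1 accounts for the factor \<open>t\<close> in the error
    \<open>(y - a) / t ^ m2\<close>; \<open>p dvd m\<close> and \<open>p * m2 < m\<close> keep the
    subtraction from being truncated.\<close>
  define n where "n = m div p - m2 - 1"
  have n: "m div p = m2 + Suc n" unfolding n_def using st(3,5) p_pos by (auto elim!: dvdE)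
  define x where "x = (a - b' ^ p) / t ^ m2"
  have nb: "t ^ n * b 1 \<in> B"
    using A_subset_B t_power_in b_in_B by (intro subring_set_mult[OF B_subring]) auto
  have "y - a = t ^ (m div p) * b 1" unfolding b_def using t(2) by simp
  then have "(y - a) / t ^ m2 = t * (t ^ n * b 1)" unfolding n using t(2) by (simp add: power_add)
  moreover have "(y - b' ^ p) / t ^ m2 = c" using *(4) st(1) t(2) by simp
  moreover have "x = (y - b' ^ p) / t ^ m2 - (y - a) / t ^ m2"
    unfolding x_def by (simp add: diff_divide_distrib)
  ultimately have x: "x = c - t * (t ^ n * b 1)" by simp
  have tB: "t \<in> B" using t(1) A_subset_B by blast
  have tnb: "t * (t ^ n * b 1) \<in> B" by (rule subring_set_mult[OF B_subring tB nb])
  have "x \<in> B" unfolding x by (rule subring_set_diff[OF B_subring cB tnb])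
  then have xA: "x \<in> A" using div_t_in_B[OF A_closed(3)[OF a bp]] unfolding x_def by blast
  have hx: "h x = h c - h t * h (t ^ n * b 1)"
    unfolding x inj_hom_on_diff[OF h B_subring cB tnb] inj_hom_on_mult[OF h B_subring tB nb] ..
  have hA: "subring_set (h ` A)" by (rule subring_set_image[OF inj_hom_on_subset[OF h A_subset_B] A])
  have "\<exists>w\<in>S2.B. \<forall>f. coeffs_in (h ` A) f \<longrightarrow> (w - poly f \<alpha>) / h s \<notin> S2.B"
  proof (rule S2.residue_field_not_simple[OF st(4) hA])
    show "h ` A \<subseteq> h ` B" using A_subset_B by blast
    show "d ^ p \<in> h ` A" if "d \<in> h ` B" for d
      using that inj_hom_on_power[OF h B_subring, symmetric] unfolding B_def by auto
    show "h x \<in> h ` A" using xA by blast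
    have "h t \<noteq> 0" using S2.t(2) st(1) by simp
    then have "(u2 - h x) / h s = h (t ^ n * b 1)" unfolding *(3) hx st(1) by simp
    then show "(u2 - h x) / h s \<in> h ` B" using nb by simp
    show "h (b 1) \<in> h ` B" using b_in_B by blast
    show "\<alpha> \<in> S2.B" using \<alpha> unfolding S2.B_def by simp
    fix r assume "r \<in> h ` A"
    then obtain r0 where r0: "r0 \<in> A" "r = h r0" by blast
    have r0B: "r0 \<in> B" using r0(1) A_subset_B by blast
    show "(h (b 1) - r) / h s \<notin> h ` B"
    proof
      assume "(h (b 1) - r) / h s \<in> h ` B"
      then have "h (b 1 - r0) / h s ^ 1 \<in> h ` B"
        unfolding r0(2) inj_hom_on_diff[OF h B_subring b_in_B r0B] by simp
      then have "(b 1 - r0) / s ^ 1 \<in> B"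
        using B.image_div_iff[OF h subring_set_diff[OF B_subring b_in_B r0B]] by blast
      then have "(u - r0 ^ p) / t ^ p \<in> A"
        unfolding B_def st(1)
        by (simp add: power_divide power_p_diff p_dvd_b1_power[OF st(3)] del: One_nat_def)
      then have "(u - r0 ^ p) / t ^ 1 \<in> A" by (rule div_t_mono) (use p_pos in simp)
      then show False using p_dvd_not_power[OF st(3) r0(1)] by simp
    qed
  qed
  then show ?thesis unfolding S2.B_def st(1) by blast
qed

lemma second_residue_degree:
  assumes "qdim k1 B {z. z / s \<in> B} d1"
  shows "qdim (h ` k1) (h ` B) (S2.t_ideal 1) d1"
proof -
  have k1B: "k1 \<subseteq> B" using k1_subset_T T_subset_B by blast
  have "qdim (h ` k1) (h ` B) (h ` {z. z / s \<in> B}) d1"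
  proof (rule qdim_image[OF assms k1_subring subspace_k1_multiples])
    fix x assume "x \<in> B" "h x = 0"
    then have "x = 0" using inj_hom_on_eq_0_iff[OF h B_subring] by blast
    then show "x \<in> {z. z / s \<in> B}" using subring_set_0[OF B_subring] by simp
  qed (use k1B inj_hom_on_add[OF h B_subring] inj_hom_on_mult[OF h B_subring] in auto)
  moreover have "h ` {z. z / s \<in> B} = S2.t_ideal 1"
  proof -
    have sub: "{z. z / s \<in> B} \<subseteq> B" using B.t_ideal_subset[of 1] unfolding B.t_ideal_def by simp
    have sub2: "S2.t_ideal 1 \<subseteq> h ` B" by (rule S2.t_ideal_subset)
    have "h z \<in> S2.t_ideal 1 \<longleftrightarrow> z / s \<in> B" if "z \<in> B" for z
      using B.image_div_iff[OF h that, of 1] unfolding S2.t_ideal_def by simp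
    then show ?thesis using sub sub2 by blast
  qed
  ultimately show ?thesis by simp
qed

lemma second_dimension:
  assumes d: "qdim k1 B {z. z / s \<in> B} d1"
  shows "\<exists>g. qdim (powers_span (h ` k1) y2 p) {z. z ^ p \<in> h ` B} (powers_span (h ` B) y2 p) g \<and>
    p * g = d1 * floor_sum p m2"
  using S2.dim_B_mod_T[OF second_residue_degree[OF d]]
  unfolding S2.k1_def S2.B_def S2.T_def floor_sum_def .

end

end

lemma two_step_comparison:
  fixes h :: "'f \<Rightarrow> 'g::field"
  assumes s: "dvr_set B s" "unit_in v" "s ^ p = v * t ^ e"
    and e: "e = 1 \<and> \<not> p dvd m \<or> e = p \<and> p dvd m \<and> s = t"
    and d: "qdim k A (t_ideal 1) d"
    and d1: "qdim k1 B {z. z / s \<in> B} d1" "p * d1 = e * d"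
    and h: "inj_hom_on B h" and y2: "y2 ^ p = h y"
    and S2: "optimal_step (h ` B) (h s) (h ` k1) y2 p m2 a2 u2"
  shows "\<exists>g10 g21. qdim k1 B T g10 \<and>
    qdim (powers_span (h ` k1) y2 p) {z. z ^ p \<in> h ` B} (powers_span (h ` B) y2 p) g21 \<and>
    (\<not> p dvd m \<and> \<not> p dvd m2 \<longrightarrow> p * g21 = g10) \<and>
    (\<not> p dvd m \<and> p dvd m2 \<longrightarrow> p * g21 \<le> g10) \<and>
    (p dvd m \<and> p dvd m2 \<longrightarrow> p * g21 \<le> g10 \<and>
      ((\<exists>\<alpha>. \<alpha> ^ p \<in> h ` B \<and>
        (\<forall>w. w ^ p \<in> h ` B \<longrightarrow> (\<exists>f. coeffs_in (h ` A) f \<and> ((w - poly f \<alpha>) / h t) ^ p \<in> h ` B)))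
        \<longrightarrow> p * g21 = g10)) \<and>
    (p dvd m \<and> \<not> p dvd m2 \<longrightarrow> p * g21 + p * (p - 1) div 2 \<le> g10)"
proof -
  obtain g10 where g10: "qdim k1 B T g10" "p * g10 = d * floor_sum p m"
    using dim_B_mod_T[OF d] unfolding floor_sum_def by blast
  obtain g21 where g21: "qdim (powers_span (h ` k1) y2 p) {z. z ^ p \<in> h ` B} (powers_span (h ` B) y2 p) g21"
    "p * g21 = d1 * floor_sum p m2"
    using second_dimension[OF s h y2 S2 d1(1)] by blast
  have em2: "e * m2 \<le> m" by (rule second_bound[OF s h y2 S2])
  have pg21: "p * (p * g21) = e * d * floor_sum p m2"
    unfolding g21(2) mult.assoc[symmetric] d1(2) ..
  have ram: "p * g21 \<le> g10" if "\<not> p dvd m"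
  proof -
    have "e = 1" using e that by blast
    then have "p * (p * g21) \<le> p * g10"
      unfolding pg21 g10(2) using em2 floor_sum_mono[of m2 m p] by simp
    then show ?thesis using p_pos by simp
  qed
  have ram2: "p * g21 = g10" if "\<not> p dvd m" "\<not> p dvd m2"
  proof -
    have "e = 1" using e that by blast
    then have "m2 = m" using both_ramified[OF s h y2 S2 _ that(2)] by simp
    then have "p * (p * g21) = p * g10" unfolding pg21 g10(2) \<open>e = 1\<close> by simp
    then show ?thesis using p_pos by simp
  qed
  have unram: "p * m2 \<le> m" "d1 = d" if "p dvd m" using e that em2 d1(2) p_pos by auto
  have unram_S: "2 * (p * floor_sum p m2) = p * m2 * (p - 1)" if "p dvd m2"
    using floor_sum_dvd[OF that p_pos] by (simp add: mult.assoc mult.left_commute)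
  have unram1: "p * g21 \<le> g10" if "p dvd m" "p dvd m2"
  proof -
    have "2 * (p * floor_sum p m2) \<le> 2 * floor_sum p m"
      unfolding unram_S[OF that(2)] floor_sum_dvd[OF that(1) p_pos] using unram(1)[OF that(1)] by simp
    then have "d * (p * floor_sum p m2) \<le> d * floor_sum p m" by simp
    then have "p * (p * g21) \<le> p * g10" unfolding g10(2) g21(2) unram(2)[OF that(1)] by (simp add: mult_ac)
    then show ?thesis using p_pos by simp
  qed
  have unram2: "p * g21 = g10" if "p dvd m" "p dvd m2"
    and \<alpha>: "\<alpha> ^ p \<in> h ` B"
      "\<And>w. w ^ p \<in> h ` B \<Longrightarrow> \<exists>f. coeffs_in (h ` A) f \<and> ((w - poly f \<alpha>) / h t) ^ p \<in> h ` B" for \<alpha>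
  proof -
    have "s = t" "e = p" using e that(1) by auto
    then have "\<not> p * m2 < m"
      using second_residue_field_not_simple[OF s h y2 S2 _ _ that(1,2) _ \<alpha>(1)] \<alpha>(2) by blast
    then have "p * m2 = m" using unram(1)[OF that(1)] by simp
    then have "2 * (p * floor_sum p m2) = 2 * floor_sum p m"
      unfolding unram_S[OF that(2)] floor_sum_dvd[OF that(1) p_pos] by simp
    then have "d * (p * floor_sum p m2) = d * floor_sum p m" by simp
    then have "p * (p * g21) = p * g10" unfolding g10(2) g21(2) unram(2)[OF that(1)] by (simp add: mult_ac)
    then show ?thesis using p_pos by simp
  qed
  have unram3: "p * g21 + p * (p - 1) div 2 \<le> g10" if "p dvd m" "\<not> p dvd m2"
  proof -
    have "m2 > 0" using that(2) by (cases m2) auto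
    then have "m > 0" using unram(1)[OF that(1)] p_pos by (metis gr0I le_zero_eq mult_is_0 not_less_zero)
    have "p dvd d" by (rule p_dvd_residue_degree[OF that(1) \<open>m > 0\<close> d])
    \<comment> \<open>Without this, \<open>p dvd d\<close> would not bound \<open>d\<close> from
      below.\<close>
    moreover have "d > 0"
    proof (rule ccontr)
      assume "\<not> d > 0"
      then have "A = t_ideal 1" using d qdim_0D by simp
      then show False using prime_ideal_t A_closed(1) unfolding prime_ideal_in_def by blast
    qed
    ultimately have dp: "p \<le> d" by (rule dvd_imp_le)
    \<comment> \<open>The summand \<open>d * (p - 1)\<close> is \<open>d\<close> times the defect in
      \<open>floor_sum_not_dvd\<close>. With \<open>p \<le> d\<close> it becomes the additional term
      of the claim.\<close>
    have "2 * (p * g21) + d * (p - 1) = d * (2 * floor_sum p m2 + (p - 1))"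
      unfolding g21(2) unram(2)[OF that(1)] by (simp add: algebra_simps)
    also have "\<dots> = d * (m2 * (p - 1))" unfolding floor_sum_not_dvd[OF p(1) that(2)] ..
    finally have 1: "2 * (p * g21) + d * (p - 1) = d * (m2 * (p - 1))" .
    have "p * (d * (m2 * (p - 1))) = d * ((p * m2) * (p - 1))" by (simp add: mult_ac)
    also have "\<dots> \<le> d * (m * (p - 1))" using unram(1)[OF that(1)] by simp
    also have "\<dots> = 2 * (p * g10)" unfolding g10(2) floor_sum_dvd[OF that(1) p_pos, symmetric] by (simp add: mult_ac)
    finally have "p * (d * (m2 * (p - 1))) \<le> p * (2 * g10)" by (simp add: mult_ac)
    then have "2 * (p * g21) + d * (p - 1) \<le> 2 * g10" unfolding 1 using p_pos by simp
    moreover have "p * (p - 1) \<le> d * (p - 1)" using dp by simp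
    ultimately have "2 * (p * g21) + p * (p - 1) \<le> 2 * g10" by linarith
    then show ?thesis by linarith
  qed
  show ?thesis
    using g10(1) g21(1) ram ram2 unram1 unram2 unram3 by (intro exI[of _ g10] exI[of _ g21]) blast
qed

end

section \<open>Subrings of a type as ring records\<close>

lemma ring_of_type_algebra_simps [simp]:
  "carrier ring_of_type_algebra = UNIV" "x \<otimes>\<^bsub>ring_of_type_algebra\<^esub> y = x * y"
  "x \<oplus>\<^bsub>ring_of_type_algebra\<^esub> y = x + y"
  "\<one>\<^bsub>ring_of_type_algebra\<^esub> = 1" "\<zero>\<^bsub>ring_of_type_algebra\<^esub> = 0"
  by (simp_all add: ring_of_type_algebra_def)

lemma ring_on_simps [simp]:
  "carrier (ring_on A) = A" "x \<otimes>\<^bsub>ring_on A\<^esub> y = x * y" "x \<oplus>\<^bsub>ring_on A\<^esub> y = x + y"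
  "\<one>\<^bsub>ring_on A\<^esub> = 1" "\<zero>\<^bsub>ring_on A\<^esub> = 0"
  by (simp_all add: ring_of_type_algebra_def)

lemma ring_on_UNIV: "ring_on (UNIV :: 'a::comm_ring_1 set) = ring_of_type_algebra"
  by (simp add: ring_of_type_algebra_def)

lemma cring_ring_on:
  assumes A: "subring_set A"
  shows "cring (ring_on A)"
proof (rule cringI)
  show "abelian_group (ring_on A)"
    by (rule abelian_groupI)
       (use subring_set_0[OF A] subring_set_add[OF A] subring_set_uminus[OF A] in
         \<open>auto simp: add.assoc add.commute intro: bexI[of _ "- x" for x]\<close>)
  show "comm_monoid (ring_on A)"
    by (rule comm_monoidI)
       (use subring_set_1[OF A] subring_set_mult[OF A] in \<open>auto simp: mult.assoc mult.commute\<close>)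
qed (simp add: distrib_right)

lemma a_inv_ring_on:
  assumes A: "subring_set A" and x: "x \<in> A"
  shows "\<ominus>\<^bsub>ring_on A\<^esub> x = - x"
proof -
  interpret cring "ring_on A" by (rule cring_ring_on[OF A])
  show ?thesis using minus_equality[of "- x" x] x subring_set_uminus[OF A x] by simp
qed

lemma finsum_ring_on:
  assumes A: "subring_set A" and f: "\<And>s. s \<in> S \<Longrightarrow> f s \<in> A"
  shows "finsum (ring_on A) f S = sum f S"
proof (cases "finite S")
  case True
  interpret cring "ring_on A" by (rule cring_ring_on[OF A])
  from True f show ?thesis
    by (induction S) (auto simp: finsum_insert Pi_def)
next
  case False
  then show ?thesis by (simp add: finsum_def finprod_def)
qed

lemma power_ring_on: "x [^]\<^bsub>ring_on A\<^esub> (n::nat) = x ^ n"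
  by (induction n) (simp_all add: mult.commute nat_pow_def)

lemma add_pow_ring_on:
  assumes A: "subring_set A" and x: "x \<in> A"
  shows "add_pow (ring_on A) (n::int) x = of_int n * x"
proof -
  have nat: "add_pow (ring_on A) (n::nat) x = of_nat n * x" for n
    by (induction n) (simp_all add: add_pow_def nat_pow_def algebra_simps)
  have mem: "of_nat n * x \<in> A" for n
    by (intro subring_set_mult[OF A] subring_set_of_nat[OF A] x)
  show ?thesis
  proof (cases "n \<ge> 0")
    case True
    then show ?thesis by (simp add: add_pow_int_ge nat)
  next
    case False
    then have "of_nat (nat (- n)) * x = - (of_int n * x)" by simp
    moreover have "add_pow (ring_on A) n x = - (of_nat (nat (- n)) * x)"
      using False a_inv_ring_on[OF A mem, of "nat (- n)"] by (simp only: add_pow_int_lt nat not_le)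
    ultimately show ?thesis by simp
  qed
qed

lemma finsum_ring_of_type_algebra:
  "finsum ring_of_type_algebra f S = (sum f S :: 'a::comm_ring_1)"
  using finsum_ring_on[of UNIV S f] unfolding ring_on_UNIV subring_set_def by simp

lemma add_pow_ring_of_type_algebra:
  "add_pow ring_of_type_algebra (n::int) x = (of_int n * x :: 'a::comm_ring_1)"
  using add_pow_ring_on[of UNIV x n] unfolding ring_on_UNIV subring_set_def by simp

section \<open>Tensor products\<close>

text \<open>Of \<open>i\<close> and \<open>j\<close> only closure is assumed, so the computations
  apply to the tensor product itself as well as to coordinate functionals with values in
  \<open>R\<close>, which are not ring homomorphisms.\<close>

locale tensor_evaluation = cring T for T :: "'t ring" (structure) +
  fixes i :: "'a \<Rightarrow> 't" and j :: "'b \<Rightarrow> 't" and CA :: "'a set" and CB :: "'b set"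
  assumes ij: "i \<in> CA \<rightarrow> carrier T" "j \<in> CB \<rightarrow> carrier T"
begin

definition F :: "(('a \<times> 'b) \<Rightarrow>\<^sub>0 int) set" where "F = {u. Poly_Mapping.keys u \<subseteq> CA \<times> CB}"

lemma tensor_eval_on:
  assumes "finite S" "Poly_Mapping.keys u \<subseteq> S" "S \<subseteq> CA \<times> CB"
  shows "tensor_eval T i j u = (\<Oplus>q\<in>S. add_pow T (Poly_Mapping.lookup u q) (i (fst q) \<otimes> j (snd q)))"
  unfolding tensor_eval_def
proof (rule add.finprod_mono_neutral_cong_left[OF assms(1,2)])
  show "add_pow T (Poly_Mapping.lookup u q) (i (fst q) \<otimes> j (snd q)) = \<zero>" if "q \<in> S - Poly_Mapping.keys u" for q
    using that by (auto simp: in_keys_iff add_pow_int_ge)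
  show "(\<lambda>q. add_pow T (Poly_Mapping.lookup u q) (i (fst q) \<otimes> j (snd q))) \<in> S \<rightarrow> carrier T"
    using assms(3) ij by (auto intro!: add.int_pow_closed m_closed)
qed simp

lemma tensor_eval_closed: "u \<in> F \<Longrightarrow> tensor_eval T i j u \<in> carrier T"
  unfolding tensor_eval_def F_def using ij
  by (intro finsum_closed) (auto intro!: add.int_pow_closed m_closed)

lemma tensor_eval_diff:
  assumes "u \<in> F" "v \<in> F"
  shows "u - v \<in> F" "tensor_eval T i j (u - v) = tensor_eval T i j u \<ominus> tensor_eval T i j v"
proof -
  let ?S = "Poly_Mapping.keys u \<union> Poly_Mapping.keys v"
  let ?w = "\<lambda>q. i (fst q) \<otimes> j (snd q)"
  have S: "finite ?S" "?S \<subseteq> CA \<times> CB" using assms unfolding F_def by auto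
  have k: "Poly_Mapping.keys (u - v) \<subseteq> ?S"
    by (auto simp: in_keys_iff lookup_minus)
  then show "u - v \<in> F" using S(2) unfolding F_def by auto
  have w: "?w q \<in> carrier T" if "q \<in> ?S" for q
    using that S(2) ij by (intro m_closed) (auto simp: Pi_def mem_Times_iff)
  have pw: "add_pow T n (?w q) \<in> carrier T" if "q \<in> ?S" for n :: int and q
    using w[OF that] by (rule add.int_pow_closed)
  have "tensor_eval T i j u = tensor_eval T i j (u - v) \<oplus> tensor_eval T i j v"
  proof -
    have "tensor_eval T i j (u - v) \<oplus> tensor_eval T i j v =
      (\<Oplus>q\<in>?S. add_pow T (Poly_Mapping.lookup (u - v) q) (?w q)) \<oplus> (\<Oplus>q\<in>?S. add_pow T (Poly_Mapping.lookup v q) (?w q))"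
      using tensor_eval_on[OF S(1) k S(2)] tensor_eval_on[OF S(1) _ S(2), of v] by simp
    also have "\<dots> = (\<Oplus>q\<in>?S. add_pow T (Poly_Mapping.lookup (u - v) q) (?w q) \<oplus> add_pow T (Poly_Mapping.lookup v q) (?w q))"
      by (rule finsum_addf[symmetric]) (use pw in blast)+
    also have "\<dots> = (\<Oplus>q\<in>?S. add_pow T (Poly_Mapping.lookup u q) (?w q))"
    proof (rule finsum_cong')
      fix q assume q: "q \<in> ?S"
      have "Poly_Mapping.lookup u q = Poly_Mapping.lookup (u - v) q + Poly_Mapping.lookup v q"
        by (simp add: lookup_minus)
      then show "add_pow T (Poly_Mapping.lookup (u - v) q) (?w q) \<oplus> add_pow T (Poly_Mapping.lookup v q) (?w q) =
          add_pow T (Poly_Mapping.lookup u q) (?w q)"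
        using add.int_pow_mult[OF w[OF q]] by simp
    qed (use pw in auto)
    also have "\<dots> = tensor_eval T i j u" using tensor_eval_on[OF S(1) _ S(2), of u] by simp
    finally show ?thesis by simp
  qed
  then show "tensor_eval T i j (u - v) = tensor_eval T i j u \<ominus> tensor_eval T i j v"
    using tensor_eval_closed[OF \<open>u - v \<in> F\<close>] tensor_eval_closed[OF assms(2)]
    by (simp add: a_minus_def a_assoc r_neg)
qed

lemma zero_in_F: "0 \<in> F"
  unfolding F_def by simp

lemma tensor_eval_0: "tensor_eval T i j 0 = \<zero>"
  unfolding tensor_eval_def by simp

lemma tensor_eval_add:
  assumes "u \<in> F" "v \<in> F"
  shows "u + v \<in> F" "tensor_eval T i j (u + v) = tensor_eval T i j u \<oplus> tensor_eval T i j v"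
proof -
  note v' = tensor_eval_diff[OF zero_in_F assms(2)]
  have eq: "u + v = u - (0 - v)" by simp
  show "u + v \<in> F" unfolding eq by (rule tensor_eval_diff(1)[OF assms(1) v'(1)])
  show "tensor_eval T i j (u + v) = tensor_eval T i j u \<oplus> tensor_eval T i j v"
    unfolding eq tensor_eval_diff(2)[OF assms(1) v'(1)] v'(2)
    using tensor_eval_closed[OF assms(1)] tensor_eval_closed[OF assms(2)]
    by (simp add: tensor_eval_0 a_minus_def minus_add)
qed

lemma tensor_eval_single:
  assumes "a \<in> CA" "b \<in> CB"
  shows "Poly_Mapping.single (a, b) 1 \<in> F" "tensor_eval T i j (Poly_Mapping.single (a, b) 1) = i a \<otimes> j b"
proof -
  have "i a \<otimes> j b \<in> carrier T" using assms ij by (intro m_closed) auto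
  then show "tensor_eval T i j (Poly_Mapping.single (a, b) 1) = i a \<otimes> j b"
    unfolding tensor_eval_def by (simp add: add.int_pow_1)
qed (use assms in \<open>simp add: F_def\<close>)

lemma tensor_eval_sum_singles:
  assumes "finite S" "\<And>l. l \<in> S \<Longrightarrow> c l \<in> CA" "\<And>l. l \<in> S \<Longrightarrow> d l \<in> CB"
  shows "(\<Sum>l\<in>S. Poly_Mapping.single (c l, d l) 1) \<in> F \<and>
    tensor_eval T i j (\<Sum>l\<in>S. Poly_Mapping.single (c l, d l) 1) = (\<Oplus>l\<in>S. i (c l) \<otimes> j (d l))"
  using assms
proof (induction S)
  case empty
  then show ?case by (simp add: zero_in_F tensor_eval_0)
next
  case (insert l S)
  have 1: "c l \<in> CA" "d l \<in> CB" using insert.prems by auto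

  have IH: "(\<Sum>l\<in>S. Poly_Mapping.single (c l, d l) 1) \<in> F"
    "tensor_eval T i j (\<Sum>l\<in>S. Poly_Mapping.single (c l, d l) 1) = (\<Oplus>l\<in>S. i (c l) \<otimes> j (d l))"
    using insert by auto
  have "(\<Oplus>l\<in>insert l S. i (c l) \<otimes> j (d l)) = i (c l) \<otimes> j (d l) \<oplus> (\<Oplus>l\<in>S. i (c l) \<otimes> j (d l))"
    using insert.hyps insert.prems ij by (intro finsum_insert) (auto intro!: m_closed)
  then show ?case
    using tensor_eval_add[OF tensor_eval_single(1)[OF 1] IH(1)] tensor_eval_single(2)[OF 1] IH(2) insert.hyps
    by simp
qed

text \<open>The universal property in the form needed: a pair of additive maps that is balanced over
  \<open>K\<close> annihilates all tensor relations.\<close>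

lemma tensor_relations_eval:
  assumes u: "u \<in> tensor_relations K f A g B" and CAB: "CA = carrier A" "CB = carrier B"
    and A: "cring A" and B: "cring B" and f: "f \<in> carrier K \<rightarrow> carrier A" and g: "g \<in> carrier K \<rightarrow> carrier B"
    and i: "\<And>a a'. a \<in> carrier A \<Longrightarrow> a' \<in> carrier A \<Longrightarrow> i (a \<oplus>\<^bsub>A\<^esub> a') = i a \<oplus> i a'"
    and j: "\<And>b b'. b \<in> carrier B \<Longrightarrow> b' \<in> carrier B \<Longrightarrow> j (b \<oplus>\<^bsub>B\<^esub> b') = j b \<oplus> j b'"
    and s: "\<And>c a b. c \<in> carrier K \<Longrightarrow> a \<in> carrier A \<Longrightarrow> b \<in> carrier B \<Longrightarrow>
      i (f c \<otimes>\<^bsub>A\<^esub> a) \<otimes> j b = i a \<otimes> j (g c \<otimes>\<^bsub>B\<^esub> b)"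
  shows "u \<in> F \<and> tensor_eval T i j u = \<zero>"
proof -
  interpret A: cring A by (rule A)
  interpret B: cring B by (rule B)
  note single = tensor_eval_single
  have cl: "\<And>a. a \<in> carrier A \<Longrightarrow> i a \<in> carrier T" "\<And>b. b \<in> carrier B \<Longrightarrow> j b \<in> carrier T"
    using ij CAB by auto
  from u show ?thesis
  proof (induction rule: tensor_relations.induct)
    case zero
    then show ?case by (simp add: zero_in_F tensor_eval_0)
  next
    case (diff u v)
    then show ?case using tensor_eval_diff[of u v] by (simp add: a_minus_def)
  next
    case (add_left a a' b)
    then have m: "a \<oplus>\<^bsub>A\<^esub> a' \<in> CA" "a \<in> CA" "a' \<in> CA" "b \<in> CB" using CAB by auto
    note s1 = single[OF m(1,4)] and s2 = single[OF m(2,4)] and s3 = single[OF m(3,4)]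
    note d1 = tensor_eval_diff[OF s1(1) s2(1)]
    note d2 = tensor_eval_diff[OF d1(1) s3(1)]
    have "tensor_eval T i j (Poly_Mapping.single (a \<oplus>\<^bsub>A\<^esub> a', b) 1 - Poly_Mapping.single (a, b) 1
      - Poly_Mapping.single (a', b) 1) = (i a \<oplus> i a') \<otimes> j b \<ominus> i a \<otimes> j b \<ominus> i a' \<otimes> j b"
      unfolding d2(2) d1(2) s1(2) s2(2) s3(2) using i add_left by simp
    also have "\<dots> = \<zero>" using cl add_left by algebra
    finally show ?case using d2(1) by simp
  next
    case (add_right a b b')
    then have m: "a \<in> CA" "b \<oplus>\<^bsub>B\<^esub> b' \<in> CB" "b \<in> CB" "b' \<in> CB" using CAB by auto
    note s1 = single[OF m(1,2)] and s2 = single[OF m(1,3)] and s3 = single[OF m(1,4)]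
    note d1 = tensor_eval_diff[OF s1(1) s2(1)]
    note d2 = tensor_eval_diff[OF d1(1) s3(1)]
    have "tensor_eval T i j (Poly_Mapping.single (a, b \<oplus>\<^bsub>B\<^esub> b') 1 - Poly_Mapping.single (a, b) 1
      - Poly_Mapping.single (a, b') 1) = i a \<otimes> (j b \<oplus> j b') \<ominus> i a \<otimes> j b \<ominus> i a \<otimes> j b'"
      unfolding d2(2) d1(2) s1(2) s2(2) s3(2) using j add_right by simp
    also have "\<dots> = \<zero>" using cl add_right by algebra
    finally show ?case using d2(1) by simp
  next
    case (scalar c a b)
    then have m: "f c \<otimes>\<^bsub>A\<^esub> a \<in> CA" "b \<in> CB" "a \<in> CA" "g c \<otimes>\<^bsub>B\<^esub> b \<in> CB"
      using CAB f g by (auto simp: Pi_def)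
    note s1 = single[OF m(1,2)] and s2 = single[OF m(3,4)]
    note d1 = tensor_eval_diff[OF s1(1) s2(1)]
    have "i a \<otimes> j (g c \<otimes>\<^bsub>B\<^esub> b) \<in> carrier T" using m ij by (intro m_closed) auto
    then show ?case using d1 unfolding s1(2) s2(2) s[OF scalar] by (simp add: a_minus_def r_neg)
  qed
qed

end

text \<open>The case \<open>P = {0}\<close> of \<open>inseparable_powers_independent\<close>, where
  the condition on the element reduces to \<open>y \<notin> k\<close>.\<close>

lemma powers_span_indep:
  fixes y :: "'k::field"
  assumes p: "Factorial_Ring.prime p" "CHAR('k) = p" and k: "subfield_set k"
    and y: "y ^ p \<in> k" "y \<notin> k"
    and c: "\<And>i. i < p \<Longrightarrow> c i \<in> k" "(\<Sum>i<p. c i * y ^ i) = 0" and i: "i < p"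
  shows "c i = 0"
proof -
  have kr: "subring_set k" using k unfolding subfield_set_def by simp
  have U: "subring_set (UNIV :: 'k set)" unfolding subring_set_def by simp
  have "prime_ideal_in (UNIV :: 'k set) {0}"
    unfolding prime_ideal_in_def subspace_over_def by auto
  moreover have "\<exists>c'\<in>k. c * c' - 1 \<in> {0}" if "c \<in> k" "c \<notin> {0}" for c
    using that k unfolding subfield_set_def by (intro bexI[of _ "inverse c"]) auto
  moreover have "y - c \<notin> {0}" if "c \<in> k" for c using that y(2) by auto
  ultimately have "c i \<in> {0}"
    by (intro inseparable_powers_independent[OF p U kr subset_UNIV _ _ UNIV_I y(1), where P = "{0}" and c = c] c i)
       (use c(2) in auto)
  then show ?thesis by simp
qed

lemma powers_span_closed:
  assumes S: "subring_set S" "A \<subseteq> S" "y \<in> S"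
  shows "powers_span A y n \<subseteq> S"
  unfolding powers_span_def using S(2)
  by (auto intro!: subring_set_sum[OF S(1)] subring_set_mult[OF S(1)] subring_set_power[OF S(1) S(3)])

lemma field_of_type_algebra_inv:
  "\<ominus>\<^bsub>ring_of_type_algebra\<^esub> z = - (z :: 'k::field)"
  "z \<noteq> 0 \<Longrightarrow> inv\<^bsub>ring_of_type_algebra\<^esub> z = inverse (z :: 'k)"
proof -
  interpret Fld: field "ring_of_type_algebra :: 'k ring" by (rule field_from_type_algebra)
  show "\<ominus>\<^bsub>ring_of_type_algebra\<^esub> z = - z"
    using a_inv_ring_on[of UNIV z] unfolding ring_on_UNIV subring_set_def by simp
  show "inv\<^bsub>ring_of_type_algebra\<^esub> z = inverse z" if "z \<noteq> 0"
    using Fld.inv_unique'[of z "inverse z"] that by simp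
qed

lemma subring_set_generate_field:
  "subring_set (generate_field ring_of_type_algebra (H :: 'k::field set))"
  unfolding subring_set_def
proof (intro conjI ballI)
  show "1 \<in> generate_field ring_of_type_algebra H"
    using generate_field.one[of "ring_of_type_algebra" H] by simp
  fix a b assume ab: "a \<in> generate_field ring_of_type_algebra H" "b \<in> generate_field ring_of_type_algebra H"
  show "a - b \<in> generate_field ring_of_type_algebra H"
    using generate_field.eng_add[OF ab(1) generate_field.a_inv[OF ab(2)]]
    by (simp add: field_of_type_algebra_inv(1) del: generate_field.simps)
  show "a * b \<in> generate_field ring_of_type_algebra H" using generate_field.eng_mult[OF ab] by simp
qed

text \<open>\<open>K\<close> and \<open>k\<close> are kept apart because the second root is adjoined
  to the field of the first one, while the generated field is described over
  \<open>K\<close>.\<close>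

lemma generate_field_eq_powers_span:
  fixes K :: "'k::field set"
  assumes p: "Factorial_Ring.prime p" "CHAR('k) = p"
    and k: "subfield_set k" "K \<subseteq> k" "k \<subseteq> generate_field ring_of_type_algebra (insert y K)"
    and y: "y ^ p \<in> k"
  shows "generate_field ring_of_type_algebra (insert y K) = powers_span k y p"
proof -
  have kr: "subring_set k" using k unfolding subfield_set_def by simp

  let ?G = "generate_field ring_of_type_algebra (insert y K)"
  have p0: "p > 0" using p(1) prime_gt_0_nat by blast
  note S = subring_set_powers_span[OF kr y p0]
  have Sf: "subfield_set (powers_span k y p)" by (rule subfield_set_powers_span[OF k(1) y p])

  show ?thesis
  proof
    show "?G \<subseteq> powers_span k y p"
    proof
      fix z assume "z \<in> ?G"
      then show "z \<in> powers_span k y p"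
      proof (induction rule: generate_field.induct)
        case one
        then show ?case using subring_set_1[OF S(1)] by simp
      next
        case (incl h)
        then show ?case using S(2,3) k(2) by auto
      next
        case (a_inv h)
        then show ?case using subring_set_uminus[OF S(1)] by (simp add: field_of_type_algebra_inv(1))
      next
        case (m_inv h)
        then show ?case using Sf field_of_type_algebra_inv(2)[of h] unfolding subfield_set_def by simp
      next
        case (eng_add h1 h2)
        then show ?case using subring_set_add[OF S(1)] by simp
      next
        case (eng_mult h1 h2)
        then show ?case using subring_set_mult[OF S(1)] by simp
      qed
    qed
    show "powers_span k y p \<subseteq> ?G"
      using k(3) by (intro powers_span_closed subring_set_generate_field) (auto intro: generate_field.incl)
  qed
qed

text \<open>The coordinates of \<open>k(y)\<close> over \<open>k\<close> induce functionals on the tensor product, which show that the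
  powers of \<open>y\<close> stay independent after the base change to \<open>R\<close>.\<close>

lemma tensor_product_powers_basis:
  fixes k :: "'k::field set" and R :: "'r ring" and i :: "'r \<Rightarrow> 't::idom" and j :: "'k \<Rightarrow> 't"
  assumes p: "Factorial_Ring.prime p" "CHAR('k) = p" and k: "subfield_set k"
    and y: "y ^ p \<in> k" "y \<notin> k"
    and R: "cring R" "\<phi> \<in> ring_hom (ring_on k) R"
    and T: "is_tensor_product (ring_on k) \<phi> R (\<lambda>c. c) (ring_on (powers_span k y p))
      (ring_of_type_algebra :: 't ring) i j"
  shows "\<And>c. (\<And>l. l < p \<Longrightarrow> c l \<in> carrier R) \<Longrightarrow> (\<Sum>l<p. i (c l) * j y ^ l) = 0 \<Longrightarrow> \<forall>l<p. c l = \<zero>\<^bsub>R\<^esub>"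
    and "powers_span (i ` carrier R) (j y) p = UNIV"
    and "subring_set (i ` carrier R)" and "j y ^ p \<in> i ` carrier R"
proof -
  define k1 where "k1 = powers_span k y p"
  have kr: "subring_set k" using k unfolding subfield_set_def by simp
  have p0: "p > 0" using p(1) prime_gt_0_nat by blast
  note S = subring_set_powers_span[OF kr y(1) p0, folded k1_def]
  interpret R: cring R by (rule R(1))
  have U: "subring_set (UNIV :: 't set)" unfolding subring_set_def by simp
  have cT: "cring (ring_of_type_algebra :: 't ring)" using cring_ring_on[OF U] unfolding ring_on_UNIV .
  have cK1: "cring (ring_on k1)" by (rule cring_ring_on[OF S(1)])
  note simps = ring_on_simps[where A = "UNIV :: 't set", unfolded ring_on_UNIV]
  have i: "i \<in> ring_hom R (ring_of_type_algebra :: 't ring)"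
    and j: "j \<in> ring_hom (ring_on k1) (ring_of_type_algebra :: 't ring)"
    and ij: "\<And>c. c \<in> k \<Longrightarrow> i (\<phi> c) = j c"
    and img: "tensor_eval ring_of_type_algebra i j ` {u. Poly_Mapping.keys u \<subseteq> carrier R \<times> k1} = (UNIV :: 't set)"
    and ker: "{u \<in> {u. Poly_Mapping.keys u \<subseteq> carrier R \<times> k1}. tensor_eval ring_of_type_algebra i j u = (0::'t)} =
      tensor_relations (ring_on k) \<phi> R (\<lambda>c. c) (ring_on k1)"
    using T unfolding is_tensor_product_def Let_def k1_def by (auto simp: simps)
  have jp: "j (z ^ n) = j z ^ n" if "z \<in> k1" for z n
  proof (induction n)
    case 0
    show ?case using ring_hom_one[OF j] simps by simp
  next
    case (Suc n)
    then show ?case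
      using ring_hom_mult[OF j, of z "z ^ n"] subring_set_power[OF S(1) that] that simps by simp
  qed
  have \<phi>c: "\<phi> c \<in> carrier R" if "c \<in> k" for c using ring_hom_closed[OF R(2)] that by simp
  interpret T: tensor_evaluation "ring_of_type_algebra :: 't ring" i j "carrier R" k1
    by (intro tensor_evaluation.intro tensor_evaluation_axioms.intro cT) (auto simp: simps)
  have iR: "subring_set (i ` carrier R)"
    unfolding subring_set_def
  proof (intro conjI ballI)
    show "1 \<in> i ` carrier R" using ring_hom_one[OF i] simps R.one_closed by (metis imageI)
    fix a b assume "a \<in> i ` carrier R" "b \<in> i ` carrier R"
    then obtain a' b' where ab: "a = i a'" "b = i b'" "a' \<in> carrier R" "b' \<in> carrier R" by blast
    have "i (a' \<ominus>\<^bsub>R\<^esub> b') + i b' = i a'"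
      using ring_hom_add[OF i, of "a' \<ominus>\<^bsub>R\<^esub> b'" b'] ab(3,4) simps
      by (simp add: a_minus_def R.a_assoc R.l_neg)
    then have "a - b = i (a' \<ominus>\<^bsub>R\<^esub> b')" using ab(1,2) by (simp add: algebra_simps)
    then show "a - b \<in> i ` carrier R" using ab(3,4) by simp
    have "a * b = i (a' \<otimes>\<^bsub>R\<^esub> b')" using ring_hom_mult[OF i ab(3,4)] ab(1,2) simps by simp
    then show "a * b \<in> i ` carrier R" using ab(3,4) by simp
  qed
  then show "subring_set (i ` carrier R)" .
  have "j y ^ p = i (\<phi> (y ^ p))" using jp[OF S(3)] ij[OF y(1)] by simp
  then show jyp: "j y ^ p \<in> i ` carrier R" using \<phi>c[OF y(1)] by simp
  note M = subring_set_powers_span[OF iR jyp p0]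
  have jM: "j z \<in> powers_span (i ` carrier R) (j y) p" if "z \<in> k1" for z
  proof -
    obtain c where c: "\<forall>l<p. c l \<in> k" "z = (\<Sum>l<p. c l * y ^ l)"
      using \<open>z \<in> k1\<close> unfolding k1_def powers_span_def by blast
    have "j (\<Sum>l<n. c l * y ^ l) = (\<Sum>l<n. i (\<phi> (c l)) * j y ^ l)" if "n \<le> p" for n
      using that
    proof (induction n)
      case 0
      have "j 0 + j 0 = j 0" using ring_hom_add[OF j, of 0 0] subring_set_0[OF S(1)] by simp
      then have "j 0 = 0" unfolding add_cancel_left_right .
      then show ?case by simp
    next
      case (Suc n)
      have ck: "c l \<in> k1" "c l \<in> k" if "l < Suc n" for l using c(1) S(2) that Suc.prems by auto
      have m: "c l * y ^ l \<in> k1" if "l < Suc n" for l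
        by (intro subring_set_mult[OF S(1)] subring_set_power[OF S(1)] S(3) ck(1)[OF that])
      have s: "(\<Sum>l<n. c l * y ^ l) \<in> k1" by (intro subring_set_sum[OF S(1)] m) auto
      have "j (c n * y ^ n) = j (c n) * j (y ^ n)"
        using ring_hom_mult[OF j, of "c n" "y ^ n"] ck(1)[of n] subring_set_power[OF S(1) S(3)] simps by simp
      then have "j (c n * y ^ n) = i (\<phi> (c n)) * j y ^ n" using jp[OF S(3)] ij[OF ck(2)[of n]] by simp
      then show ?case
        using ring_hom_add[OF j, of "\<Sum>l<n. c l * y ^ l" "c n * y ^ n"] s m[of n] Suc simps by simp
    qed
    from this[of p] have "j z = (\<Sum>l<p. i (\<phi> (c l)) * j y ^ l)" using c(2) by simp
    then show ?thesis
      unfolding powers_span_def using c(1) \<phi>c by (intro CollectI exI[of _ "\<lambda>l. i (\<phi> (c l))"]) auto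
  qed
  show "powers_span (i ` carrier R) (j y) p = UNIV"
  proof (intro equalityI subsetI UNIV_I)
    fix \<tau> :: 't
    obtain u where u: "Poly_Mapping.keys u \<subseteq> carrier R \<times> k1" "\<tau> = tensor_eval ring_of_type_algebra i j u"
      using img by blast
    have "\<tau> = (\<Sum>q\<in>Poly_Mapping.keys u. of_int (Poly_Mapping.lookup u q) * (i (fst q) * j (snd q)))"
      unfolding u(2) tensor_eval_def finsum_ring_of_type_algebra add_pow_ring_of_type_algebra by simp
    also have "\<dots> \<in> powers_span (i ` carrier R) (j y) p"
    proof (intro subring_set_sum[OF M(1)] subring_set_mult[OF M(1)])
      fix q assume q: "q \<in> Poly_Mapping.keys u"
      have "of_int n \<in> powers_span (i ` carrier R) (j y) p" for n
        by (cases n rule: int_cases2)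
           (auto intro: subring_set_of_nat[OF M(1)] subring_set_uminus[OF M(1) subring_set_of_nat[OF M(1)]])
      then show "of_int (Poly_Mapping.lookup u q) \<in> powers_span (i ` carrier R) (j y) p" .
      show "i (fst q) \<in> powers_span (i ` carrier R) (j y) p"
        using subsetD[OF u(1) q] M(2) by (auto simp: mem_Times_iff)
      show "j (snd q) \<in> powers_span (i ` carrier R) (j y) p"
        using subsetD[OF u(1) q] jM by (auto simp: mem_Times_iff)
    qed
    finally show "\<tau> \<in> powers_span (i ` carrier R) (j y) p" .
  qed
  fix c assume c: "\<And>l. l < p \<Longrightarrow> c l \<in> carrier R" "(\<Sum>l<p. i (c l) * j y ^ l) = 0"
  \<comment> \<open>Coordinates with respect to the powers of \<open>y\<close>. They are chosen
    arbitrarily, and \<open>coord_unique\<close> makes them linear.\<close>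
  define coord where "coord z = (SOME c. (\<forall>l<p. c l \<in> k) \<and> z = (\<Sum>l<p. c l * y ^ l))" for z
  have coord: "\<forall>l<p. coord z l \<in> k" "z = (\<Sum>l<p. coord z l * y ^ l)" if "z \<in> k1" for z
    using someI_ex[of "\<lambda>c. (\<forall>l<p. c l \<in> k) \<and> z = (\<Sum>l<p. c l * y ^ l)"] that
    unfolding coord_def k1_def powers_span_def by blast+
  have coord_unique: "coord z l = d l"
    if "z \<in> k1" "l < p" "\<And>l. l < p \<Longrightarrow> d l \<in> k" "z = (\<Sum>l<p. d l * y ^ l)" for z d l
  proof -
    have "(\<Sum>l<p. (coord z l - d l) * y ^ l) = 0"
      using coord(2)[OF that(1)] that(4) by (simp add: left_diff_distrib sum_subtractf)
    then have "coord z l - d l = 0"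
      by (intro powers_span_indep[OF p k y, of "\<lambda>l. coord z l - d l" l])
         (use coord(1)[OF that(1)] that(2,3) in \<open>auto intro: subring_set_diff[OF kr]\<close>)
    then show ?thesis by simp
  qed
  \<comment> \<open>A formal preimage of the given relation. Its value in the tensor product is 0,
    so it is a tensor relation and every balanced pair of maps sends it to 0.\<close>
  define u where "u = (\<Sum>l<p. Poly_Mapping.single (c l, y ^ l) (1::int))"
  have yk1: "y ^ l \<in> k1" for l by (rule subring_set_power[OF S(1,3)])
  have uF: "u \<in> T.F" and Tu: "tensor_eval ring_of_type_algebra i j u = (0::'t)"
  proof -
    have *: "u \<in> T.F \<and> tensor_eval ring_of_type_algebra i j u =
        finsum ring_of_type_algebra (\<lambda>l. i (c l) \<otimes>\<^bsub>ring_of_type_algebra\<^esub> j (y ^ l)) {..<p}"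
      unfolding u_def using c(1) yk1 by (intro T.tensor_eval_sum_singles) auto
    then show "u \<in> T.F" by blast
    have "finsum ring_of_type_algebra (\<lambda>l. i (c l) \<otimes>\<^bsub>ring_of_type_algebra\<^esub> j (y ^ l)) {..<p} = (0::'t)"
      unfolding finsum_ring_of_type_algebra using c(2) jp[OF S(3)] by simp
    with * show "tensor_eval ring_of_type_algebra i j u = (0::'t)" by simp
  qed
  then have urel: "u \<in> tensor_relations (ring_on k) \<phi> R (\<lambda>c. c) (ring_on k1)"
    using ker unfolding T.F_def by blast
  show "\<forall>l<p. c l = \<zero>\<^bsub>R\<^esub>"
  proof (intro allI impI)
    fix l assume l: "l < p"
    \<comment> \<open>The coordinate \<open>l\<close>, moved to \<open>R\<close> by \<phi>. Together
      with the identity of \<open>R\<close> it is a balanced pair that sends the formal sum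
      \<open>u\<close> to \<open>c l\<close>.\<close>
    define g where "g z = \<phi> (coord z l)" for z
    have g: "g z \<in> carrier R" if "z \<in> k1" for z unfolding g_def using coord(1)[OF that] l \<phi>c by blast
    interpret E: tensor_evaluation R "\<lambda>a. a" g "carrier R" k1
      by (intro tensor_evaluation.intro tensor_evaluation_axioms.intro R(1)) (use g in auto)
    have "u \<in> E.F \<and> tensor_eval R (\<lambda>a. a) g u = \<zero>\<^bsub>R\<^esub>"
    proof (rule E.tensor_relations_eval[OF urel _ _ R(1) cK1])
      show "\<phi> \<in> carrier (ring_on k) \<rightarrow> carrier R" using \<phi>c by auto
      show "(\<lambda>c. c) \<in> carrier (ring_on k) \<rightarrow> carrier (ring_on k1)" using S(2) by auto
      fix b b' assume "b \<in> carrier (ring_on k1)" "b' \<in> carrier (ring_on k1)"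
      then have b: "b \<in> k1" "b' \<in> k1" by simp_all
      have "coord (b + b') l = coord b l + coord b' l"
        by (rule coord_unique[OF subring_set_add[OF S(1) b] l])
           (use coord[OF b(1)] coord[OF b(2)] subring_set_add[OF kr] in \<open>simp_all add: distrib_right sum.distrib\<close>)
      then show "g (b \<oplus>\<^bsub>ring_on k1\<^esub> b') = g b \<oplus>\<^bsub>R\<^esub> g b'"
        unfolding g_def using ring_hom_add[OF R(2), of "coord b l" "coord b' l"] coord(1)[OF b(1)] coord(1)[OF b(2)] l
        by simp
    next
      fix d a b assume "d \<in> carrier (ring_on k)" "a \<in> carrier R" "b \<in> carrier (ring_on k1)"
      then have d: "d \<in> k" "a \<in> carrier R" "b \<in> k1" "d \<in> k1" using S(2) by auto
      have "coord (d * b) l = d * coord b l"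
        by (rule coord_unique[OF subring_set_mult[OF S(1) d(4,3)] l])
           (use coord[OF d(3)] subring_set_mult[OF kr d(1)] in \<open>auto simp: sum_distrib_left[symmetric] mult.assoc\<close>)
      then have "g (d * b) = \<phi> d \<otimes>\<^bsub>R\<^esub> g b"
        unfolding g_def using ring_hom_mult[OF R(2), of d "coord b l"] coord(1)[OF d(3)] l d(1) by simp
      then show "\<phi> d \<otimes>\<^bsub>R\<^esub> a \<otimes>\<^bsub>R\<^esub> g b = a \<otimes>\<^bsub>R\<^esub> g (d \<otimes>\<^bsub>ring_on k1\<^esub> b)"
        using \<phi>c[OF d(1)] d(2) g[OF d(3)] by (simp add: R.m_ac)
    qed simp_all
    moreover have "tensor_eval R (\<lambda>a. a) g u = (\<Oplus>\<^bsub>R\<^esub>l'\<in>{..<p}. c l' \<otimes>\<^bsub>R\<^esub> g (y ^ l'))"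
      unfolding u_def using E.tensor_eval_sum_singles[of "{..<p}" c "\<lambda>l. y ^ l"] c(1) yk1 by auto
    moreover have "(\<Oplus>\<^bsub>R\<^esub>l'\<in>{..<p}. c l' \<otimes>\<^bsub>R\<^esub> g (y ^ l')) = (\<Oplus>\<^bsub>R\<^esub>l'\<in>{..<p}. if l' = l then c l' else \<zero>\<^bsub>R\<^esub>)"
    proof (rule R.finsum_cong')
      fix l' assume l': "l' \<in> {..<p}"
      have "coord (y ^ l') l = (if l = l' then 1 else 0)"
        by (rule coord_unique[OF yk1 l, of "\<lambda>n. if n = l' then 1 else 0"])
           (use subring_set_0[OF kr] subring_set_1[OF kr] l' in
             \<open>auto simp: if_distrib[of "\<lambda>z. z * _"] if_distribR cong: if_cong\<close>)
      moreover have "\<phi> 0 = \<zero>\<^bsub>R\<^esub>" using ring_hom_zero[OF R(2) cring.axioms(1)[OF cring_ring_on[OF kr]] R.ring_axioms] by simp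
      moreover have "\<phi> 1 = \<one>\<^bsub>R\<^esub>" using ring_hom_one[OF R(2)] by simp
      ultimately show "c l' \<otimes>\<^bsub>R\<^esub> g (y ^ l') = (if l' = l then c l' else \<zero>\<^bsub>R\<^esub>)"
        unfolding g_def using c(1)[of l'] l' by auto
    qed (use c(1) in auto)
    moreover have "\<dots> = c l"
      using R.finsum_singleton[of l "{..<p}" c] l c(1) by (auto simp: Pi_def eq_commute cong: if_cong)
    ultimately show "c l = \<zero>\<^bsub>R\<^esub>" by simp
  qed
qed

section \<open>Discrete valuation rings as ring records\<close>

text \<open>In a principal domain an irreducible element generates a maximal ideal. There is just
  one, so all irreducibles are associated to \<open>t\<close>, and a factorization becomes a unit
  times a power of \<open>t\<close>.\<close>

lemma discrete_valuation_ring_uniformizer: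
  assumes R: "discrete_valuation_ring R"
  obtains t where "t \<in> carrier R" "t \<noteq> \<zero>\<^bsub>R\<^esub>" "t \<notin> Units R" "uniformizer R t" "maximalideal (max_ideal R) R"
    "\<And>a. a \<in> carrier R \<Longrightarrow> a \<noteq> \<zero>\<^bsub>R\<^esub> \<Longrightarrow> \<exists>n::nat. \<exists>u\<in>Units R. a = u \<otimes>\<^bsub>R\<^esub> t [^]\<^bsub>R\<^esub> n"
proof -
  interpret principal_domain R using R unfolding discrete_valuation_ring_def by simp
  have nf: "\<not> field R" and ex1: "\<exists>!m. maximalideal m R" using R unfolding discrete_valuation_ring_def by simp_all
  have max: "maximalideal (max_ideal R) R" unfolding max_ideal_def by (rule theI'[OF ex1])
  have max_eq: "m = max_ideal R" if "maximalideal m R" for m using ex1 max that by blast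
  have "\<exists>a\<in>carrier R - {\<zero>\<^bsub>R\<^esub>}. a \<notin> Units R"
  proof (rule ccontr)
    assume "\<not> ?thesis"
    moreover have "\<zero>\<^bsub>R\<^esub> \<notin> Units R"
      by (metis Units_r_inv_ex l_null one_not_zero zero_closed)
    ultimately have "Units R = carrier R - {\<zero>\<^bsub>R\<^esub>}" using Units_closed by blast
    then show False using nf cring_fieldI by blast
  qed
  then obtain a where a: "a \<in> carrier R - {\<zero>\<^bsub>R\<^esub>}" "a \<notin> Units R" by blast
  obtain t where t: "t \<in> carrier R" "ring_irreducible\<^bsub>R\<^esub> t" using exists_irreducible_divisor[OF a] by blast
  have tmax: "max_ideal R = PIdl\<^bsub>R\<^esub> t" using max_eq[OF irreducible_imp_maximalideal[OF t]] by simp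
  have irr: "\<exists>u\<in>Units R. f = u \<otimes>\<^bsub>R\<^esub> t" if "f \<in> carrier R" "ring_irreducible\<^bsub>R\<^esub> f" for f
    using max_eq[OF irreducible_imp_maximalideal[OF that]] tmax
      associated_iff_same_ideal[OF that(1) t(1)] ring_associated_iff[OF that(1) t(1)] by simp
  have list: "\<exists>n::nat. \<exists>u\<in>Units R. foldr (\<otimes>\<^bsub>R\<^esub>) fs \<one>\<^bsub>R\<^esub> = u \<otimes>\<^bsub>R\<^esub> t [^]\<^bsub>R\<^esub> n"
    if "\<forall>f\<in>set fs. f \<in> carrier R \<and> ring_irreducible\<^bsub>R\<^esub> f" for fs
    using that
  proof (induction fs)
    case Nil
    show ?case by (intro exI[of _ 0] bexI[of _ "\<one>\<^bsub>R\<^esub>"]) auto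
  next
    case (Cons f fs)
    then obtain n :: nat and u v where *: "u \<in> Units R" "foldr (\<otimes>\<^bsub>R\<^esub>) fs \<one>\<^bsub>R\<^esub> = u \<otimes>\<^bsub>R\<^esub> t [^]\<^bsub>R\<^esub> n"
      "v \<in> Units R" "f = v \<otimes>\<^bsub>R\<^esub> t" using irr[of f] by auto
    have "foldr (\<otimes>\<^bsub>R\<^esub>) (f # fs) \<one>\<^bsub>R\<^esub> = (v \<otimes>\<^bsub>R\<^esub> u) \<otimes>\<^bsub>R\<^esub> t [^]\<^bsub>R\<^esub> Suc n"
      using * t(1) Units_closed by (simp add: m_ac)
    then show ?case using Units_m_closed[OF *(3,1)] by blast
  qed
  have pow: "\<exists>n::nat. \<exists>u\<in>Units R. a = u \<otimes>\<^bsub>R\<^esub> t [^]\<^bsub>R\<^esub> n" if a: "a \<in> carrier R" "a \<noteq> \<zero>\<^bsub>R\<^esub>" for a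
  proof (cases "a \<in> Units R")
    case True
    then show ?thesis using Units_closed by (intro exI[of _ 0] bexI[of _ a]) auto
  next
    case False
    obtain fs where fs: "set fs \<subseteq> carrier (mult_of R)" "wfactors (mult_of R) fs a"
      using factorization_property[of a] a False by blast
    have "\<forall>f\<in>set fs. f \<in> carrier R \<and> ring_irreducible\<^bsub>R\<^esub> f"
      using fs ring_irreducibleI' unfolding wfactors_def by auto
    from list[OF this] obtain n :: nat and u where
      nu: "u \<in> Units R" "foldr (\<otimes>\<^bsub>R\<^esub>) fs \<one>\<^bsub>R\<^esub> = u \<otimes>\<^bsub>R\<^esub> t [^]\<^bsub>R\<^esub> n" by blast
    have cl: "u \<otimes>\<^bsub>R\<^esub> t [^]\<^bsub>R\<^esub> n \<in> carrier R" using nu(1) t(1) Units_closed by simp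
    have "u \<otimes>\<^bsub>R\<^esub> t [^]\<^bsub>R\<^esub> n \<sim>\<^bsub>mult_of R\<^esub> a" using fs(2) nu(2) unfolding wfactors_def by simp
    then have "u \<otimes>\<^bsub>R\<^esub> t [^]\<^bsub>R\<^esub> n \<sim>\<^bsub>R\<^esub> a" using assoc_iff_assoc_mult[OF cl a(1)] by simp
    then have "a \<sim>\<^bsub>R\<^esub> u \<otimes>\<^bsub>R\<^esub> t [^]\<^bsub>R\<^esub> n" by (rule associated_sym)
    then obtain v where v: "v \<in> Units R" "a = v \<otimes>\<^bsub>R\<^esub> (u \<otimes>\<^bsub>R\<^esub> t [^]\<^bsub>R\<^esub> n)"
      using ring_associated_iff[OF a(1) cl] by blast
    then have "a = (v \<otimes>\<^bsub>R\<^esub> u) \<otimes>\<^bsub>R\<^esub> t [^]\<^bsub>R\<^esub> n" using nu(1) t(1) Units_closed by (simp add: m_assoc)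
    then show ?thesis using Units_m_closed[OF v(1) nu(1)] by blast
  qed
  show thesis
    by (rule that[OF t(1) ring_irreducibleE(1,4)[OF t] _ max pow])
       (use t(1) tmax in \<open>auto simp: uniformizer_def\<close>)
qed

locale field_embedding = cring R for R :: "'r ring" (structure) +
  fixes \<iota> :: "'r \<Rightarrow> 'f::field"
  assumes hom: "\<iota> \<in> ring_hom R ring_of_type_algebra"
    and inj: "\<And>a. a \<in> carrier R \<Longrightarrow> \<iota> a = 0 \<Longrightarrow> a = \<zero>"
begin

lemma emb_mult: "a \<in> carrier R \<Longrightarrow> b \<in> carrier R \<Longrightarrow> \<iota> (a \<otimes> b) = \<iota> a * \<iota> b"
  and emb_add: "a \<in> carrier R \<Longrightarrow> b \<in> carrier R \<Longrightarrow> \<iota> (a \<oplus> b) = \<iota> a + \<iota> b"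
  and emb_one: "\<iota> \<one> = 1"
  using ring_hom_mult[OF hom] ring_hom_add[OF hom] ring_hom_one[OF hom] by auto

lemma emb_zero: "\<iota> \<zero> = 0"
proof -
  have "\<iota> \<zero> + \<iota> \<zero> = \<iota> \<zero>" using emb_add[of \<zero> \<zero>] by simp
  then show ?thesis unfolding add_cancel_left_right .
qed

lemma emb_minus: "a \<in> carrier R \<Longrightarrow> b \<in> carrier R \<Longrightarrow> \<iota> (a \<ominus> b) = \<iota> a - \<iota> b"
  using emb_add[of "a \<ominus> b" b] by (simp add: a_minus_def a_assoc l_neg)

lemma emb_power: "a \<in> carrier R \<Longrightarrow> \<iota> (a [^] (n::nat)) = \<iota> a ^ n"
  by (induction n) (simp_all add: emb_one emb_mult mult.commute)

lemma emb_eq_iff: "a \<in> carrier R \<Longrightarrow> b \<in> carrier R \<Longrightarrow> \<iota> a = \<iota> b \<longleftrightarrow> a = b"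
  using inj[of "a \<ominus> b"] emb_minus[of a b] r_right_minus_eq[of a b] by auto

lemma emb_finsum: "f \<in> S \<rightarrow> carrier R \<Longrightarrow> \<iota> (finsum R f S) = (\<Sum>s\<in>S. \<iota> (f s))"
proof (induction S rule: infinite_finite_induct)
  case (infinite S)
  then show ?case by (simp add: finsum_def finprod_def emb_zero)
next
  case empty
  then show ?case by (simp add: emb_zero)
next
  case (insert s S)
  then have "f \<in> S \<rightarrow> carrier R" "f s \<in> carrier R" by auto
  then show ?case using insert by (simp add: emb_add finsum_closed)
qed

lemma subring_set_emb: "subring_set (\<iota> ` carrier R)"
  unfolding subring_set_def
proof (intro conjI ballI)
  show "1 \<in> \<iota> ` carrier R" using emb_one by (metis imageI one_closed)
  fix a b assume "a \<in> \<iota> ` carrier R" "b \<in> \<iota> ` carrier R"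
  then obtain a' b' where *: "a = \<iota> a'" "b = \<iota> b'" "a' \<in> carrier R" "b' \<in> carrier R" by blast
  show "a - b \<in> \<iota> ` carrier R" unfolding *(1,2) emb_minus[OF *(3,4), symmetric] using *(3,4) by simp
  show "a * b \<in> \<iota> ` carrier R" unfolding *(1,2) emb_mult[OF *(3,4), symmetric] using *(3,4) by simp
qed

lemma emb_Unit:
  assumes "u \<in> Units R"
  shows "\<iota> u \<in> \<iota> ` carrier R" "inverse (\<iota> u) \<in> \<iota> ` carrier R"
proof -
  have u: "u \<in> carrier R" "inv u \<in> carrier R" "u \<otimes> inv u = \<one>"
    using assms Units_closed Units_inv_closed Units_r_inv by auto
  show "\<iota> u \<in> \<iota> ` carrier R" using u(1) by blast
  have "\<iota> u * \<iota> (inv u) = 1" using emb_mult[OF u(1,2)] u(3) emb_one by simp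
  then have "inverse (\<iota> u) = \<iota> (inv u)" by (rule inverse_unique)
  then show "inverse (\<iota> u) \<in> \<iota> ` carrier R" using u(2) by simp
qed

lemma Unit_of_emb:
  assumes "u \<in> carrier R" "inverse (\<iota> u) \<in> \<iota> ` carrier R" "\<iota> u \<noteq> 0"
  shows "u \<in> Units R"
proof -
  obtain v where v: "v \<in> carrier R" "inverse (\<iota> u) = \<iota> v" using assms(2) by blast
  have "\<iota> u * \<iota> v = 1" unfolding v(2)[symmetric] using assms(3) by simp
  then have "\<iota> (u \<otimes> v) = \<iota> \<one>" using emb_mult[OF assms(1) v(1)] emb_one by simp
  then have "u \<otimes> v = \<one>" using emb_eq_iff assms(1) v(1) by simp
  then show ?thesis using assms(1) v(1) m_comm[OF assms(1) v(1)] unfolding Units_def by auto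
qed

lemma dvr_set_emb:
  assumes R: "discrete_valuation_ring R"
  obtains t where "t \<in> carrier R" "uniformizer R t" "dvr_set (\<iota> ` carrier R) (\<iota> t)"
    "maximalideal (max_ideal R) R"
    "\<And>a. a \<in> carrier R \<Longrightarrow> a \<in> max_ideal R \<longleftrightarrow> \<iota> a / \<iota> t \<in> \<iota> ` carrier R"
proof -
  obtain t where t: "t \<in> carrier R" "t \<noteq> \<zero>" "t \<notin> Units R" "uniformizer R t" "maximalideal (max_ideal R) R"
    "\<And>a. a \<in> carrier R \<Longrightarrow> a \<noteq> \<zero> \<Longrightarrow> \<exists>n::nat. \<exists>u\<in>Units R. a = u \<otimes> t [^] n"
    using discrete_valuation_ring_uniformizer[OF R] by metis
  have t0: "\<iota> t \<noteq> 0" using inj t(1,2) by blast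
  have dvr: "dvr_set (\<iota> ` carrier R) (\<iota> t)"
  proof
    show "subring_set (\<iota> ` carrier R)" by (rule subring_set_emb)
    show "\<iota> t \<in> \<iota> ` carrier R" "\<iota> t \<noteq> 0" using t(1) t0 by auto
    show "inverse (\<iota> t) \<notin> \<iota> ` carrier R" using Unit_of_emb[OF t(1) _ t0] t(3) by blast
    fix z assume "z \<in> \<iota> ` carrier R" "z \<noteq> 0"
    then obtain a where a: "a \<in> carrier R" "z = \<iota> a" "a \<noteq> \<zero>" using emb_zero by blast
    from t(6)[OF a(1,3)] obtain n :: nat and u where u: "u \<in> Units R" "a = u \<otimes> t [^] n" by blast
    have "z = \<iota> u * \<iota> t ^ n"
      unfolding a(2) u(2) using emb_mult[of u "t [^] n"] emb_power[OF t(1)] Units_closed[OF u(1)] t(1) by simp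
    then show "\<exists>n u. u \<in> \<iota> ` carrier R \<and> inverse u \<in> \<iota> ` carrier R \<and> z = u * \<iota> t ^ n"
      using emb_Unit[OF u(1)] by blast
  qed
  have mem: "a \<in> max_ideal R \<longleftrightarrow> \<iota> a / \<iota> t \<in> \<iota> ` carrier R" if a: "a \<in> carrier R" for a
  proof
    assume "a \<in> max_ideal R"
    then obtain x where "x \<in> carrier R" "a = x \<otimes> t" using t(4) unfolding uniformizer_def cgenideal_def by auto
    then show "\<iota> a / \<iota> t \<in> \<iota> ` carrier R" using emb_mult t(1) t0 by simp
  next
    assume "\<iota> a / \<iota> t \<in> \<iota> ` carrier R"
    then obtain x where x: "x \<in> carrier R" "\<iota> a / \<iota> t = \<iota> x" by blast
    then have "\<iota> a = \<iota> (x \<otimes> t)" using emb_mult[OF x(1) t(1)] t0 by (simp add: field_simps)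
    then have "a = x \<otimes> t" using emb_eq_iff a x(1) t(1) by simp
    then show "a \<in> max_ideal R" using t(4) x(1) unfolding uniformizer_def cgenideal_def by auto
  qed
  show thesis by (rule that[OF t(1,4) dvr t(5) mem])
qed

lemma uniformizers_associated:
  assumes "uniformizer R t" "uniformizer R t'" "\<iota> t \<noteq> 0"
  obtains w where "w \<in> \<iota> ` carrier R" "inverse w \<in> \<iota> ` carrier R" "w \<noteq> 0" "\<iota> t' = w * \<iota> t"
proof -
  have t: "t \<in> carrier R" "t' \<in> carrier R" "PIdl\<^bsub>R\<^esub> t = PIdl\<^bsub>R\<^esub> t'" using assms(1,2) unfolding uniformizer_def by auto
  obtain a b where ab: "a \<in> carrier R" "t' = a \<otimes> t" "b \<in> carrier R" "t = b \<otimes> t'"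
    using cgenideal_self[OF t(1)] cgenideal_self[OF t(2)] t(3) unfolding cgenideal_def by blast
  have 1: "\<iota> t' = \<iota> a * \<iota> t" using emb_mult[OF ab(1) t(1)] ab(2) by simp
  have "\<iota> t = \<iota> b * \<iota> t'" using emb_mult[OF ab(3) t(2)] ab(4) by simp
  then have "\<iota> a * \<iota> b = 1" using 1 assms(3) by (simp add: mult.commute)
  then have "inverse (\<iota> a) = \<iota> b" "\<iota> a \<noteq> 0" by (auto intro: inverse_unique)
  then show thesis using that[OF _ _ _ 1] ab(1,3) by auto
qed

end

lemma field_embedding_ring_on:
  fixes B :: "'f::field set"
  assumes "subring_set B"
  shows "field_embedding (ring_on B) (\<lambda>z. z)"
proof -
  interpret cring "ring_on B" by (rule cring_ring_on[OF assms])
  show ?thesis by unfold_locales (auto simp: ring_hom_def)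
qed

context dvr_set
begin

interpretation Rec: cring "ring_on A" by (rule cring_ring_on[OF A])

lemma t_ideal_eq_PIdl: "t_ideal 1 = PIdl\<^bsub>ring_on A\<^esub> t"
proof (intro equalityI subsetI)
  fix z assume "z \<in> t_ideal 1"
  then show "z \<in> PIdl\<^bsub>ring_on A\<^esub> t"
    unfolding cgenideal_def using t(2) by (intro CollectI exI[of _ "z / t"]) (simp add: t_ideal_def)
next
  fix z assume "z \<in> PIdl\<^bsub>ring_on A\<^esub> t"
  then show "z \<in> t_ideal 1" using t(2) unfolding cgenideal_def t_ideal_def by auto
qed

lemma ideal_ring_on_unit:
  assumes "ideal I (ring_on A)" "unit_in u" "u \<in> I"
  shows "I = A"
proof -
  interpret ideal I "ring_on A" by (rule assms(1))
  have "inverse u * u \<in> I" using I_l_closed[OF assms(3), of "inverse u"] assms(2) unfolding unit_in_def by simp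
  then have "1 \<in> I" using assms(2) unfolding unit_in_def by simp
  then show ?thesis using one_imp_carrier by simp
qed

lemma max_ideal_ring_on: "maximalideal (t_ideal 1) (ring_on A)" "max_ideal (ring_on A) = t_ideal 1"
proof -
  have id: "ideal (t_ideal 1) (ring_on A)"
    unfolding t_ideal_eq_PIdl using t(1) by (intro Rec.cgenideal_ideal) simp
  have one: "1 \<notin> t_ideal 1" using prime_ideal_t unfolding prime_ideal_in_def by blast
  have sub: "I \<subseteq> t_ideal 1" if "ideal I (ring_on A)" "I \<noteq> A" for I
  proof
    fix z assume z: "z \<in> I"
    have zA: "z \<in> A" using ideal.Icarr[OF that(1) z] by simp
    have "\<not> unit_in z" using ideal_ring_on_unit[OF that(1) _ z] that(2) by blast
    then show "z \<in> t_ideal 1" using unit_iff_not_div_t[OF zA] unfolding t_ideal_def by simp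
  qed
  show max: "maximalideal (t_ideal 1) (ring_on A)"
  proof (rule maximalidealI[OF id])
    show "carrier (ring_on A) \<noteq> t_ideal 1" using one A_closed(1) by auto
    fix J assume "ideal J (ring_on A)" "t_ideal 1 \<subseteq> J" "J \<subseteq> carrier (ring_on A)"
    then show "J = t_ideal 1 \<or> J = carrier (ring_on A)" using sub[of J] by auto
  qed
  show "max_ideal (ring_on A) = t_ideal 1"
    unfolding max_ideal_def
  proof (rule the_equality[of "\<lambda>m. maximalideal m (ring_on A)", OF max])
    fix I assume I: "maximalideal I (ring_on A)"
    then have idI: "ideal I (ring_on A)" by (rule maximalideal.axioms(1))
    have ne: "I \<noteq> A" using maximalideal.I_notcarr[OF I] by simp
    have "t_ideal 1 = I \<or> t_ideal 1 = carrier (ring_on A)"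
      using maximalideal.I_maximal[OF I id sub[OF idI ne]] t_ideal_subset by simp
    then show "I = t_ideal 1" using one A_closed(1) by auto
  qed
qed

lemma uniformizer_ring_on: "uniformizer (ring_on A) t"
  unfolding uniformizer_def max_ideal_ring_on t_ideal_eq_PIdl using t(1) by simp

lemma Units_ring_on: "w \<in> Units (ring_on A) \<longleftrightarrow> unit_in w"
proof -
  interpret E: field_embedding "ring_on A" "\<lambda>z. z" by (rule field_embedding_ring_on[OF A])
  show ?thesis
  proof
    assume w: "w \<in> Units (ring_on A)"
    have "w \<noteq> 0"
    proof
      assume "w = 0"
      then have "0 * z = 1" if "z = inv\<^bsub>ring_on A\<^esub> w" for z
        using Rec.Units_r_inv[OF w] that by simp
      then show False by simp
    qed
    then show "unit_in w" using E.emb_Unit[OF w] unfolding unit_in_def by simp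
  qed (use E.Unit_of_emb[of w] in \<open>simp add: unit_in_def\<close>)
qed

text \<open>The definite description needs uniqueness: another uniformizer, of either ring, differs
  by a unit, so the exponent of \<open>t\<close> stays the same.\<close>

lemma ramification_index_eq:
  assumes R: "field_embedding R \<iota>" and sub: "\<iota> ` carrier R \<subseteq> A" and r: "uniformizer R r"
    and eq: "\<iota> r = w * t ^ e" "unit_in w"
  shows "ramification_index \<iota> R (ring_on A) = e"
proof -
  interpret Dom: field_embedding R \<iota> by (rule R)
  interpret E: field_embedding "ring_on A" "\<lambda>z. z" by (rule field_embedding_ring_on[OF A])
  show ?thesis
    unfolding ramification_index_def
  proof (rule the_equality)
    show "\<exists>r s. \<exists>u\<in>Units (ring_on A). uniformizer R r \<and> uniformizer (ring_on A) s \<and>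
        \<iota> r = u \<otimes>\<^bsub>ring_on A\<^esub> s [^]\<^bsub>ring_on A\<^esub> e"
      using r eq uniformizer_ring_on Units_ring_on
      by (intro exI[of _ r] exI[of _ t] bexI[of _ w]) (simp_all only: power_ring_on ring_on_simps simp_thms)
  next
    fix e' :: nat assume "\<exists>r s. \<exists>u\<in>Units (ring_on A). uniformizer R r \<and> uniformizer (ring_on A) s \<and>
        \<iota> r = u \<otimes>\<^bsub>ring_on A\<^esub> s [^]\<^bsub>ring_on A\<^esub> e'"
    then obtain r' s' u' where u': "u' \<in> Units (ring_on A)" and *: "uniformizer R r'"
      "uniformizer (ring_on A) s'" "\<iota> r' = u' * s' ^ e'"
      unfolding power_ring_on ring_on_simps by blast
    have uu: "unit_in u'" using u' Units_ring_on by simp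
    have r0: "\<iota> r \<noteq> 0" using eq t(2) unfolding unit_in_def by simp
    obtain x where x: "x \<in> \<iota> ` carrier R" "inverse x \<in> \<iota> ` carrier R" "x \<noteq> 0" "\<iota> r' = x * \<iota> r"
      using Dom.uniformizers_associated[OF r *(1) r0] by blast
    obtain z where z: "z \<in> A" "inverse z \<in> A" "z \<noteq> 0" "s' = z * t"
      using E.uniformizers_associated[OF uniformizer_ring_on *(2) t(2)] by auto
    have "unit_in x" "unit_in z" using x z sub unfolding unit_in_def by auto
    then have u1: "unit_in (u' * z ^ e')" "unit_in (x * w)" using uu eq(2) unit_in_mult unit_in_power by auto
    have "(x * w) * t ^ e = (u' * z ^ e') * t ^ e'"
      using *(3) x(4) eq(1) unfolding z(4) by (simp add: power_mult_distrib mult.assoc)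
    from unit_power_unique[OF u1(2,1) this] show "e' = e" by simp
  qed
qed

end

section \<open>Dimensions of quotients\<close>

text \<open>A version of \<open>basis_mod\<close> with the scalars inside the field and with
  existence and uniqueness of coefficients separated; this form can be followed along the chains of
  \<open>qdim\<close>.\<close>

definition basis_over :: "'f::comm_ring_1 set \<Rightarrow> 'f set \<Rightarrow> 'f set \<Rightarrow> 'f set \<Rightarrow> bool"
  where "basis_over k V W S \<longleftrightarrow> finite S \<and> S \<subseteq> V \<and>
    (\<forall>v\<in>V. \<exists>c. (\<forall>s\<in>S. c s \<in> k) \<and> v - (\<Sum>s\<in>S. c s * s) \<in> W) \<and>
    (\<forall>c. (\<forall>s\<in>S. c s \<in> k) \<longrightarrow> (\<Sum>s\<in>S. c s * s) \<in> W \<longrightarrow> (\<forall>s\<in>S. c s = 0))"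

lemma qdim_imp_basis:
  fixes k :: "'f::field set"
  assumes "qdim k V W n" "subfield_set k" "subspace_over k W"
  shows "\<exists>S. basis_over k V W S \<and> card S = n"
  using assms(1,3)
proof (induction rule: qdim.induct)
  case (refl W)
  show ?case by (intro exI[of _ "{}"]) (simp add: basis_over_def)
next
  case (adjoin V W n v)
  have k: "subring_set k" using assms(2) unfolding subfield_set_def by simp
  have V: "subspace_over k V" using qdim_subspace[OF adjoin(1) k adjoin.prems] .
  have WV: "W \<subseteq> V" by (rule qdim_subset[OF adjoin(1) k])
  from adjoin obtain S where S: "basis_over k V W S" "card S = n" by blast
  then have fin: "finite S" and SV: "S \<subseteq> V"
    and span: "\<And>w. w \<in> V \<Longrightarrow> \<exists>c. (\<forall>s\<in>S. c s \<in> k) \<and> w - (\<Sum>s\<in>S. c s * s) \<in> W"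
    and indep: "\<And>c. (\<forall>s\<in>S. c s \<in> k) \<Longrightarrow> (\<Sum>s\<in>S. c s * s) \<in> W \<Longrightarrow> (\<forall>s\<in>S. c s = 0)"
    unfolding basis_over_def by blast+
  have vS: "v \<notin> S" using SV adjoin(2) by blast
  have "basis_over k (adjoin k V v) W (insert v S)"
    unfolding basis_over_def
  proof (intro conjI ballI allI impI)
    show "finite (insert v S)" using fin by simp
    show "insert v S \<subseteq> adjoin k V v"
      using SV subset_adjoin[OF k, of V v] mem_adjoin[OF k subspace_over_0[OF V]] by blast
    fix z assume "z \<in> adjoin k V v"
    then obtain w d where z: "z = w + d * v" "w \<in> V" "d \<in> k" unfolding adjoin_def by blast
    obtain c where c: "\<forall>s\<in>S. c s \<in> k" "w - (\<Sum>s\<in>S. c s * s) \<in> W" using span[OF z(2)] by blast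
    have "(\<Sum>s\<in>S. (c(v := d)) s * s) = (\<Sum>s\<in>S. c s * s)" using vS by (intro sum.cong) auto
    then have "z - (\<Sum>s\<in>insert v S. (c(v := d)) s * s) = w - (\<Sum>s\<in>S. c s * s)"
      using fin vS z(1) by simp
    moreover have "\<forall>s\<in>insert v S. (c(v := d)) s \<in> k" using c(1) z(3) by auto
    ultimately show "\<exists>c. (\<forall>s\<in>insert v S. c s \<in> k) \<and> z - (\<Sum>s\<in>insert v S. c s * s) \<in> W"
      using c(2) by metis
  next
    fix c s assume c: "\<forall>s\<in>insert v S. c s \<in> k" "(\<Sum>s\<in>insert v S. c s * s) \<in> W" and s: "s \<in> insert v S"
    have eq: "(\<Sum>s\<in>insert v S. c s * s) = c v * v + (\<Sum>s\<in>S. c s * s)" using fin vS by simp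
    have SV': "(\<Sum>s\<in>S. c s * s) \<in> V"
      using c(1) SV by (intro subspace_over_sum[OF V] subspace_over_scale[OF V]) auto
    have cv: "c v = 0"
    proof (rule ccontr)
      assume nz: "c v \<noteq> 0"
      have "c v * v + (\<Sum>s\<in>S. c s * s) \<in> V" using c(2) WV unfolding eq by blast
      from subspace_over_diff[OF V k this SV'] have "c v * v \<in> V" by simp
      then have "inverse (c v) * (c v * v) \<in> V"
        using c(1) assms(2) unfolding subfield_set_def by (intro subspace_over_scale[OF V _ \<open>c v * v \<in> V\<close>]) auto
      then show False using adjoin(2) nz by (simp add: mult.assoc[symmetric])
    qed
    have "(\<Sum>s\<in>S. c s * s) \<in> W" using c(2) unfolding eq cv by simp
    then have "\<forall>s\<in>S. c s = 0" using c(1) by (intro indep) auto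
    then show "c s = 0" using cv s by blast
  qed
  then show ?case using S(2) fin vS by (intro exI[of _ "insert v S"]) simp
qed

lemma basis_imp_qdim:
  fixes k :: "'f::field set"
  assumes k: "subfield_set k" and W: "subspace_over k W" and V: "subspace_over k V" "W \<subseteq> V"
    and S: "basis_over k V W S"
  shows "qdim k V W (card S)"
proof -
  have kr: "subring_set k" using k unfolding subfield_set_def by simp
  from S have fin: "finite S" and SV: "S \<subseteq> V"
    and span: "\<And>w. w \<in> V \<Longrightarrow> \<exists>c. (\<forall>s\<in>S. c s \<in> k) \<and> w - (\<Sum>s\<in>S. c s * s) \<in> W"
    and indep: "\<And>c. (\<forall>s\<in>S. c s \<in> k) \<Longrightarrow> (\<Sum>s\<in>S. c s * s) \<in> W \<Longrightarrow> (\<forall>s\<in>S. c s = 0)"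
    unfolding basis_over_def by blast+
  define U where "U S' = {w + (\<Sum>s\<in>S'. c s * s) | w c. w \<in> W \<and> (\<forall>s\<in>S'. c s \<in> k)}" for S'
  have "qdim k (U S') W (card S')" if "finite S'" "S' \<subseteq> S" for S'
    using that
  proof (induction S')
    case empty
    have "U {} = W" unfolding U_def by simp
    then show ?case by (simp add: qdim.refl)
  next
    case (insert v S')
    have "v \<notin> U S'"
    proof
      assume "v \<in> U S'"
      then obtain w c where wc: "v = w + (\<Sum>s\<in>S'. c s * s)" "w \<in> W" "\<forall>s\<in>S'. c s \<in> k" unfolding U_def by blast
      \<comment> \<open>The relation that expresses \<open>v\<close>, extended by zero to all of
        \<open>S\<close>; its coefficient 1 at \<open>v\<close> contradicts independence.\<close>
      define d where "d s = (if s = v then 1 else if s \<in> S' then - c s else 0)" for s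
      have "(\<Sum>s\<in>S. d s * s) = (\<Sum>s\<in>insert v S'. d s * s)"
        using insert.prems fin by (intro sum.mono_neutral_right) (auto simp: d_def)
      also have "\<dots> = v + (\<Sum>s\<in>S'. d s * s)" using insert.hyps by (simp add: d_def)
      also have "(\<Sum>s\<in>S'. d s * s) = - (\<Sum>s\<in>S'. c s * s)"
        unfolding sum_negf[symmetric] using insert.hyps by (intro sum.cong) (auto simp: d_def)
      finally have "(\<Sum>s\<in>S. d s * s) \<in> W" using wc by simp
      moreover have "\<forall>s\<in>S. d s \<in> k"
        using wc(3) subring_set_0[OF kr] subring_set_1[OF kr] subring_set_uminus[OF kr] unfolding d_def by auto
      ultimately have "d v = 0" using indep insert.prems by blast
      then show False unfolding d_def by simp
    qed
    moreover have "U (insert v S') = adjoin k (U S') v"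
    proof (intro equalityI subsetI)
      fix z assume "z \<in> U (insert v S')"
      then obtain w c where "z = w + (\<Sum>s\<in>insert v S'. c s * s)" "w \<in> W" "\<forall>s\<in>insert v S'. c s \<in> k"
        unfolding U_def by blast
      then have "z = (w + (\<Sum>s\<in>S'. c s * s)) + c v * v" "w \<in> W" "\<forall>s\<in>S'. c s \<in> k" "c v \<in> k"
        using insert.hyps by (auto simp: algebra_simps)
      then show "z \<in> adjoin k (U S') v" unfolding adjoin_def U_def by blast
    next
      fix z assume "z \<in> adjoin k (U S') v"
      then obtain w c d where z: "z = (w + (\<Sum>s\<in>S'. c s * s)) + d * v" "w \<in> W" "\<forall>s\<in>S'. c s \<in> k" "d \<in> k"
        unfolding adjoin_def U_def by blast
      have "(\<Sum>s\<in>S'. (c(v := d)) s * s) = (\<Sum>s\<in>S'. c s * s)" using insert.hyps by (intro sum.cong) auto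
      then have "z = w + (\<Sum>s\<in>insert v S'. (c(v := d)) s * s)"
        using insert.hyps z(1) by (simp add: algebra_simps)
      moreover have "\<forall>s\<in>insert v S'. (c(v := d)) s \<in> k" using z(3,4) by auto
      ultimately show "z \<in> U (insert v S')" unfolding U_def using z(2) by blast
    qed
    ultimately show ?case using insert qdim.adjoin[of k "U S'" W "card S'" v] by simp
  qed
  from this[OF fin order_refl] have "qdim k (U S) W (card S)" .
  moreover have "U S = V"
  proof (intro equalityI subsetI)
    fix z assume "z \<in> U S"
    then obtain w c where "z = w + (\<Sum>s\<in>S. c s * s)" "w \<in> W" "\<forall>s\<in>S. c s \<in> k" unfolding U_def by blast
    then show "z \<in> V" using SV V(2)
      by (auto intro!: subspace_over_add[OF V(1)] subspace_over_sum[OF V(1)] subspace_over_scale[OF V(1)])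
  next
    fix z assume "z \<in> V"
    then obtain c where c: "\<forall>s\<in>S. c s \<in> k" "z - (\<Sum>s\<in>S. c s * s) \<in> W" using span by blast
    have "z = (z - (\<Sum>s\<in>S. c s * s)) + (\<Sum>s\<in>S. c s * s)" by simp
    with c show "z \<in> U S" unfolding U_def by blast
  qed
  ultimately show ?thesis by simp
qed

lemma basis_mod_iff_basis_over:
  fixes \<kappa> :: "'k::comm_ring_1 \<Rightarrow> 'f::field"
  assumes \<kappa>: "inj_hom_on K \<kappa>" "subring_set K" and B: "subring_set B" "\<kappa> ` K \<subseteq> B"
    and W: "subspace_over (\<kappa> ` K) W" "W \<subseteq> B"
  shows "basis_mod \<kappa> (ring_on K) (ring_on B) W S \<longleftrightarrow> basis_over (\<kappa> ` K) B W S"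
proof -
  have kr: "subring_set (\<kappa> ` K)" by (rule subring_set_image[OF \<kappa>])
  have coset: "W +>\<^bsub>ring_on B\<^esub> z = {w + z | w. w \<in> W}" for z
    unfolding a_r_coset_def' by auto
  have coset_eq: "W +>\<^bsub>ring_on B\<^esub> z = W +>\<^bsub>ring_on B\<^esub> z' \<longleftrightarrow> z - z' \<in> W" for z z'
  proof
    assume "W +>\<^bsub>ring_on B\<^esub> z = W +>\<^bsub>ring_on B\<^esub> z'"
    moreover have "0 + z \<in> W +>\<^bsub>ring_on B\<^esub> z" unfolding coset using subspace_over_0[OF W(1)] by blast
    ultimately obtain w where "w \<in> W" "z = w + z'" unfolding coset by auto
    then show "z - z' \<in> W" by simp
  next
    have half: "W +>\<^bsub>ring_on B\<^esub> z \<subseteq> W +>\<^bsub>ring_on B\<^esub> z'" if "z - z' \<in> W" for z z'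
    proof
      fix x assume "x \<in> W +>\<^bsub>ring_on B\<^esub> z"
      then obtain w where w: "w \<in> W" "x = w + z" unfolding coset by blast
      then have "w + (z - z') \<in> W" "x = (w + (z - z')) + z'"
        using subspace_over_add[OF W(1) w(1) that] by simp_all
      then show "x \<in> W +>\<^bsub>ring_on B\<^esub> z'" unfolding coset by blast
    qed
    assume d: "z - z' \<in> W"
    have "0 - (z - z') \<in> W" by (rule subspace_over_diff[OF W(1) kr subspace_over_0[OF W(1)] d])
    then have "z' - z \<in> W" by simp
    then show "W +>\<^bsub>ring_on B\<^esub> z = W +>\<^bsub>ring_on B\<^esub> z'" using half d by blast
  qed
  have fs: "finsum (ring_on B) (\<lambda>s. \<kappa> (c s) \<otimes>\<^bsub>ring_on B\<^esub> s) S = (\<Sum>s\<in>S. \<kappa> (c s) * s)"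
    if "S \<subseteq> B" "\<And>s. s \<in> S \<Longrightarrow> c s \<in> K" for c
    using that B by (subst finsum_ring_on[OF B(1)]) (auto intro!: subring_set_mult[OF B(1)])
  show ?thesis
  proof
    assume S: "basis_mod \<kappa> (ring_on K) (ring_on B) W S"
    then have fin: "finite S" and SB: "S \<subseteq> B" unfolding basis_mod_def by simp_all
    have ex1: "\<exists>!c. c \<in> S \<rightarrow>\<^sub>E K \<and> v - (\<Sum>s\<in>S. \<kappa> (c s) * s) \<in> W" if "v \<in> B" for v
    proof -
      have "\<exists>!c. c \<in> S \<rightarrow>\<^sub>E K \<and> W +>\<^bsub>ring_on B\<^esub> v =
          W +>\<^bsub>ring_on B\<^esub> finsum (ring_on B) (\<lambda>s. \<kappa> (c s) \<otimes>\<^bsub>ring_on B\<^esub> s) S"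
        using S that unfolding basis_mod_def by simp
      moreover have "(c \<in> S \<rightarrow>\<^sub>E K \<and> W +>\<^bsub>ring_on B\<^esub> v =
          W +>\<^bsub>ring_on B\<^esub> finsum (ring_on B) (\<lambda>s. \<kappa> (c s) \<otimes>\<^bsub>ring_on B\<^esub> s) S) \<longleftrightarrow>
          (c \<in> S \<rightarrow>\<^sub>E K \<and> v - (\<Sum>s\<in>S. \<kappa> (c s) * s) \<in> W)" for c
        unfolding coset_eq using fs[OF SB, of c] by (auto simp: PiE_iff)
      ultimately show ?thesis by simp
    qed
    show "basis_over (\<kappa> ` K) B W S"
      unfolding basis_over_def
    proof (intro conjI ballI allI impI fin SB)
      fix v assume "v \<in> B"
      from ex1[OF this] obtain c where "c \<in> S \<rightarrow>\<^sub>E K" "v - (\<Sum>s\<in>S. \<kappa> (c s) * s) \<in> W" by blast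
      then show "\<exists>c. (\<forall>s\<in>S. c s \<in> \<kappa> ` K) \<and> v - (\<Sum>s\<in>S. c s * s) \<in> W"
        by (intro exI[of _ "\<lambda>s. \<kappa> (c s)"]) (auto simp: PiE_iff)
    next
      fix c s assume c: "\<forall>s\<in>S. c s \<in> \<kappa> ` K" "(\<Sum>s\<in>S. c s * s) \<in> W" and s: "s \<in> S"
      define d where "d = restrict (\<lambda>s. SOME z. z \<in> K \<and> \<kappa> z = c s) S"
      have d: "d s \<in> K" "\<kappa> (d s) = c s" if sS: "s \<in> S" for s
      proof -
        obtain z where "z \<in> K \<and> \<kappa> z = c s" using bspec[OF c(1) sS] by (metis imageE)
        from someI[of "\<lambda>z. z \<in> K \<and> \<kappa> z = c s", OF this] show "d s \<in> K" "\<kappa> (d s) = c s"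
          using sS unfolding d_def by auto
      qed
      have "d \<in> S \<rightarrow>\<^sub>E K" using d(1) unfolding d_def by (auto simp: PiE_iff)
      moreover have "(\<Sum>s\<in>S. \<kappa> (d s) * s) = (\<Sum>s\<in>S. c s * s)" using d(2) by (intro sum.cong) auto
      then have "0 - (\<Sum>s\<in>S. \<kappa> (d s) * s) \<in> W"
        using subspace_over_diff[OF W(1) kr subspace_over_0[OF W(1)] c(2)] by simp
      moreover have "restrict (\<lambda>s. 0) S \<in> S \<rightarrow>\<^sub>E K" using subring_set_0[OF \<kappa>(2)] by auto
      moreover have "(\<Sum>s\<in>S. \<kappa> (restrict (\<lambda>s. 0) S s) * s) = 0"
        using inj_hom_on_0[OF \<kappa>] by (intro sum.neutral) auto
      then have "0 - (\<Sum>s\<in>S. \<kappa> (restrict (\<lambda>s. 0) S s) * s) \<in> W" using subspace_over_0[OF W(1)] by simp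
      \<comment> \<open>Uniqueness for the zero vector, which both \<open>d\<close> and the zero
        coefficients represent modulo \<open>W\<close>.\<close>
      ultimately have "d = restrict (\<lambda>s. 0) S" using ex1[OF subring_set_0[OF B(1)]] by blast
      then show "c s = 0" using d(2)[OF s] s inj_hom_on_0[OF \<kappa>] by simp
    qed
  next
    assume S: "basis_over (\<kappa> ` K) B W S"
    then have fin: "finite S" and SB: "S \<subseteq> B"
      and span: "\<And>w. w \<in> B \<Longrightarrow> \<exists>c. (\<forall>s\<in>S. c s \<in> \<kappa> ` K) \<and> w - (\<Sum>s\<in>S. c s * s) \<in> W"
      and indep: "\<And>c. (\<forall>s\<in>S. c s \<in> \<kappa> ` K) \<Longrightarrow> (\<Sum>s\<in>S. c s * s) \<in> W \<Longrightarrow> (\<forall>s\<in>S. c s = 0)"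
      unfolding basis_over_def by blast+
    have ex1: "\<exists>!c. c \<in> S \<rightarrow>\<^sub>E K \<and> v - (\<Sum>s\<in>S. \<kappa> (c s) * s) \<in> W" if v: "v \<in> B" for v
    proof (rule ex_ex1I)
      obtain c where c: "\<forall>s\<in>S. c s \<in> \<kappa> ` K" "v - (\<Sum>s\<in>S. c s * s) \<in> W" using span[OF v] by blast
      define d where "d = restrict (\<lambda>s. SOME z. z \<in> K \<and> \<kappa> z = c s) S"
      have d: "d s \<in> K" "\<kappa> (d s) = c s" if sS: "s \<in> S" for s
      proof -
        obtain z where "z \<in> K \<and> \<kappa> z = c s" using bspec[OF c(1) sS] by (metis imageE)
        from someI[of "\<lambda>z. z \<in> K \<and> \<kappa> z = c s", OF this] show "d s \<in> K" "\<kappa> (d s) = c s"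
          using sS unfolding d_def by auto
      qed
      have "d \<in> S \<rightarrow>\<^sub>E K" using d(1) unfolding d_def by (auto simp: PiE_iff)
      moreover have "(\<Sum>s\<in>S. \<kappa> (d s) * s) = (\<Sum>s\<in>S. c s * s)" using d(2) by (intro sum.cong) auto
      ultimately show "\<exists>c. c \<in> S \<rightarrow>\<^sub>E K \<and> v - (\<Sum>s\<in>S. \<kappa> (c s) * s) \<in> W" using c(2) by metis
    next
      fix c d assume c: "c \<in> S \<rightarrow>\<^sub>E K \<and> v - (\<Sum>s\<in>S. \<kappa> (c s) * s) \<in> W"
        and d: "d \<in> S \<rightarrow>\<^sub>E K \<and> v - (\<Sum>s\<in>S. \<kappa> (d s) * s) \<in> W"
      have "(v - (\<Sum>s\<in>S. \<kappa> (d s) * s)) - (v - (\<Sum>s\<in>S. \<kappa> (c s) * s)) \<in> W"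
        by (rule subspace_over_diff[OF W(1) kr]) (use c d in auto)
      then have "(\<Sum>s\<in>S. (\<kappa> (c s) - \<kappa> (d s)) * s) \<in> W" by (simp add: left_diff_distrib sum_subtractf)
      moreover have cd: "c s \<in> K" "d s \<in> K" if "s \<in> S" for s using c d that by auto
      then have "\<forall>s\<in>S. \<kappa> (c s) - \<kappa> (d s) \<in> \<kappa> ` K" using subring_set_diff[OF kr] by blast
      ultimately have "\<forall>s\<in>S. \<kappa> (c s) - \<kappa> (d s) = 0" using indep[of "\<lambda>s. \<kappa> (c s) - \<kappa> (d s)"] by blast
      then have "c s = d s" if "s \<in> S" for s
        using inj_hom_on_eq_iff[OF \<kappa> cd[OF that]] that by simp
      then show "c = d" using c d by (intro PiE_ext) auto
    qed
    show "basis_mod \<kappa> (ring_on K) (ring_on B) W S"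
      unfolding basis_mod_def
    proof (intro conjI ballI fin)
      show "S \<subseteq> carrier (ring_on B)" using SB by simp
      fix v assume "v \<in> carrier (ring_on B)"
      then have v: "v \<in> B" by simp
      have "(c \<in> S \<rightarrow>\<^sub>E K \<and> W +>\<^bsub>ring_on B\<^esub> v =
          W +>\<^bsub>ring_on B\<^esub> finsum (ring_on B) (\<lambda>s. \<kappa> (c s) \<otimes>\<^bsub>ring_on B\<^esub> s) S) \<longleftrightarrow>
          (c \<in> S \<rightarrow>\<^sub>E K \<and> v - (\<Sum>s\<in>S. \<kappa> (c s) * s) \<in> W)" for c
        unfolding coset_eq using fs[OF SB, of c] by (auto simp: PiE_iff)
      then show "\<exists>!c. c \<in> S \<rightarrow>\<^sub>E carrier (ring_on K) \<and> W +>\<^bsub>ring_on B\<^esub> v =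
          W +>\<^bsub>ring_on B\<^esub> finsum (ring_on B) (\<lambda>s. \<kappa> (c s) \<otimes>\<^bsub>ring_on B\<^esub> s) S"
        using ex1[OF v] by simp
    qed
  qed
qed

text \<open>All bases modulo \<open>W\<close> have \<open>n\<close> elements and one exists, so the
  infimum runs over a single value.\<close>

lemma quotient_dim_eq:
  fixes \<kappa> :: "'k::comm_ring_1 \<Rightarrow> 'f::field"
  assumes \<kappa>: "inj_hom_on K \<kappa>" "subring_set K" and k: "subfield_set (\<kappa> ` K)"
    and B: "subring_set B" "\<kappa> ` K \<subseteq> B" and W: "subspace_over (\<kappa> ` K) W"
    and n: "qdim (\<kappa> ` K) B W n"
  shows "quotient_dim \<kappa> (ring_on K) (ring_on B) W = enat n"
proof -
  have kr: "subring_set (\<kappa> ` K)" using k unfolding subfield_set_def by simp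
  have WB: "W \<subseteq> B" by (rule qdim_subset[OF n kr])
  have sB: "subspace_over (\<kappa> ` K) B"
    unfolding subspace_over_def
    using subring_set_0[OF B(1)] subring_set_add[OF B(1)] subring_set_mult[OF B(1)] B(2) by blast
  obtain S where S: "basis_over (\<kappa> ` K) B W S" "card S = n" using qdim_imp_basis[OF n k W] by blast
  have "card S' = n" if "basis_over (\<kappa> ` K) B W S'" for S'
    using qdim_unique[OF k W basis_imp_qdim[OF k W sB WB that] n] .
  then have "{enat (card S) | S. basis_mod \<kappa> (ring_on K) (ring_on B) W S} = {enat n}"
    unfolding basis_mod_iff_basis_over[OF \<kappa> B W WB] using S by auto
  then show ?thesis unfolding quotient_dim_def by simp
qed

section \<open>The fraction field of the tensor product\<close>

lemma image_powers_span:
  assumes h: "inj_hom_on D h" and D: "subring_set D" and A: "A \<subseteq> D" and y: "y \<in> D"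
  shows "h ` powers_span A y n = powers_span (h ` A) (h y) n"
proof -
  have eq: "h (\<Sum>l<n. c l * y ^ l) = (\<Sum>l<n. h (c l) * h y ^ l)" if "\<forall>l<n. c l \<in> A" for c n
    using that
  proof (induction n)
    case 0
    show ?case using inj_hom_on_0[OF h D] by simp
  next
    case (Suc n)
    have cD: "c l \<in> D" if "l < Suc n" for l using Suc.prems A that by blast
    have yD: "y ^ l \<in> D" for l by (rule subring_set_power[OF D y])
    have s: "(\<Sum>l<n. c l * y ^ l) \<in> D"
      by (intro subring_set_sum[OF D] subring_set_mult[OF D] yD cD) auto
    have m: "c n * y ^ n \<in> D" by (intro subring_set_mult[OF D] yD cD) auto
    have "h (\<Sum>l<Suc n. c l * y ^ l) = h (\<Sum>l<n. c l * y ^ l) + h (c n * y ^ n)"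
      using inj_hom_on_add[OF h D s m] by simp
    also have "h (c n * y ^ n) = h (c n) * h y ^ n"
      using inj_hom_on_mult[OF h D cD[of n] yD[of n]] inj_hom_on_power[OF h D y] by simp
    also have "h (\<Sum>l<n. c l * y ^ l) = (\<Sum>l<n. h (c l) * h y ^ l)" using Suc by simp
    finally show ?case by simp
  qed
  show ?thesis
  proof (intro equalityI subsetI)
    fix z assume "z \<in> h ` powers_span A y n"
    then obtain c where c: "\<forall>l<n. c l \<in> A" "z = h (\<Sum>l<n. c l * y ^ l)" unfolding powers_span_def by blast
    then show "z \<in> powers_span (h ` A) (h y) n"
      unfolding powers_span_def by (intro CollectI exI[of _ "\<lambda>l. h (c l)"]) (simp add: eq)
  next
    fix z assume "z \<in> powers_span (h ` A) (h y) n"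
    then obtain c where c: "\<forall>l<n. c l \<in> h ` A" "z = (\<Sum>l<n. c l * h y ^ l)" unfolding powers_span_def by blast
    define d where "d l = (SOME a. a \<in> A \<and> h a = c l)" for l
    have d: "d l \<in> A \<and> h (d l) = c l" if l: "l < n" for l
    proof -
      obtain a where "a \<in> A \<and> h a = c l" using c(1) l by (metis imageE)
      then show ?thesis unfolding d_def by (rule someI)
    qed
    have "z = h (\<Sum>l<n. d l * y ^ l)" using c(2) d eq[of n d] by simp
    moreover have "(\<Sum>l<n. d l * y ^ l) \<in> powers_span A y n" unfolding powers_span_def using d by blast
    ultimately show "z \<in> h ` powers_span A y n" by blast
  qed
qed

context dvr_set
begin

text \<open>The surrounding field may exceed the field of fractions of \<open>A\<close>; the element
  \<open>c\<close> certifies that \<open>w\<close> is a fraction. If \<open>w\<close> had negative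
  valuation, the term \<open>w ^ n\<close> would dominate the equation.\<close>

lemma integrally_closed:
  assumes n: "n > 0" and w: "c \<in> A" "c \<noteq> 0" "c * w \<in> A"
    and a: "\<And>l. l < n \<Longrightarrow> a l \<in> A" and eq: "w ^ n + (\<Sum>l<n. a l * w ^ l) = 0"
  shows "w \<in> A"
proof (rule ccontr)
  assume not: "w \<notin> A"
  then have "w \<noteq> 0" using A_closed(2) by blast
  from unit_decomposition[OF w(1,2)] obtain N u where u: "unit_in u" "c = u * t ^ N" .
  have "c * w \<noteq> 0" using w(2) \<open>w \<noteq> 0\<close> by simp
  from unit_decomposition[OF w(3) this] obtain M u' where u': "unit_in u'" "c * w = u' * t ^ M" .
  define v where "v = inverse u * u'"
  have v: "unit_in v" unfolding v_def by (intro unit_in_mult unit_in_inverse u(1) u'(1))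
  have u0: "u \<noteq> 0" using u(1) unfolding unit_in_def by simp
  have wv: "w * t ^ N = v * t ^ M" unfolding v_def using u u'(2) u0 by (simp add: field_simps)
  then have w_eq: "w = v * t ^ M / t ^ N" using t(2) by (simp add: field_simps)
  have MN: "M < N"
  proof (rule ccontr)
    assume "\<not> M < N"
    then show False using not unit_power_div_iff[OF v, of M N] unfolding w_eq by simp
  qed
  define k where "k = N - M"
  have k: "k > 0" "N = k + M" unfolding k_def using MN by auto
  have wk: "w * t ^ k = v"
    unfolding w_eq k(2) power_add using t(2) by simp
  have vA: "v \<in> A" using v unfolding unit_in_def by simp
  \<comment> \<open>Multiplication by \<open>(t ^ k) ^ n\<close> replaces \<open>w\<close> by the
    unit \<open>v\<close>, and every term except \<open>v ^ n\<close> keeps a factor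
    \<open>t\<close>.\<close>
  have "0 = (w ^ n + (\<Sum>l<n. a l * w ^ l)) * (t ^ k) ^ n" unfolding eq by simp
  also have "\<dots> = v ^ n + (\<Sum>l<n. a l * w ^ l * (t ^ k) ^ n)"
    unfolding distrib_right sum_distrib_right wk[symmetric] by (simp add: power_mult_distrib)
  also have "(\<Sum>l<n. a l * w ^ l * (t ^ k) ^ n) = (\<Sum>l<n. a l * v ^ l * (t ^ k) ^ (n - l))"
  proof (rule sum.cong)
    fix l assume "l \<in> {..<n}"
    then have "(t ^ k) ^ n = (t ^ k) ^ l * (t ^ k) ^ (n - l)" by (simp add: power_add[symmetric])
    then show "a l * w ^ l * (t ^ k) ^ n = a l * v ^ l * (t ^ k) ^ (n - l)"
      unfolding wk[symmetric] by (simp add: power_mult_distrib mult_ac)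
  qed simp
  finally have vn: "v ^ n = - (\<Sum>l<n. a l * v ^ l * (t ^ k) ^ (n - l))" by (simp add: eq_neg_iff_add_eq_0)
  have "(\<Sum>l<n. a l * v ^ l * (t ^ k) ^ (n - l)) / t ^ 1 \<in> A"
  proof (rule div_t_sum)
    fix l assume l: "l \<in> {..<n}"
    have "1 \<le> k * (n - l)" using k(1) l by simp
    then have "t ^ (k * (n - l)) / t ^ 1 \<in> A" using unit_power_div_iff[OF unit_in_1, of "k * (n - l)" 1] by simp
    then show "a l * v ^ l * (t ^ k) ^ (n - l) / t ^ 1 \<in> A"
      unfolding power_mult[symmetric] using a l A_closed(7)[OF vA]
      by (intro div_t_mult A_closed(4)) auto
  qed
  then have "v ^ n / t \<in> A" unfolding vn using A_closed(5) by fastforce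
  then show False using unit_not_div_t[OF unit_in_power[OF v]] by blast
qed

end

text \<open>One step from the abstract tensor product to its fraction field. It is used for
  \<open>K\<close> with the first root and \<open>R\<close>, and again for the field of the first
  root with the second root and the first normalization.\<close>

locale tensor_root =
  fixes K :: "'k::field set" and y :: 'k and p :: nat and R :: "'r ring" and \<phi> :: "'k \<Rightarrow> 'r"
    and i :: "'r \<Rightarrow> 't::idom" and j :: "'k \<Rightarrow> 't"
  assumes p: "Factorial_Ring.prime p" "CHAR('k) = p" and K: "subfield_set K"
    and y: "y ^ p \<in> K" "y \<notin> K"
    and R: "cring R" "\<phi> \<in> ring_hom (ring_on K) R"
    and T: "is_tensor_product (ring_on K) \<phi> R (\<lambda>c. c) (ring_on (powers_span K y p))
      (ring_of_type_algebra :: 't ring) i j"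
begin

definition \<iota> :: "'r \<Rightarrow> 't fract" where "\<iota> = to_fract \<circ> i"
definition \<kappa> :: "'k \<Rightarrow> 't fract" where "\<kappa> = to_fract \<circ> j"

lemmas basis = tensor_product_powers_basis[OF p K y R T]

lemma p0: "p > 0"
  using p(1) prime_gt_0_nat by blast

lemma K_ring: "subring_set K"
  using K unfolding subfield_set_def by simp

lemmas K1 = subring_set_powers_span[OF K_ring y(1) p0]

lemma K1_field: "subfield_set (powers_span K y p)"
  by (rule subfield_set_powers_span[OF K y(1) p])

lemma hom_i: "i \<in> ring_hom R ring_of_type_algebra"
  and hom_j: "j \<in> ring_hom (ring_on (powers_span K y p)) ring_of_type_algebra"
  and agree: "c \<in> K \<Longrightarrow> i (\<phi> c) = j c"
  using T unfolding is_tensor_product_def by auto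

lemma to_fract_hom: "inj_hom_on UNIV (to_fract :: 't \<Rightarrow> 't fract)"
  unfolding inj_hom_on_def by simp

lemma UNIV_ring: "subring_set (UNIV :: 't set)"
  unfolding subring_set_def by simp

lemma \<kappa>_hom: "inj_hom_on (powers_span K y p) \<kappa>"
proof -
  have one: "j 1 = 1" using ring_hom_one[OF hom_j] by simp
  have mult: "j (a * b) = j a * j b" if "a \<in> powers_span K y p" "b \<in> powers_span K y p" for a b
    using ring_hom_mult[OF hom_j, of a b] that by simp
  have add: "j (a + b) = j a + j b" if "a \<in> powers_span K y p" "b \<in> powers_span K y p" for a b
    using ring_hom_add[OF hom_j, of a b] that by simp
  have diff: "j (a - b) = j a - j b" if "a \<in> powers_span K y p" "b \<in> powers_span K y p" for a b
    using add[OF subring_set_diff[OF K1(1) that] that(2)] by (simp add: algebra_simps)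
  have ker: "a = 0" if "a \<in> powers_span K y p" "j a = 0" for a
  proof (rule ccontr)
    assume "a \<noteq> 0"
    then have "j a * j (inverse a) = j 1"
      using mult[of a "inverse a"] that(1) K1_field unfolding subfield_set_def by simp
    then show False using that(2) one by simp
  qed
  show ?thesis unfolding inj_hom_on_def \<kappa>_def using one mult diff ker by simp
qed

lemma char_fract: "CHAR('t fract) = p"
proof -
  have "\<kappa> (of_nat n) = of_nat n" for n
  proof (induction n)
    case 0
    show ?case using inj_hom_on_0[OF \<kappa>_hom K1(1)] by simp
  next
    case (Suc n)
    then show ?case
      using inj_hom_on_add[OF \<kappa>_hom K1(1) subring_set_1[OF K1(1)] subring_set_of_nat[OF K1(1)], of n]
        inj_hom_on_1[OF \<kappa>_hom K1(1)] by simp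
  qed
  from this[of p] have "of_nat p = (0 :: 't fract)"
    using inj_hom_on_0[OF \<kappa>_hom K1(1)] p(2) of_nat_CHAR[where 'a = 'k] by simp
  then have "CHAR('t fract) dvd p" by (simp add: of_nat_eq_0_iff_char_dvd)
  moreover have "CHAR('t fract) \<noteq> 1"
  proof
    assume "CHAR('t fract) = 1"
    then have "of_nat 1 = (0 :: 't fract)" by (metis of_nat_CHAR)
    then show False by simp
  qed
  ultimately show ?thesis using p(1) by (auto simp: prime_nat_iff)
qed

lemma indep:
  assumes c: "\<And>l. l < p \<Longrightarrow> c l \<in> \<iota> ` carrier R" and z: "(\<Sum>l<p. c l * \<kappa> y ^ l) = 0"
  shows "\<forall>l<p. c l = 0"
proof -
  interpret cring R by (rule R(1))
  define d where "d l = (SOME a. a \<in> carrier R \<and> \<iota> a = c l)" for l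
  have d: "d l \<in> carrier R \<and> \<iota> (d l) = c l" if l: "l < p" for l
  proof -
    obtain a where "a \<in> carrier R \<and> \<iota> a = c l" using c[OF l] by (metis imageE)
    then show ?thesis unfolding d_def by (rule someI)
  qed
  have pw: "to_fract (j y ^ l) = \<kappa> y ^ l" for l unfolding \<kappa>_def by (induction l) simp_all
  have "to_fract (\<Sum>l<p. i (d l) * j y ^ l) = (\<Sum>l<p. \<iota> (d l) * \<kappa> y ^ l)"
    unfolding to_fract_sum to_fract_mult pw \<iota>_def by simp
  also have "\<dots> = 0" using z d by simp
  finally have "(\<Sum>l<p. i (d l) * j y ^ l) = 0" unfolding to_fract_eq_0_iff .
  then have "\<forall>l<p. d l = \<zero>\<^bsub>R\<^esub>" using d by (intro basis(1)) auto
  moreover have "i \<zero>\<^bsub>R\<^esub> = 0"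
  proof -
    have "i \<zero>\<^bsub>R\<^esub> + i \<zero>\<^bsub>R\<^esub> = i \<zero>\<^bsub>R\<^esub>" using ring_hom_add[OF hom_i, of "\<zero>\<^bsub>R\<^esub>" "\<zero>\<^bsub>R\<^esub>"] by simp
    then show ?thesis unfolding add_cancel_left_right .
  qed
  then have "\<iota> \<zero>\<^bsub>R\<^esub> = 0" unfolding \<iota>_def by simp
  ultimately show ?thesis using d by metis
qed

lemma embedding: "field_embedding R \<iota>"
proof -
  interpret cring R by (rule R(1))
  show ?thesis
  proof
    show "\<iota> \<in> ring_hom R ring_of_type_algebra"
      using ring_hom_mult[OF hom_i] ring_hom_add[OF hom_i] ring_hom_one[OF hom_i]
      by (intro ring_hom_memI) (auto simp: \<iota>_def)
    fix a assume a: "a \<in> carrier R" "\<iota> a = 0"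
    then have ia: "i a = 0" unfolding \<iota>_def by simp
    have "i \<zero>\<^bsub>R\<^esub> + i \<zero>\<^bsub>R\<^esub> = i \<zero>\<^bsub>R\<^esub>" using ring_hom_add[OF hom_i, of "\<zero>\<^bsub>R\<^esub>" "\<zero>\<^bsub>R\<^esub>"] by simp
    then have i0: "i \<zero>\<^bsub>R\<^esub> = 0" unfolding add_cancel_left_right .
    have "\<forall>l<p. (if l = 0 then a else \<zero>\<^bsub>R\<^esub>) = \<zero>\<^bsub>R\<^esub>"
      by (rule basis(1)) (use a(1) ia i0 in \<open>auto intro!: sum.neutral\<close>)
    then show "a = \<zero>\<^bsub>R\<^esub>" using p0 by auto
  qed
qed

sublocale field_embedding R \<iota> by (rule embedding)

lemma range_to_fract: "range to_fract = powers_span (\<iota> ` carrier R) (\<kappa> y) p"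
proof -
  have "to_fract ` powers_span (i ` carrier R) (j y) p = powers_span (to_fract ` (i ` carrier R)) (to_fract (j y)) p"
    by (rule image_powers_span[OF to_fract_hom UNIV_ring]) auto
  then show ?thesis unfolding basis(2) \<iota>_def \<kappa>_def by (simp add: image_comp)
qed

lemma \<kappa>_K1: "\<kappa> ` powers_span K y p = powers_span (\<kappa> ` K) (\<kappa> y) p"
  by (rule image_powers_span[OF \<kappa>_hom K1])

lemma \<kappa>_K: "c \<in> K \<Longrightarrow> \<kappa> c = \<iota> (\<phi> c)"
  unfolding \<kappa>_def \<iota>_def by (simp add: agree)

lemma \<phi>_closed: "c \<in> K \<Longrightarrow> \<phi> c \<in> carrier R"
  using ring_hom_closed[OF R(2)] by simp

lemma \<kappa>_K_subset: "\<kappa> ` K \<subseteq> \<iota> ` carrier R"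
  using \<kappa>_K \<phi>_closed by auto

lemma \<kappa>_K_hom: "inj_hom_on K \<kappa>"
  by (rule inj_hom_on_subset[OF \<kappa>_hom K1(2)])

lemma \<kappa>_K_field: "subfield_set (\<kappa> ` K)"
  unfolding subfield_set_def
proof (intro conjI ballI)
  show "subring_set (\<kappa> ` K)" by (rule subring_set_image[OF \<kappa>_K_hom K_ring])
  fix z assume "z \<in> \<kappa> ` K"
  then obtain c where c: "c \<in> K" "z = \<kappa> c" by blast
  have "inverse c \<in> K" using K c(1) unfolding subfield_set_def by blast
  then show "inverse z \<in> \<kappa> ` K"
    unfolding c(2) inj_hom_on_inverse[OF \<kappa>_K_hom K_ring c(1) \<open>inverse c \<in> K\<close>, symmetric] by blast
qed

lemma \<kappa>_y_power: "\<kappa> y ^ p = \<kappa> (y ^ p)" "\<kappa> y ^ p \<in> \<kappa> ` K"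
  using inj_hom_on_power[OF \<kappa>_hom K1(1,3), of p] y(1) by (auto intro: back_subst[of "\<lambda>z. z \<in> \<kappa> ` K"])

lemma \<kappa>_y_power_in: "\<kappa> y ^ p \<in> \<iota> ` carrier R"
  using \<kappa>_y_power(2) \<kappa>_K_subset by blast

text \<open>A denominator from the tensor product can be replaced by its \<open>p\<close>-th power,
  which lies in the image of \<open>R\<close>.\<close>

lemma span: "\<exists>a\<in>\<iota> ` carrier R. a \<noteq> 0 \<and> a * z \<in> powers_span (\<iota> ` carrier R) (\<kappa> y) p"
proof -
  obtain v w where vw: "z = Fract v w" "w \<noteq> 0" by (rule Fract_cases)
  have "to_fract w ^ p \<in> \<iota> ` carrier R"
    by (rule powers_span_power_in[OF subring_set_emb \<kappa>_y_power_in p(1) char_fract])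
       (simp add: range_to_fract[symmetric])
  moreover have "to_fract w ^ p * z = to_fract (w ^ (p - 1) * v)"
  proof -
    have pw: "to_fract w ^ l = to_fract (w ^ l)" for l by (induction l) simp_all
    have "to_fract w ^ p = to_fract w ^ (p - 1) * to_fract w" by (rule power_minus_mult[OF p0, symmetric])
    then show ?thesis using vw unfolding pw by (simp add: Fract_conv_to_fract)
  qed
  ultimately show ?thesis
    unfolding range_to_fract[symmetric] using vw(2)
    by (intro bexI[of _ "to_fract w ^ p"] conjI) (simp_all only: rangeI power_not_zero to_fract_eq_0_iff not_False_eq_True)
qed

text \<open>If \<open>z ^ p\<close> is in the image of \<open>R\<close>, then \<open>z\<close> is a
  root of \<open>X ^ p - a\<close>. Conversely, the \<open>p\<close>-th power of an integral
  equation for \<open>z\<close> is one for \<open>z ^ p\<close>, its coefficients are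
  \<open>p\<close>-th powers and so lie in the image of \<open>R\<close>, and this ring is
  integrally closed.\<close>

lemma normalization_eq:
  assumes "dvr_set (\<iota> ` carrier R) t"
  shows "normalization = {z :: 't fract. z ^ p \<in> \<iota> ` carrier R}"
proof (intro equalityI subsetI)
  interpret A: dvr_set "\<iota> ` carrier R" t by (rule assms)
  fix z :: "'t fract" assume "z \<in> {z. z ^ p \<in> \<iota> ` carrier R}"
  then have "z ^ p \<in> \<iota> ` carrier R" by simp
  then obtain a where a: "z ^ p = to_fract a" unfolding \<iota>_def by auto
  define q where "q = pCons (- a) (Polynomial.monom 1 (p - 1))"
  have "Polynomial.lead_coeff q = 1" unfolding q_def by (simp add: Polynomial.degree_monom_eq)
  moreover have "poly (map_poly to_fract q) z = 0"
  proof -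
    have "poly (map_poly to_fract q) z = z * z ^ (p - 1) - to_fract a"
      unfolding q_def by (simp add: map_poly_pCons map_poly_monom Polynomial.poly_monom)
    also have "z * z ^ (p - 1) = z ^ p" using p0 by (metis mult.commute power_minus_mult)
    finally show ?thesis using a by simp
  qed
  ultimately show "z \<in> normalization" unfolding normalization_def by blast
next
  interpret A: dvr_set "\<iota> ` carrier R" t by (rule assms)
  fix z :: "'t fract" assume "z \<in> normalization"
  then obtain q :: "'t poly" where q: "Polynomial.lead_coeff q = 1" "poly (map_poly to_fract q) z = 0"
    unfolding normalization_def by blast
  define n where "n = Polynomial.degree q"
  have coeff_p: "to_fract w ^ p \<in> \<iota> ` carrier R" for w :: 't
    by (rule powers_span_power_in[OF subring_set_emb \<kappa>_y_power_in p(1) char_fract])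
       (simp add: range_to_fract[symmetric])
  have "Polynomial.degree (map_poly to_fract q) = n" unfolding n_def by (rule degree_map_poly) simp
  then have "0 = (\<Sum>l\<le>n. to_fract (poly.coeff q l) * z ^ l)"
    using q(2) by (simp add: Polynomial.poly_altdef coeff_map_poly)
  then have "0 = (\<Sum>l\<le>n. to_fract (poly.coeff q l) * z ^ l) ^ p" using p0 by (metis zero_power)
  also have "\<dots> = (\<Sum>l\<le>n. to_fract (poly.coeff q l) ^ p * (z ^ p) ^ l)"
    unfolding CHAR_prime_power_sum[OF p(1) char_fract]
    by (simp add: power_mult_distrib power_mult[symmetric] mult.commute)
  also have "\<dots> = (\<Sum>l<n. to_fract (poly.coeff q l) ^ p * (z ^ p) ^ l) + (z ^ p) ^ n"
    using q(1) by (simp add: lessThan_Suc_atMost[symmetric] n_def)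
  finally have eq: "(z ^ p) ^ n + (\<Sum>l<n. to_fract (poly.coeff q l) ^ p * (z ^ p) ^ l) = 0"
    by (simp add: add.commute)
  have n: "n > 0"
  proof (rule ccontr)
    assume "\<not> n > 0"
    then show False using eq by simp
  qed
  obtain c where c: "c \<in> \<iota> ` carrier R" "c \<noteq> 0" "c * z \<in> powers_span (\<iota> ` carrier R) (\<kappa> y) p"
    using span by blast
  have "c ^ p \<in> \<iota> ` carrier R" "c ^ p \<noteq> 0" using c(1,2) A.A_closed(7) by auto
  moreover have "c ^ p * z ^ p \<in> \<iota> ` carrier R"
    using powers_span_power_in[OF subring_set_emb \<kappa>_y_power_in p(1) char_fract c(3)]
    by (simp add: power_mult_distrib)
  ultimately have "z ^ p \<in> \<iota> ` carrier R"
    by (rule A.integrally_closed[OF n _ _ _ coeff_p eq])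
  then show "z \<in> {z. z ^ p \<in> \<iota> ` carrier R}" by simp
qed

lemma step:
  assumes "dvr_set (\<iota> ` carrier R) t"
    and "\<exists>N. \<forall>a\<in>\<iota> ` carrier R. (\<kappa> y ^ p - a ^ p) / t ^ N \<notin> \<iota> ` carrier R"
  shows "inseparable_step (\<iota> ` carrier R) t (\<kappa> ` K) (\<kappa> y) p"
proof -
  interpret A: dvr_set "\<iota> ` carrier R" t by (rule assms(1))
  show ?thesis
    by unfold_locales (fact p(1) char_fract \<kappa>_K_field \<kappa>_K_subset \<kappa>_y_power(2) span assms(2) | erule (1) indep)+
qed

text \<open>Finitely many generators have a common denominator \<open>e\<close> that carries the
  normalization into \<open>T\<close>. If \<open>N\<close> is the valuation of \<open>e\<close>,
  then \<open>(y - a) / t ^ Suc N\<close> cannot be integral, because in \<open>e\<close> times this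
  element the coefficient of \<open>y\<close> would be \<open>e / t ^ Suc N\<close>. Its
  \<open>p\<close>-th power explains the exponent \<open>p * Suc N\<close>.\<close>

lemma bounded_if_finite:
  assumes t: "dvr_set (\<iota> ` carrier R) t"
    and S: "finite S" "\<And>z. z ^ p \<in> \<iota> ` carrier R \<Longrightarrow> \<exists>c. (\<forall>s\<in>S. c s \<in> \<iota> ` carrier R) \<and> z = (\<Sum>s\<in>S. c s * s)"
  shows "\<exists>N. \<forall>a\<in>\<iota> ` carrier R. (\<kappa> y ^ p - a ^ p) / t ^ N \<notin> \<iota> ` carrier R"
proof -
  interpret A: dvr_set "\<iota> ` carrier R" t by (rule t)
  let ?A = "\<iota> ` carrier R" and ?T = "powers_span (\<iota> ` carrier R) (\<kappa> y) p"
  note T = subring_set_powers_span[OF subring_set_emb \<kappa>_y_power_in p0]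
  define f where "f s = (SOME a. a \<in> ?A \<and> a \<noteq> 0 \<and> a * s \<in> ?T)" for s
  have f: "f s \<in> ?A \<and> f s \<noteq> 0 \<and> f s * s \<in> ?T" for s
  proof -
    obtain a where "a \<in> ?A \<and> a \<noteq> 0 \<and> a * s \<in> ?T" using span[of s] by metis
    then show ?thesis unfolding f_def by (rule someI)
  qed
  define e where "e = (\<Prod>s\<in>S. f s)"
  have e: "e \<in> ?A" "e \<noteq> 0"
    unfolding e_def using f S(1) by (auto intro!: subring_set_prod[OF subring_set_emb])
  have eT: "e * z \<in> ?T" if "z ^ p \<in> ?A" for z
  proof -
    obtain c where c: "\<forall>s\<in>S. c s \<in> ?A" "z = (\<Sum>s\<in>S. c s * s)" using S(2)[OF \<open>z ^ p \<in> ?A\<close>] by blast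
    have "e * (c s * s) \<in> ?T" if s: "s \<in> S" for s
    proof -
      have "e = f s * (\<Prod>s\<in>S - {s}. f s)" unfolding e_def by (rule prod.remove[OF S(1) s])
      then have ee: "e * (c s * s) = ((\<Prod>s\<in>S - {s}. f s) * c s) * (f s * s)" by (simp add: mult_ac)
      have "(\<Prod>s\<in>S - {s}. f s) * c s \<in> ?T"
        using f c(1) s T(2) by (intro subring_set_mult[OF T(1)] subring_set_prod[OF T(1)]) auto
      moreover have "f s * s \<in> ?T" using f by blast
      ultimately show ?thesis unfolding ee by (rule subring_set_mult[OF T(1)])
    qed
    then show ?thesis unfolding c(2) sum_distrib_left by (intro subring_set_sum[OF T(1)])
  qed
  from A.unit_decomposition[OF e] obtain N u where u: "A.unit_in u" "e = u * t ^ N" .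
  have "(\<kappa> y ^ p - a ^ p) / t ^ (p * Suc N) \<notin> ?A" if a: "a \<in> ?A" for a
  proof
    assume *: "(\<kappa> y ^ p - a ^ p) / t ^ (p * Suc N) \<in> ?A"
    define z where "z = (\<kappa> y - a) / t ^ Suc N"
    have "z ^ p = (\<kappa> y ^ p - a ^ p) / t ^ (p * Suc N)"
      unfolding z_def power_divide CHAR_prime_power_diff[OF p(1) char_fract]
      by (simp only: power_mult[symmetric] mult.commute)
    then have "e * z \<in> ?T" using eT[of z] * by simp
    then obtain c where c: "\<forall>l<p. c l \<in> ?A" "e * z = (\<Sum>l<p. c l * \<kappa> y ^ l)" unfolding powers_span_def by blast
    \<comment> \<open>The equation \<open>e * (\<kappa> y - a) = t ^ Suc N * (e * z)\<close> as a
      relation between powers of the root; its coefficient at index 1 is the one that gives the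
      contradiction.\<close>
    define d where "d l = t ^ Suc N * c l + (if l = 0 then e * a else if l = 1 then - e else 0)" for l
    have p1: "1 < p" using p(1) prime_gt_1_nat by blast
    have "(\<Sum>l<p. (if l = 0 then e * a else if l = 1 then - e else 0) * \<kappa> y ^ l) =
        (\<Sum>l\<in>{0, 1}. (if l = 0 then e * a else if l = 1 then - e else 0) * \<kappa> y ^ l)"
      using p1 by (intro sum.mono_neutral_right) auto
    also have "\<dots> = e * a - e * \<kappa> y" by simp
    finally have "(\<Sum>l<p. d l * \<kappa> y ^ l) = t ^ Suc N * (e * z) + (e * a - e * \<kappa> y)"
      unfolding d_def c(2) distrib_right sum.distrib sum_distrib_left by (simp only: mult.assoc)
    also have "t ^ Suc N * (e * z) = e * (\<kappa> y - a)" unfolding z_def using A.t(2) by simp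
    finally have "(\<Sum>l<p. d l * \<kappa> y ^ l) = 0" by (simp add: algebra_simps)
    moreover have "d l \<in> ?A" if l: "l < p" for l
      unfolding d_def using c(1) l e(1) a A.t_power_in[of "Suc N"] A.A_closed(2) A.A_closed(4) A.A_closed(5)
      by (intro A.A_closed(6)) auto
    ultimately have "\<forall>l<p. d l = 0" by (intro indep)
    then have "d 1 = 0" using p1 by blast
    then have "e / t ^ Suc N = c 1" unfolding d_def using A.t(2) by (simp add: field_simps)
    also have "\<dots> \<in> ?A" using c(1) p1 by blast
    finally show False unfolding u(2) A.unit_power_div_iff[OF u(1)] by simp
  qed
  then show ?thesis by blast
qed

end

section \<open>Residue fields\<close>

lemma carrier_residue_field: "carrier (residue_field R) = residue R ` carrier R"
  unfolding residue_field_def residue_def[abs_def] FactRing_def A_RCOSETS_def' by auto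

lemma residue_hom:
  assumes "cring R" "maximalideal (max_ideal R) R"
  shows "ring_hom_cring R (residue_field R) (residue R)" "field (residue_field R)"
    and "\<And>a b. a \<in> carrier R \<Longrightarrow> b \<in> carrier R \<Longrightarrow> residue R a = residue R b \<longleftrightarrow> a \<ominus>\<^bsub>R\<^esub> b \<in> max_ideal R"
proof -
  interpret cring R by (rule assms(1))
  interpret maximalideal "max_ideal R" R by (rule assms(2))
  have id: "ideal (max_ideal R) R" by (rule is_ideal)
  show "ring_hom_cring R (residue_field R) (residue R)"
    unfolding residue_field_def residue_def[abs_def] by (rule ideal.rcos_ring_hom_cring[OF id assms(1)])
  show "field (residue_field R)" unfolding residue_field_def by (rule quotient_is_field[OF assms(1)])
  show "residue R a = residue R b \<longleftrightarrow> a \<ominus>\<^bsub>R\<^esub> b \<in> max_ideal R" if "a \<in> carrier R" "b \<in> carrier R" for a b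
    unfolding residue_def using quotient_eq_iff_same_a_r_cos[OF id that] by simp
qed

text \<open>Lifts of finitely many generators of the residue field span the ring modulo its maximal
  ideal.\<close>

lemma (in field_embedding) residue_dimension_exists:
  fixes \<phi> :: "'k::comm_ring_1 \<Rightarrow> 'r"
  assumes max: "maximalideal (max_ideal R) R" and t: "dvr_set (\<iota> ` carrier R) t"
    and mem: "\<And>a. a \<in> carrier R \<Longrightarrow> a \<in> max_ideal R \<longleftrightarrow> \<iota> a / t \<in> \<iota> ` carrier R"
    and \<phi>: "\<And>c. c \<in> K \<Longrightarrow> \<phi> c \<in> carrier R" and k: "subring_set ((\<lambda>c. \<iota> (\<phi> c)) ` K)"
    and fin: "finite_over (residue R \<circ> \<phi>) (ring_on K) (residue_field R)"
  shows "\<exists>d. qdim ((\<lambda>c. \<iota> (\<phi> c)) ` K) (\<iota> ` carrier R) (dvr_set.t_ideal (\<iota> ` carrier R) t 1) d"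
proof -
  interpret A: dvr_set "\<iota> ` carrier R" t by (rule t)
  interpret \<rho>: ring_hom_cring R "residue_field R" "residue R" by (rule residue_hom(1)[OF is_cring max])
  note res_eq = residue_hom(3)[OF is_cring max]
  let ?k = "(\<lambda>c. \<iota> (\<phi> c)) ` K"
  have kA: "?k \<subseteq> \<iota> ` carrier R" using \<phi> by auto
  obtain S where S: "finite S" "S \<subseteq> carrier (residue_field R)"
    "\<And>b. b \<in> carrier (residue_field R) \<Longrightarrow> \<exists>c\<in>S \<rightarrow> K. b = (\<Oplus>\<^bsub>residue_field R\<^esub>s\<in>S. residue R (\<phi> (c s)) \<otimes>\<^bsub>residue_field R\<^esub> s)"
    using fin unfolding finite_over_def by auto
  define r where "r s = (SOME a. a \<in> carrier R \<and> residue R a = s)" for s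
  have r: "r s \<in> carrier R \<and> residue R (r s) = s" if s: "s \<in> S" for s
  proof -
    obtain a where "a \<in> carrier R \<and> residue R a = s"
      using S(2) s unfolding carrier_residue_field by blast
    then show ?thesis unfolding r_def by (rule someI)
  qed
  have sub: "subspace_over ?k (A.t_ideal 1)" using A.subspace_t_ideal kA unfolding subspace_over_def by blast
  have sA: "subspace_over ?k (\<iota> ` carrier R)"
    unfolding subspace_over_def
    by (intro conjI ballI A.A_closed(2) A.A_closed(6) A.A_closed(4)) (use kA in blast)+
  obtain d V where V: "qdim ?k V (A.t_ideal 1) d" "(\<iota> \<circ> r) ` S \<subseteq> V"
    "\<And>U. subspace_over ?k U \<Longrightarrow> A.t_ideal 1 \<subseteq> U \<Longrightarrow> (\<iota> \<circ> r) ` S \<subseteq> U \<Longrightarrow> V \<subseteq> U"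
    using qdim_exists_span[OF k sub, of "(\<iota> \<circ> r) ` S"] S(1) by blast
  have Vs: "subspace_over ?k V" by (rule qdim_subspace[OF V(1) k sub])
  have "V = \<iota> ` carrier R"
  proof (intro equalityI subsetI)
    have "V \<subseteq> \<iota> ` carrier R" by (rule V(3)[OF sA A.t_ideal_subset]) (use r in auto)
    then show "z \<in> \<iota> ` carrier R" if "z \<in> V" for z using that by blast
    fix z assume "z \<in> \<iota> ` carrier R"
    then obtain a where a: "a \<in> carrier R" "z = \<iota> a" by blast
    have "residue R a \<in> carrier (residue_field R)" using a(1) unfolding carrier_residue_field by blast
    from S(3)[OF this] obtain c where c: "c \<in> S \<rightarrow> K"
      "residue R a = (\<Oplus>\<^bsub>residue_field R\<^esub>s\<in>S. residue R (\<phi> (c s)) \<otimes>\<^bsub>residue_field R\<^esub> s)" by blast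
    have cr: "(\<lambda>s. \<phi> (c s) \<otimes> r s) \<in> S \<rightarrow> carrier R" using c(1) \<phi> r by (auto intro!: m_closed)
    have "residue R (\<Oplus>s\<in>S. \<phi> (c s) \<otimes> r s) = (\<Oplus>\<^bsub>residue_field R\<^esub>s\<in>S. residue R (\<phi> (c s) \<otimes> r s))"
      using \<rho>.hom_finsum[OF cr] by (simp add: comp_def)
    also have "\<dots> = (\<Oplus>\<^bsub>residue_field R\<^esub>s\<in>S. residue R (\<phi> (c s)) \<otimes>\<^bsub>residue_field R\<^esub> s)"
    proof (rule \<rho>.S.finsum_cong')
      fix s assume s: "s \<in> S"
      then have "\<phi> (c s) \<in> carrier R" using c(1) \<phi> by blast
      then show "residue R (\<phi> (c s) \<otimes> r s) = residue R (\<phi> (c s)) \<otimes>\<^bsub>residue_field R\<^esub> s"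
        using \<rho>.hom_mult[of "\<phi> (c s)" "r s"] r[OF s] by simp
    qed (use c(1) \<phi> S(2) in \<open>auto intro!: \<rho>.S.m_closed \<rho>.hom_closed\<close>)
    finally have "residue R a = residue R (\<Oplus>s\<in>S. \<phi> (c s) \<otimes> r s)" using c(2) by simp
    moreover have scl: "(\<Oplus>s\<in>S. \<phi> (c s) \<otimes> r s) \<in> carrier R" using cr by (rule finsum_closed)
    ultimately have "a \<ominus> (\<Oplus>s\<in>S. \<phi> (c s) \<otimes> r s) \<in> max_ideal R" using res_eq[OF a(1)] by simp
    then have "\<iota> (a \<ominus> (\<Oplus>s\<in>S. \<phi> (c s) \<otimes> r s)) \<in> A.t_ideal 1"
      using mem[of "a \<ominus> (\<Oplus>s\<in>S. \<phi> (c s) \<otimes> r s)"] a(1) scl unfolding A.t_ideal_def by simp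
    then have "\<iota> a - \<iota> (\<Oplus>s\<in>S. \<phi> (c s) \<otimes> r s) \<in> V"
      unfolding emb_minus[OF a(1) scl] using qdim_subset[OF V(1) k] by blast
    moreover have "\<iota> (\<Oplus>s\<in>S. \<phi> (c s) \<otimes> r s) = (\<Sum>s\<in>S. \<iota> (\<phi> (c s)) * \<iota> (r s))"
      unfolding emb_finsum[OF cr] using c(1) \<phi> r by (intro sum.cong refl emb_mult) auto
    moreover have "(\<Sum>s\<in>S. \<iota> (\<phi> (c s)) * \<iota> (r s)) \<in> V"
      using c(1) V(2) by (intro subspace_over_sum[OF Vs] subspace_over_scale[OF Vs]) auto
    ultimately show "z \<in> V" using subspace_over_add[OF Vs, of "\<iota> a - \<iota> (\<Oplus>s\<in>S. \<phi> (c s) \<otimes> r s)"] a(2) by fastforce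
  qed
  then show ?thesis using V(1) by blast
qed

text \<open>As \<open>n\<close>-th powers lie in \<open>A0\<close>, a unit \<open>z\<close> has the
  inverse \<open>z ^ (n - 1) * inverse (z ^ n)\<close>, whose last factor is in \<open>A0\<close>.
  So the polynomials in \<alpha> over \<open>A0\<close> already give a field modulo
  \<open>t\<close>, and the generated field consists of their classes.\<close>

lemma (in dvr_set) simple_residue_field_generator:
  assumes A0: "subring_set A0" "A0 \<subseteq> A" and pw: "n > 0" "\<And>z. z \<in> A \<Longrightarrow> z ^ n \<in> A0"
    and inv: "\<And>a. a \<in> A0 \<Longrightarrow> a / t \<notin> A \<Longrightarrow> inverse a \<in> A0"
    and simple: "simple_field_extension (residue_field (ring_on A)) (residue (ring_on A) ` A0)"
  shows "\<exists>\<alpha>\<in>A. \<forall>w\<in>A. \<exists>f. coeffs_in A0 f \<and> (w - poly f \<alpha>) / t \<in> A"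
proof -
  let ?R = "ring_on A" and ?L = "residue_field (ring_on A)" and ?\<rho> = "residue (ring_on A)"
  have cR: "cring ?R" by (rule cring_ring_on[OF A])
  have max: "maximalideal (max_ideal ?R) ?R" using max_ideal_ring_on by simp
  interpret \<rho>: ring_hom_cring ?R ?L ?\<rho> by (rule residue_hom(1)[OF cR max])
  interpret L: field ?L by (rule residue_hom(2)[OF cR max])
  have eq_iff: "?\<rho> a = ?\<rho> b \<longleftrightarrow> (a - b) / t \<in> A" if "a \<in> A" "b \<in> A" for a b
  proof -
    have "a \<ominus>\<^bsub>?R\<^esub> b = a - b" using a_inv_ring_on[OF A that(2)] unfolding a_minus_def by simp
    then show ?thesis using residue_hom(3)[OF cR max, of a b] that unfolding max_ideal_ring_on t_ideal_def by simp
  qed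
  obtain Xa where Xa: "Xa \<in> carrier ?L" "generate_field ?L (insert Xa (?\<rho> ` A0)) = carrier ?L"
    using simple unfolding simple_field_extension_def by blast
  obtain \<alpha> where \<alpha>: "\<alpha> \<in> A" "Xa = ?\<rho> \<alpha>" using Xa(1) unfolding carrier_residue_field by auto
  have pA: "poly f \<alpha> \<in> A" if "coeffs_in A0 f" for f
    using that A0(2) by (intro poly_in[OF A _ \<alpha>(1)]) (auto simp: coeffs_in_def)
  have gen: "\<exists>f. coeffs_in A0 f \<and> Y = ?\<rho> (poly f \<alpha>)" if "Y \<in> generate_field ?L (insert Xa (?\<rho> ` A0))" for Y
    using that
  proof (induction rule: generate_field.induct)
    case one
    have "?\<rho> 1 = \<one>\<^bsub>?L\<^esub>" using \<rho>.hom_one by simp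
    then show ?case using coeffs_in_const[OF A0(1) subring_set_1[OF A0(1)]] by (intro exI[of _ "[:1:]"]) simp
  next
    case (incl Y)
    then show ?case
    proof
      assume "Y = Xa"
      then show ?thesis
        using \<alpha>(2) coeffs_in_linear[OF A0(1) subring_set_0[OF A0(1)]] by (intro exI[of _ "[:0, 1:]"]) simp
    next
      assume "Y \<in> ?\<rho> ` A0"
      then obtain a where "a \<in> A0" "Y = ?\<rho> a" by blast
      then show ?thesis using coeffs_in_const[OF A0(1)] by (intro exI[of _ "[:a:]"]) simp
    qed
  next
    case (a_inv Y)
    then obtain f where f: "coeffs_in A0 f" "Y = ?\<rho> (poly f \<alpha>)" by blast
    have "\<ominus>\<^bsub>?L\<^esub> Y = ?\<rho> (poly (- f) \<alpha>)"
      using \<rho>.hom_a_inv[of "poly f \<alpha>"] a_inv_ring_on[OF A pA[OF f(1)]] pA[OF f(1)] f(2) by simp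
    moreover have "coeffs_in A0 (- f)" using f(1) subring_set_uminus[OF A0(1)] unfolding coeffs_in_def by simp
    ultimately show ?case by blast
  next
    case (m_inv Y)
    then obtain f where f: "coeffs_in A0 f" "Y = ?\<rho> (poly f \<alpha>)" by blast
    define z where "z = poly f \<alpha>"
    have z: "z \<in> A" unfolding z_def by (rule pA[OF f(1)])
    have "?\<rho> 0 = \<zero>\<^bsub>?L\<^esub>" using \<rho>.hom_zero by simp
    then have "z / t \<notin> A" using eq_iff[OF z A_closed(2)] m_inv.hyps(2) f(2) unfolding z_def by simp
    then have zu: "unit_in z" using unit_iff_not_div_t[OF z] by simp
    define g where "g = f ^ (n - 1) * [:inverse (z ^ n):]"
    have "inverse (z ^ n) \<in> A0" by (rule inv[OF pw(2)[OF z] unit_not_div_t[OF unit_in_power[OF zu]]])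
    then have g: "coeffs_in A0 g" unfolding g_def
      by (intro coeffs_in_mult coeffs_in_power coeffs_in_const A0 f)
    have z0: "z \<noteq> 0" using zu unfolding unit_in_def by simp
    have "z * poly g \<alpha> = z * z ^ (n - 1) * inverse (z ^ n)"
      unfolding g_def z_def by (simp add: poly_power mult.assoc)
    also have "z * z ^ (n - 1) = z ^ n" using power_minus_mult[OF pw(1), of z] by (simp add: mult.commute)
    finally have zg: "z * poly g \<alpha> = 1" using z0 by simp
    have "?\<rho> z \<otimes>\<^bsub>?L\<^esub> ?\<rho> (poly g \<alpha>) = \<one>\<^bsub>?L\<^esub>"
      using \<rho>.hom_mult[of z "poly g \<alpha>"] \<rho>.hom_one z pA[OF g] zg by simp
    moreover have cl: "?\<rho> z \<in> carrier ?L" "?\<rho> (poly g \<alpha>) \<in> carrier ?L"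
      using \<rho>.hom_closed z pA[OF g] by auto
    ultimately have "?\<rho> (poly g \<alpha>) = inv\<^bsub>?L\<^esub> (?\<rho> z)"
      by (intro \<rho>.S.inv_unique') (auto simp: \<rho>.S.m_comm)
    then show ?case using g f(2) unfolding z_def by metis
  next
    case (eng_add Y Z)
    then obtain f g where fg: "coeffs_in A0 f" "Y = ?\<rho> (poly f \<alpha>)" "coeffs_in A0 g" "Z = ?\<rho> (poly g \<alpha>)" by blast
    have "Y \<oplus>\<^bsub>?L\<^esub> Z = ?\<rho> (poly (f + g) \<alpha>)"
      using \<rho>.hom_add[of "poly f \<alpha>" "poly g \<alpha>"] pA fg by simp
    then show ?case using coeffs_in_add[OF A0(1) fg(1,3)] by blast
  next
    case (eng_mult Y Z)
    then obtain f g where fg: "coeffs_in A0 f" "Y = ?\<rho> (poly f \<alpha>)" "coeffs_in A0 g" "Z = ?\<rho> (poly g \<alpha>)" by blast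
    have "Y \<otimes>\<^bsub>?L\<^esub> Z = ?\<rho> (poly (f * g) \<alpha>)"
      using \<rho>.hom_mult[of "poly f \<alpha>" "poly g \<alpha>"] pA fg by simp
    then show ?case using coeffs_in_mult[OF A0(1) fg(1,3)] by blast
  qed
  have "\<exists>f. coeffs_in A0 f \<and> (w - poly f \<alpha>) / t \<in> A" if w: "w \<in> A" for w
  proof -
    have "?\<rho> w \<in> carrier ?L" using \<rho>.hom_closed w by simp
    then obtain f where "coeffs_in A0 f" "?\<rho> w = ?\<rho> (poly f \<alpha>)" using gen Xa(2) by blast
    then show ?thesis using eq_iff[OF w pA] by blast
  qed
  then show ?thesis using \<alpha>(1) by blast
qed

section \<open>Passage from the tensor products to the two steps\<close>

theorem theorem5p13:
  fixes K :: "'k::field set" and x :: 'k and y :: "nat \<Rightarrow> 'k" and p :: nat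
    and Kn :: "nat \<Rightarrow> 'k ring" and Kinf :: "'k ring"
    and R :: "'r ring" and \<phi> :: "'k \<Rightarrow> 'r"
    and Tinf :: "'s ring" and i :: "'r \<Rightarrow> 's" and j :: "'k \<Rightarrow> 's"
    and i\<^sub>1 :: "'r \<Rightarrow> 't::idom" and j\<^sub>1 :: "'k \<Rightarrow> 't"
    and R\<^sub>1 :: "'t fract ring" and \<iota>\<^sub>1 :: "'r \<Rightarrow> 't fract" and \<kappa>\<^sub>1 :: "'k \<Rightarrow> 't fract"
    and i\<^sub>2 :: "'t fract \<Rightarrow> 'u::idom" and j\<^sub>2 :: "'k \<Rightarrow> 'u"
    and R\<^sub>2 :: "'u fract ring" and \<iota>\<^sub>2 :: "'t fract \<Rightarrow> 'u fract" and \<kappa>\<^sub>2 :: "'k \<Rightarrow> 'u fract"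
    and L :: "'r set ring" and L\<^sub>1 :: "'t fract set ring" and L\<^sub>2 :: "'u fract set ring"
    and e\<^sub>1 e\<^sub>2 :: nat and g\<^sub>1\<^sub>0 g\<^sub>2\<^sub>1 :: enat
  assumes K: "subfield K ring_of_type_algebra"
    and char: "CHAR('k) = p" "p > 0"
    and x: "x \<in> K - {z ^ p | z. z \<in> K}"
    \<comment> \<open>\<open>y n\<close> is the (unique) \<open>p^n\<close>-th root of \<open>x\<close> in an ambient field\<close>
    and y: "\<And>n. y n ^ (p ^ n) = x"
    and Kn_eq: "\<And>n. Kn n = ring_on (generate_field ring_of_type_algebra (insert (y n) K))"
    and Kinf_eq: "Kinf = ring_on (\<Union>n\<in>{1..}. carrier (Kn n))"
    and R: "discrete_valuation_ring R" "\<phi> \<in> ring_hom (ring_on K) R"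
    and Tinf: "is_tensor_product (ring_on K) \<phi> R (\<lambda>c. c) Kinf Tinf i j" "domain Tinf"
    \<comment> \<open>\<open>'t\<close> is the tensor product of \<open>R\<close> and \<open>K(y 1)\<close> over \<open>K\<close>\<close>
    and T1: "is_tensor_product (ring_on K) \<phi> R (\<lambda>c. c) (Kn 1)
               (ring_of_type_algebra :: 't ring) i\<^sub>1 j\<^sub>1"
    and R1_eq: "R\<^sub>1 = ring_on normalization"
    and maps1: "\<iota>\<^sub>1 = to_fract \<circ> i\<^sub>1" "\<kappa>\<^sub>1 = to_fract \<circ> j\<^sub>1"
    and R1_finite: "finite_over \<iota>\<^sub>1 R R\<^sub>1"
    \<comment> \<open>\<open>'u\<close> is the tensor product of \<open>R\<^sub>1\<close> and \<open>K(y 2)\<close> over \<open>K(y 1)\<close>\<close>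
    and T2: "is_tensor_product (Kn 1) \<kappa>\<^sub>1 R\<^sub>1 (\<lambda>c. c) (Kn 2)
               (ring_of_type_algebra :: 'u ring) i\<^sub>2 j\<^sub>2"
    and R2_eq: "R\<^sub>2 = ring_on normalization"
    and maps2: "\<iota>\<^sub>2 = to_fract \<circ> i\<^sub>2" "\<kappa>\<^sub>2 = to_fract \<circ> j\<^sub>2"
    and L_eq: "L = residue_field R" "L\<^sub>1 = residue_field R\<^sub>1" "L\<^sub>2 = residue_field R\<^sub>2"
    and root_L: "\<exists>z\<in>carrier L. z [^]\<^bsub>L\<^esub> p = residue R (\<phi> x)"
    and root_L1: "\<exists>z\<in>carrier L\<^sub>1. z [^]\<^bsub>L\<^sub>1\<^esub> (p ^ 2) = residue R\<^sub>1 (\<iota>\<^sub>1 (\<phi> x))"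
    and L_finite: "finite_over (residue R \<circ> \<phi>) (ring_on K) L"
    and e1: "e\<^sub>1 = ramification_index \<iota>\<^sub>1 R R\<^sub>1"
    and e2: "e\<^sub>2 = ramification_index \<iota>\<^sub>2 R\<^sub>1 R\<^sub>2"
    and g10: "g\<^sub>1\<^sub>0 = quotient_dim \<kappa>\<^sub>1 (Kn 1) R\<^sub>1 (range to_fract)"
    and g21: "g\<^sub>2\<^sub>1 = quotient_dim \<kappa>\<^sub>2 (Kn 2) R\<^sub>2 (range to_fract)"
  shows "(e\<^sub>1 = p \<and> e\<^sub>2 = p \<longrightarrow> enat p * g\<^sub>2\<^sub>1 = g\<^sub>1\<^sub>0) \<and>
    (e\<^sub>1 = p \<and> e\<^sub>2 = 1 \<longrightarrow> enat p * g\<^sub>2\<^sub>1 \<le> g\<^sub>1\<^sub>0) \<and>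
    (e\<^sub>1 = 1 \<and> e\<^sub>2 = 1 \<longrightarrow> enat p * g\<^sub>2\<^sub>1 \<le> g\<^sub>1\<^sub>0 \<and>
       (simple_field_extension L\<^sub>2 ((\<lambda>r. residue R\<^sub>2 (\<iota>\<^sub>2 (\<iota>\<^sub>1 r))) ` carrier R)
          \<longrightarrow> enat p * g\<^sub>2\<^sub>1 = g\<^sub>1\<^sub>0)) \<and>
    (e\<^sub>1 = 1 \<and> e\<^sub>2 = p \<longrightarrow> enat p * g\<^sub>2\<^sub>1 + enat (p * (p - 1) div 2) \<le> g\<^sub>1\<^sub>0)"
proof -
  have prime: "Factorial_Ring.prime p"
    using prime_CHAR_semidom[where ?'a = 'k] char by simp
  have p0: "p > 0" and p1: "p > 1" using prime prime_gt_0_nat prime_gt_1_nat by blast+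
  have Kf: "subfield_set K"
  proof -
    interpret Fld: field "ring_of_type_algebra :: 'k ring" by (rule field_from_type_algebra)
    note sub = subringE[OF subfieldE(1)[OF K]]
    have ring: "subring_set K"
      unfolding subring_set_def
    proof (intro conjI ballI)
      show "1 \<in> K" using sub(3) by simp
      fix a b assume ab: "a \<in> K" "b \<in> K"
      have "a + - b \<in> K" using sub(7)[OF ab(1) sub(5)[OF ab(2)]] by (simp add: field_of_type_algebra_inv(1))
      then show "a - b \<in> K" by simp
      show "a * b \<in> K" using sub(6)[OF ab] by simp
    qed
    have "inverse a \<in> K" if "a \<in> K" for a
    proof (cases "a = 0")
      case False
      then have "inv\<^bsub>ring_of_type_algebra\<^esub> a \<in> K" using Fld.subfield_m_inv(1)[OF K, of a] that by simp
      then show ?thesis using field_of_type_algebra_inv(2)[OF False] by simp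
    qed (use that in simp)
    with ring show ?thesis unfolding subfield_set_def by simp
  qed
  then have Kr: "subring_set K" unfolding subfield_set_def by simp
  have y1p: "y 1 ^ p = x" using y[of 1] by simp
  have y1: "y 1 ^ p \<in> K" "y 1 \<notin> K" using x y1p by auto
  define K1 where "K1 = powers_span K (y 1) p"
  note K1 = subring_set_powers_span[OF Kr y1(1) p0, folded K1_def]
  have K1f: "subfield_set K1" unfolding K1_def by (rule subfield_set_powers_span[OF Kf y1(1) prime char(1)])
  have gen1: "generate_field ring_of_type_algebra (insert (y 1) K) = K1"
    unfolding K1_def
    by (rule generate_field_eq_powers_span[OF prime char(1) Kf order_refl _ y1(1)]) (auto intro: generate_field.incl)
  \<comment> \<open>A \<open>p\<close>-th root is unique in characteristic \<open>p\<close>, so the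
    chosen roots of \<open>x\<close> are compatible.\<close>
  have y2p: "y 2 ^ p = y 1"
  proof -
    have "y 2 ^ (p * p) = y 1 ^ p" using y[of 2] y1p by (simp add: power2_eq_square)
    then have "(y 2 ^ p - y 1) ^ p = 0"
      unfolding CHAR_prime_power_diff[OF prime char(1)] by (simp add: power_mult)
    then show ?thesis by simp
  qed
  have y2: "y 2 ^ p \<in> K1" "y 2 \<notin> K1"
  proof -
    show "y 2 ^ p \<in> K1" unfolding y2p by (rule K1(3))
    \<comment> \<open>The \<open>p\<close>-th powers of elements of \<open>K1\<close> lie in
      \<open>K\<close>, whereas \<open>y 2 ^ p = y 1\<close> does not.\<close>
    show "y 2 \<notin> K1"
      using powers_span_power_in[OF Kr y1(1) prime char(1), of "y 2"] y1(2) y2p unfolding K1_def by auto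
  qed
  define K2 where "K2 = powers_span K1 (y 2) p"
  have gen2: "generate_field ring_of_type_algebra (insert (y 2) K) = K2"
    unfolding K2_def
  proof (rule generate_field_eq_powers_span[OF prime char(1) K1f K1(2) _ y2(1)])
    let ?G = "generate_field ring_of_type_algebra (insert (y 2) K)"
    have "y 1 \<in> ?G"
      unfolding y2p[symmetric] by (intro subring_set_power[OF subring_set_generate_field] generate_field.incl) simp
    then show "K1 \<subseteq> ?G"
      unfolding K1_def by (intro powers_span_closed subring_set_generate_field) (auto intro: generate_field.incl)
  qed
  have Kn1: "Kn 1 = ring_on K1" and Kn2: "Kn 2 = ring_on K2" unfolding Kn_eq gen1 gen2 by simp_all
  have cR: "cring R"
    using R(1) unfolding discrete_valuation_ring_def
    by (auto dest: principal_domain.axioms(1) domain.axioms(1))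

  interpret S1: tensor_root K "y 1" p R \<phi> i\<^sub>1 j\<^sub>1
    by (rule tensor_root.intro) (fact prime char(1) Kf y1 cR R(2) T1[unfolded Kn1 K1_def])+
  have \<iota>1: "\<iota>\<^sub>1 = S1.\<iota>" and \<kappa>1: "\<kappa>\<^sub>1 = S1.\<kappa>" unfolding maps1 S1.\<iota>_def S1.\<kappa>_def by simp_all
  note \<kappa>1_hom = S1.\<kappa>_hom[folded K1_def \<kappa>1]
  define A where "A = \<iota>\<^sub>1 ` carrier R"
  obtain r where r: "r \<in> carrier R" "uniformizer R r" "dvr_set A (\<iota>\<^sub>1 r)" "maximalideal (max_ideal R) R"
    "\<And>a. a \<in> carrier R \<Longrightarrow> a \<in> max_ideal R \<longleftrightarrow> \<iota>\<^sub>1 a / \<iota>\<^sub>1 r \<in> A"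
    using S1.dvr_set_emb[OF R(1)] unfolding A_def \<iota>1 by metis
  define t where "t = \<iota>\<^sub>1 r"
  have dvrA: "dvr_set A t" using r(3) unfolding t_def .
  define B1 where "B1 = {z :: 't fract. z ^ p \<in> A}"
  have R1: "R\<^sub>1 = ring_on B1"
    unfolding R1_eq B1_def A_def \<iota>1 S1.normalization_eq[OF dvrA[unfolded A_def \<iota>1]] ..
  \<comment> \<open>Here finiteness of \<open>R\<^sub>1\<close> over \<open>R\<close> enters: it
    limits how closely the image of \<open>x\<close> is approximated by \<open>p\<close>-th
    powers.\<close>
  have bounded1: "\<exists>N. \<forall>a\<in>A. (\<kappa>\<^sub>1 (y 1) ^ p - a ^ p) / t ^ N \<notin> A"
  proof -
    obtain S where S: "finite S" "S \<subseteq> B1"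
      "\<And>b. b \<in> B1 \<Longrightarrow> \<exists>c\<in>S \<rightarrow> carrier R. b = (\<Oplus>\<^bsub>ring_on B1\<^esub>s\<in>S. \<iota>\<^sub>1 (c s) * s)"
      using R1_finite unfolding finite_over_def R1 by auto
    have A_ring: "subring_set A" unfolding A_def \<iota>1 by (rule S1.subring_set_emb)
    have AB: "A \<subseteq> B1" unfolding B1_def using subring_set_power[OF A_ring] by blast
    have B1_ring: "subring_set B1"
      unfolding subring_set_def B1_def
      using subring_set_1[OF A_ring] subring_set_diff[OF A_ring] subring_set_mult[OF A_ring]
      by (auto simp: CHAR_prime_power_diff[OF prime S1.char_fract] power_mult_distrib)
    have "\<exists>c. (\<forall>s\<in>S. c s \<in> A) \<and> b = (\<Sum>s\<in>S. c s * s)" if b: "b ^ p \<in> A" for b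
    proof -
      have "b \<in> B1" using b unfolding B1_def by simp
      from S(3)[OF this] obtain c where c: "c \<in> S \<rightarrow> carrier R" "b = (\<Oplus>\<^bsub>ring_on B1\<^esub>s\<in>S. \<iota>\<^sub>1 (c s) * s)" by blast
      have cA: "\<iota>\<^sub>1 (c s) \<in> A" if "s \<in> S" for s unfolding A_def using c(1) that by blast
      have "b = (\<Sum>s\<in>S. \<iota>\<^sub>1 (c s) * s)"
        unfolding c(2) using cA AB S(2)
        by (intro finsum_ring_on[OF B1_ring] subring_set_mult[OF B1_ring]) auto
      then show ?thesis using cA by (intro exI[of _ "\<lambda>s. \<iota>\<^sub>1 (c s)"]) simp
    qed
    from S1.bounded_if_finite[OF dvrA[unfolded A_def \<iota>1] S(1) this[unfolded A_def \<iota>1]]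
    show ?thesis unfolding A_def \<iota>1 \<kappa>1 .
  qed
  have "inseparable_step A t (\<kappa>\<^sub>1 ` K) (\<kappa>\<^sub>1 (y 1)) p"
    using S1.step[OF dvrA[unfolded A_def \<iota>1]] bounded1 unfolding A_def \<iota>1 \<kappa>1 .
  then interpret I1: inseparable_step A t "\<kappa>\<^sub>1 ` K" "\<kappa>\<^sub>1 (y 1)" p .
  obtain m a u where "a \<in> A" "I1.unit_in u" "\<kappa>\<^sub>1 (y 1) ^ p - a ^ p = u * t ^ m"
    "\<forall>b\<in>A. \<forall>n. (\<kappa>\<^sub>1 (y 1) ^ p - b ^ p) / t ^ n \<in> A \<longrightarrow> n \<le> m"
    using I1.optimal_approximation by blast
  then interpret O1: optimal_step A t "\<kappa>\<^sub>1 ` K" "\<kappa>\<^sub>1 (y 1)" p m a u by unfold_locales blast+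
  have IB: "I1.B = B1" unfolding I1.B_def B1_def ..
  have "\<kappa>\<^sub>1 ` K1 = powers_span (\<kappa>\<^sub>1 ` K) (\<kappa>\<^sub>1 (y 1)) p" unfolding K1_def \<kappa>1 by (rule S1.\<kappa>_K1)
  then have Ik1: "I1.k1 = \<kappa>\<^sub>1 ` K1" unfolding I1.k1_def by simp
  have "range to_fract = powers_span A (\<kappa>\<^sub>1 (y 1)) p" unfolding A_def \<iota>1 \<kappa>1 by (rule S1.range_to_fract)
  then have IT: "I1.T = range to_fract" unfolding I1.T_def by simp
  have kK: "\<kappa>\<^sub>1 ` K = (\<lambda>c. \<iota>\<^sub>1 (\<phi> c)) ` K" using S1.\<kappa>_K unfolding \<iota>1 \<kappa>1 by auto
  obtain d where d: "qdim (\<kappa>\<^sub>1 ` K) A (I1.t_ideal 1) d"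
  proof -
    have "\<exists>d. qdim ((\<lambda>c. S1.\<iota> (\<phi> c)) ` K) (S1.\<iota> ` carrier R) (dvr_set.t_ideal (S1.\<iota> ` carrier R) t 1) d"
    proof (rule S1.residue_dimension_exists[OF r(4) dvrA[unfolded A_def \<iota>1] _ S1.\<phi>_closed])
      show "a \<in> max_ideal R \<longleftrightarrow> S1.\<iota> a / t \<in> S1.\<iota> ` carrier R" if "a \<in> carrier R" for a
        using r(5)[OF that] unfolding t_def A_def \<iota>1 .
      show "subring_set ((\<lambda>c. S1.\<iota> (\<phi> c)) ` K)" using I1.k_subring unfolding kK \<iota>1 .
      show "finite_over (residue R \<circ> \<phi>) (ring_on K) (residue_field R)" using L_finite unfolding L_eq .
    qed
    then show thesis using that unfolding kK A_def \<iota>1 by blast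
  qed
  obtain s v e where s: "dvr_set B1 s" "I1.unit_in v" "s ^ p = v * t ^ e"
    and e: "e = 1 \<and> \<not> p dvd m \<or> e = p \<and> p dvd m \<and> s = t"
    and dim1: "\<exists>d1. qdim I1.k1 I1.B {z. z / s \<in> I1.B} d1 \<and> p * d1 = e * d"
    using O1.uniformizer_exists[unfolded IB] d unfolding IB by metis
  obtain d1 where d1: "qdim I1.k1 I1.B {z. z / s \<in> I1.B} d1" "p * d1 = e * d" using dim1 by blast
  interpret D1: dvr_set B1 s by (rule s(1))
  have e0: "e > 0" using e p0 by auto
  have AB: "A \<subseteq> B1" using I1.A_subset_B unfolding IB .
  have unitB: "D1.unit_in w" if "I1.unit_in w" for w
    using that AB unfolding I1.unit_in_def D1.unit_in_def by blast
  \<comment> \<open>The ramification index is \<open>p / e\<close>: for \<open>e = 1\<close> the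
    uniformizer \<open>t\<close> is a unit times \<open>s ^ p\<close>, and for \<open>e = p\<close>
    it equals \<open>s\<close>.\<close>
  have e1_eq: "e\<^sub>1 = (if p dvd m then 1 else p)"
  proof -
    have sub: "\<iota>\<^sub>1 ` carrier R \<subseteq> B1" using AB unfolding A_def .
    note ram = D1.ramification_index_eq[OF S1.embedding[folded \<iota>1] sub r(2)]
    show ?thesis
    proof (cases "p dvd m")
      case True
      then have "s = t" using e p1 by auto
      then have "\<iota>\<^sub>1 r = 1 * s ^ 1" unfolding t_def by simp
      from ram[OF this D1.unit_in_1] show ?thesis unfolding e1 R1 using True by simp
    next
      case False
      then have "e = 1" using e by blast
      have "v \<noteq> 0" using s(2) unfolding I1.unit_in_def by simp
      then have "\<iota>\<^sub>1 r = inverse v * s ^ p" unfolding s(3) \<open>e = 1\<close> t_def by simp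
      from ram[OF this D1.unit_in_inverse[OF unitB[OF s(2)]]] show ?thesis unfolding e1 R1 using False by simp
    qed
  qed
  have g10_eq: "g\<^sub>1\<^sub>0 = enat g" if "qdim I1.k1 I1.B I1.T g" for g
  proof -
    have "quotient_dim \<kappa>\<^sub>1 (ring_on K1) (ring_on B1) I1.T = enat g"
    proof (rule quotient_dim_eq[OF \<kappa>1_hom K1(1)])
      show "subfield_set (\<kappa>\<^sub>1 ` K1)" using I1.k1_subfield unfolding Ik1 .
      show "subring_set B1" by (rule D1.A)
      show "\<kappa>\<^sub>1 ` K1 \<subseteq> B1" using I1.k1_subset_T I1.T_subset_B unfolding Ik1 IB by blast
      show "subspace_over (\<kappa>\<^sub>1 ` K1) I1.T" using O1.subspace_k1_T unfolding Ik1 .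
      show "qdim (\<kappa>\<^sub>1 ` K1) B1 I1.T g" using that unfolding Ik1 IB .
    qed
    then show ?thesis unfolding g10 Kn1 R1 IT .
  qed

  have cB: "cring (ring_on B1)" by (rule cring_ring_on[OF D1.A])
  have \<kappa>1_ring_hom: "\<kappa>\<^sub>1 \<in> ring_hom (ring_on K1) (ring_on B1)"
  proof -
    have "\<kappa>\<^sub>1 c \<in> B1" if "c \<in> K1" for c
      using that I1.k1_subset_T I1.T_subset_B unfolding Ik1 IB by blast
    then show ?thesis
      using inj_hom_on_1[OF \<kappa>1_hom K1(1)] inj_hom_on_add[OF \<kappa>1_hom K1(1)] inj_hom_on_mult[OF \<kappa>1_hom K1(1)]
      by (intro ring_hom_memI) simp_all
  qed
  interpret S2: tensor_root K1 "y 2" p "ring_on B1" \<kappa>\<^sub>1 i\<^sub>2 j\<^sub>2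
    by (rule tensor_root.intro) (fact prime char(1) K1f y2 cB \<kappa>1_ring_hom T2[unfolded Kn1 Kn2 K2_def R1])+
  have \<iota>2: "\<iota>\<^sub>2 = S2.\<iota>" and \<kappa>2: "\<kappa>\<^sub>2 = S2.\<kappa>" unfolding maps2 S2.\<iota>_def S2.\<kappa>_def by simp_all
  note \<kappa>2_hom = S2.\<kappa>_hom[folded K2_def \<kappa>2]
  have h: "inj_hom_on B1 \<iota>\<^sub>2"
  proof -
    have "S2.\<iota> (a - b) = S2.\<iota> a - S2.\<iota> b" if "a \<in> B1" "b \<in> B1" for a b
      using S2.emb_add[of "a - b" b] subring_set_diff[OF D1.A that] that by simp
    then show ?thesis unfolding inj_hom_on_def \<iota>2 using S2.emb_one S2.emb_mult S2.inj by simp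
  qed
  have yy: "\<kappa>\<^sub>2 (y 2) ^ p = \<iota>\<^sub>2 (\<kappa>\<^sub>1 (y 1))"
    using S2.\<kappa>_y_power(1) S2.\<kappa>_K[OF y2(1)] unfolding \<iota>2 \<kappa>2 y2p by simp
  have dvr2: "dvr_set (\<iota>\<^sub>2 ` B1) (\<iota>\<^sub>2 s)" by (rule D1.image_dvr_set[OF h])
  \<comment> \<open>The base field of the second step is the extended field of the first, seen
    through \<open>\<iota>\<^sub>2\<close>.\<close>
  have kk: "\<kappa>\<^sub>2 ` K1 = \<iota>\<^sub>2 ` I1.k1"
    unfolding Ik1 image_image using S2.\<kappa>_K unfolding \<iota>2 \<kappa>2 by (intro image_cong) auto
  have "\<exists>N. \<forall>c\<in>\<iota>\<^sub>2 ` B1. (\<kappa>\<^sub>2 (y 2) ^ p - c ^ p) / \<iota>\<^sub>2 s ^ N \<notin> \<iota>\<^sub>2 ` B1"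
    using O1.second_step_bounded[unfolded IB, OF s h yy e0] .
  then have "inseparable_step (\<iota>\<^sub>2 ` B1) (\<iota>\<^sub>2 s) (\<kappa>\<^sub>2 ` K1) (\<kappa>\<^sub>2 (y 2)) p"
    using S2.step[of "\<iota>\<^sub>2 s"] dvr2 unfolding \<iota>2 \<kappa>2 by simp
  then have "inseparable_step (\<iota>\<^sub>2 ` B1) (\<iota>\<^sub>2 s) (\<iota>\<^sub>2 ` I1.k1) (\<kappa>\<^sub>2 (y 2)) p" unfolding kk .
  then interpret I2: inseparable_step "\<iota>\<^sub>2 ` B1" "\<iota>\<^sub>2 s" "\<iota>\<^sub>2 ` I1.k1" "\<kappa>\<^sub>2 (y 2)" p .
  obtain m2 a2 u2 where "a2 \<in> \<iota>\<^sub>2 ` B1" "I2.unit_in u2" "\<kappa>\<^sub>2 (y 2) ^ p - a2 ^ p = u2 * \<iota>\<^sub>2 s ^ m2"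
    "\<forall>b\<in>\<iota>\<^sub>2 ` B1. \<forall>n. (\<kappa>\<^sub>2 (y 2) ^ p - b ^ p) / \<iota>\<^sub>2 s ^ n \<in> \<iota>\<^sub>2 ` B1 \<longrightarrow> n \<le> m2"
    using I2.optimal_approximation by blast
  then interpret O2: optimal_step "\<iota>\<^sub>2 ` B1" "\<iota>\<^sub>2 s" "\<iota>\<^sub>2 ` I1.k1" "\<kappa>\<^sub>2 (y 2)" p m2 a2 u2 by unfold_locales blast+
  define B2 where "B2 = {z :: 'u fract. z ^ p \<in> \<iota>\<^sub>2 ` B1}"
  have IB2: "I2.B = B2" unfolding I2.B_def B2_def ..
  have R2: "R\<^sub>2 = ring_on B2"
    using S2.normalization_eq[of "\<iota>\<^sub>2 s"] dvr2 unfolding R2_eq B2_def \<iota>2 by simp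
  have "\<kappa>\<^sub>2 ` K2 = powers_span (\<kappa>\<^sub>2 ` K1) (\<kappa>\<^sub>2 (y 2)) p" unfolding K2_def \<kappa>2 by (rule S2.\<kappa>_K1)
  then have Ik2: "I2.k1 = \<kappa>\<^sub>2 ` K2" unfolding I2.k1_def kk by simp
  have "range to_fract = powers_span (\<iota>\<^sub>2 ` carrier (ring_on B1)) (\<kappa>\<^sub>2 (y 2)) p"
    unfolding \<iota>2 \<kappa>2 by (rule S2.range_to_fract)
  then have IT2: "I2.T = range to_fract" unfolding I2.T_def by simp
  have S2_emb: "field_embedding (ring_on B1) \<iota>\<^sub>2" unfolding \<iota>2 by (rule S2.embedding)
  have K2r: "subring_set K2" unfolding K2_def by (rule S2.K1(1))
  have e2_eq: "e\<^sub>2 = (if p dvd m2 then 1 else p)"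
  proof -
    obtain s2 v2 f2 where s2: "dvr_set B2 s2" "I2.unit_in v2" "s2 ^ p = v2 * \<iota>\<^sub>2 s ^ f2"
      and f2: "f2 = 1 \<and> \<not> p dvd m2 \<or> f2 = p \<and> p dvd m2 \<and> s2 = \<iota>\<^sub>2 s"
      using O2.uniformizer_exists[unfolded IB2] by metis
    interpret D2: dvr_set B2 s2 by (rule s2(1))
    have sub: "\<iota>\<^sub>2 ` B1 \<subseteq> B2" using I2.A_subset_B unfolding IB2 .
    then have sub': "\<iota>\<^sub>2 ` carrier (ring_on B1) \<subseteq> B2" by simp
    have unit: "D2.unit_in w" if "I2.unit_in w" for w
      using that sub unfolding I2.unit_in_def D2.unit_in_def by blast
    note ram = D2.ramification_index_eq[OF S2_emb sub' D1.uniformizer_ring_on]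
    show ?thesis
    proof (cases "p dvd m2")
      case True
      then have "\<iota>\<^sub>2 s = 1 * s2 ^ 1" using f2 p1 by auto
      from ram[OF this D2.unit_in_1] show ?thesis unfolding e2 R1 R2 using True by simp
    next
      case False
      then have "f2 = 1" using f2 by blast
      have "v2 \<noteq> 0" using s2(2) unfolding I2.unit_in_def by simp
      then have "\<iota>\<^sub>2 s = inverse v2 * s2 ^ p" unfolding s2(3) \<open>f2 = 1\<close> by simp
      from ram[OF this D2.unit_in_inverse[OF unit[OF s2(2)]]] show ?thesis unfolding e2 R1 R2 using False by simp
    qed
  qed
  have g21_eq: "g\<^sub>2\<^sub>1 = enat g" if "qdim I2.k1 I2.B I2.T g" for g
  proof -
    have "quotient_dim \<kappa>\<^sub>2 (ring_on K2) (ring_on B2) I2.T = enat g"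
    proof (rule quotient_dim_eq[OF \<kappa>2_hom K2r])
      show "subfield_set (\<kappa>\<^sub>2 ` K2)" using I2.k1_subfield unfolding Ik2 .
      show "subring_set B2" using I2.B_subring unfolding IB2 .
      show "\<kappa>\<^sub>2 ` K2 \<subseteq> B2" using I2.k1_subset_T I2.T_subset_B unfolding Ik2 IB2 by blast
      show "subspace_over (\<kappa>\<^sub>2 ` K2) I2.T" using O2.subspace_k1_T unfolding Ik2 .
      show "qdim (\<kappa>\<^sub>2 ` K2) B2 I2.T g" using that unfolding Ik2 IB2 .
    qed
    then show ?thesis unfolding g21 Kn2 R2 IT2 .
  qed
  have generator: "\<exists>\<alpha>. \<alpha> ^ p \<in> \<iota>\<^sub>2 ` B1 \<and>
      (\<forall>w. w ^ p \<in> \<iota>\<^sub>2 ` B1 \<longrightarrow> (\<exists>f. coeffs_in (\<iota>\<^sub>2 ` A) f \<and> ((w - poly f \<alpha>) / \<iota>\<^sub>2 t) ^ p \<in> \<iota>\<^sub>2 ` B1))"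
    if dvd: "p dvd m" "p dvd m2"
      and simple: "simple_field_extension L\<^sub>2 ((\<lambda>r. residue R\<^sub>2 (\<iota>\<^sub>2 (\<iota>\<^sub>1 r))) ` carrier R)"
  proof -
    have st: "s = t" using e dvd(1) p1 by auto
    interpret D2: dvr_set B2 "\<iota>\<^sub>2 t" using O2.unramified(1)[OF dvd(2)] unfolding IB2 st .
    have hA: "inj_hom_on A \<iota>\<^sub>2" by (rule inj_hom_on_subset[OF h AB])
    have img: "(\<lambda>r. residue R\<^sub>2 (\<iota>\<^sub>2 (\<iota>\<^sub>1 r))) ` carrier R = residue (ring_on B2) ` (\<iota>\<^sub>2 ` A)"
      unfolding A_def R2 image_image ..
    have "\<exists>\<alpha>\<in>B2. \<forall>w\<in>B2. \<exists>f. coeffs_in (\<iota>\<^sub>2 ` A) f \<and> (w - poly f \<alpha>) / \<iota>\<^sub>2 t \<in> B2"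
    \<comment> \<open>Two steps separate \<open>A\<close> from \<open>B2\<close>, so the exponent
      that leads back to the image of \<open>A\<close> is \<open>p * p\<close>.\<close>
    proof (rule D2.simple_residue_field_generator[where n = "p * p"])
      show "subring_set (\<iota>\<^sub>2 ` A)" by (rule subring_set_image[OF hA I1.A])
      show "\<iota>\<^sub>2 ` A \<subseteq> B2" using AB I2.A_subset_B unfolding IB2 by blast
      show "p * p > 0" using p0 by simp
      show "z ^ (p * p) \<in> \<iota>\<^sub>2 ` A" if z: "z \<in> B2" for z
      proof -
        obtain w where w: "w \<in> B1" "z ^ p = \<iota>\<^sub>2 w" using z unfolding B2_def by blast
        have "z ^ (p * p) = \<iota>\<^sub>2 (w ^ p)" unfolding power_mult w(2) inj_hom_on_power[OF h D1.A w(1)] ..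
        then show ?thesis using w(1) unfolding B1_def by blast
      qed
      show "inverse c \<in> \<iota>\<^sub>2 ` A" if c: "c \<in> \<iota>\<^sub>2 ` A" "c / \<iota>\<^sub>2 t \<notin> B2" for c
      proof -
        obtain a' where a': "a' \<in> A" "c = \<iota>\<^sub>2 a'" using c(1) by blast
        have "a' / t \<notin> A"
        proof
          assume "a' / t \<in> A"
          then have "a' / s ^ 1 \<in> B1" using AB st by auto
          then have "\<iota>\<^sub>2 a' / \<iota>\<^sub>2 s ^ 1 \<in> \<iota>\<^sub>2 ` B1"
            using D1.image_div_iff[OF h, of a' 1] a'(1) AB by blast
          then show False using c(2) I2.A_subset_B unfolding a'(2) st IB2 by auto
        qed
        then have "I1.unit_in a'" using I1.unit_iff_not_div_t[OF a'(1)] by blast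
        then have "inverse a' \<in> A" unfolding I1.unit_in_def by simp
        then show ?thesis using inj_hom_on_inverse[OF hA I1.A a'(1)] unfolding a'(2) by (metis imageI)
      qed
      show "simple_field_extension (residue_field (ring_on B2)) (residue (ring_on B2) ` \<iota>\<^sub>2 ` A)"
        unfolding img[symmetric] using simple unfolding L_eq R2 .
    qed
    then show ?thesis unfolding B2_def by blast
  qed
  obtain g g' where g: "qdim I1.k1 I1.B I1.T g" "qdim I2.k1 I2.B I2.T g'"
    and cmp: "(\<not> p dvd m \<and> \<not> p dvd m2 \<longrightarrow> p * g' = g) \<and>
    (\<not> p dvd m \<and> p dvd m2 \<longrightarrow> p * g' \<le> g) \<and>
    (p dvd m \<and> p dvd m2 \<longrightarrow> p * g' \<le> g \<and>
      ((\<exists>\<alpha>. \<alpha> ^ p \<in> \<iota>\<^sub>2 ` B1 \<and>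
        (\<forall>w. w ^ p \<in> \<iota>\<^sub>2 ` B1 \<longrightarrow> (\<exists>f. coeffs_in (\<iota>\<^sub>2 ` A) f \<and> ((w - poly f \<alpha>) / \<iota>\<^sub>2 t) ^ p \<in> \<iota>\<^sub>2 ` B1)))
        \<longrightarrow> p * g' = g)) \<and>
    (p dvd m \<and> \<not> p dvd m2 \<longrightarrow> p * g' + p * (p - 1) div 2 \<le> g)"
    using O1.two_step_comparison[unfolded IB, OF s e d d1[unfolded IB] h yy O2.optimal_step_axioms]
    unfolding I2.k1_def I2.B_def I2.T_def IB by blast
  have g10': "g\<^sub>1\<^sub>0 = enat g" and g21': "g\<^sub>2\<^sub>1 = enat g'" by (rule g10_eq[OF g(1)] g21_eq[OF g(2)])+
  \<comment> \<open>Since \<open>p > 1\<close>, the values 1 and \<open>p\<close> of a ramification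
    index exclude each other, so the cases of the claim are those of divisibility of
    \<open>m\<close> and \<open>m2\<close>.\<close>
  have ram: "e\<^sub>1 = p \<longleftrightarrow> \<not> p dvd m" "e\<^sub>1 = 1 \<longleftrightarrow> p dvd m" "e\<^sub>2 = p \<longleftrightarrow> \<not> p dvd m2" "e\<^sub>2 = 1 \<longleftrightarrow> p dvd m2"
    unfolding e1_eq e2_eq using p1 by auto
  show ?thesis
    unfolding ram g10' g21' times_enat_simps plus_enat_simps enat_ord_simps enat.inject
    using cmp generator by blast
qed

end
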